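(* Let $\mathscr B$ be a translation invariant BF-space on $\mathbf R^d$ and let $f\in\mathscr D'(\mathbf R^d)$. Then $$\operatorname{WF}_{\mathscr F\mathscr B}(f)=\bigcap_{g\in\mathscr F\mathscr B}\operatorname{WF}_A(f-g).$$
   Context: Weights. For positive $\omega,v\in L^\infty_{loc}(\mathbf R^d)$, $\omega$ is $v$-moderate if $\omega(x+y)\le C\omega(x)v(y)$ for all $x,y$, with $C$ independent of $x,y$. $\mathscr P(\mathbf R^d)$ is the set of all $\omega$ that are $v$-moderate for some polynomial $v$. $v$ is submultiplicative if it is $v$-moderate; submultiplicative weights are assumed even. $L^1_{(v)}$ is the set of $f\in L^1_{loc}$ with $fv\in L^1$. BF-spaces. A Banach space $\mathscr B$ of complex-valued measurable functions on $\mathbf R^d$ is a translation invariant BF-space (with respect to some submultiplicative weight $v\in\mathscr P(\mathbf R^d)$) if there is a constant $C$ such that: (1) $\mathscr S\subseteq\mathscr B\subseteq\mathscr S'$ with continuous embeddings; (2) if $x\in\mathbf R^d$, $f\in\mathscr B$, then $f(\cdot-x)\in\mathscr B$ and $\|f(\cdot-x)\|_{\mathscr B}\le Cv(x)\|f\|_{\mathscr B}$; (3) if $f,g\in L^1_{loc}$, $g\in\mathscr B$ and $|f|\le|g|$ a.e., then $f\in\mathscr B$ and $\|f\|_{\mathscr B}\le C\|g\|_{\mathscr B}$. Standing assumption: convolution on $\mathscr S$ extends uniquely to a continuous map $\mathscr B\times L^1_{(v)}\to\mathscr B$, with $\|\varphi*f\|_{\mathscr B}\le C\|\varphi\|_{L^1_{(v)}}\|f\|_{\mathscr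 B}$. Fourier transform: $\widehat f(\xi)=\mathscr Ff(\xi)=(2\pi)^{-d/2}\int f(x)e^{-i\langle x,\xi\rangle}dx$, extended to $\mathscr S'$. $\mathscr F\mathscr B$ is the space of $f\in\mathscr S'(\mathbf R^d)$ with $\widehat f\in\mathscr B$. $\operatorname{WF}_{\mathscr F\mathscr B}(f)$ consists of all $(x_0,\xi_0)\in\mathbf R^d\times(\mathbf R^d\setminus0)$ such that $\|\mathscr F(\varphi f)\chi_{\Gamma}\|_{\mathscr B}=\infty$ (i.e. the function is not in $\mathscr B$) for every open conical neighbourhood $\Gamma$ of $\xi_0$ and every $\varphi\in C_0^\infty(\mathbf R^d)$ equal to $1$ in some open neighbourhood of $x_0$; $\chi_\Gamma$ is the characteristic function of $\Gamma$. $\operatorname{WF}_A(u)$ is the (Hörmander) analytic wave-front set: $(x_0,\xi_0)\notin\operatorname{WF}_A(u)$ iff there are a neighbourhood $U$ of $x_0$, an open conical neighbourhood $\Gamma$ of $\xi_0$, a constant $C$ and a bounded sequence $u_N\in\mathscr E'$ with $u_N=u$ in $U$ and $|\widehat u_N(\xi)|\le C\big(C(N+1)/|\xi|\big)^N$ for $\xi\in\Gamma$, $N=1,2,\dots$ *)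

theory Defs
  imports "HOL-Analysis.Analysis"
begin

text \<open>
  Distributions on \<open>real ^ 'd\<close> are represented by functionals on all functions
  \<open>real ^ 'd \<Rightarrow> complex\<close>. A functional is only ever evaluated on the relevant test space,
  and linearity and continuity are only required there; its values elsewhere are irrelevant.
\<close>

type_synonym 'd fn = "real ^ 'd \<Rightarrow> complex"
type_synonym 'd functional = "'d fn \<Rightarrow> complex"


section \<open>Test function spaces\<close>

definition partial :: "'d::finite \<Rightarrow> 'd fn \<Rightarrow> 'd fn" where
  "partial i \<phi> x = frechet_derivative \<phi> (at x) (axis i 1)"

text \<open>
  Multi-indices are lists of coordinate directions. For smooth functions the order is
  immaterial, so a list represents the multi-index that counts its entries, and sums over
  lists of length at most \<open>m\<close> just repeat the terms with \<open>|\<alpha>| \<le> m\<close>.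
\<close>

definition partials :: "'d::finite list \<Rightarrow> 'd fn \<Rightarrow> 'd fn" where
  "partials \<alpha> = foldr partial \<alpha>"

definition smooth_fns :: "'d::finite fn set" where
  "smooth_fns = {\<phi>. \<forall>\<alpha> x. partials \<alpha> \<phi> differentiable (at x)}"

definition supp :: "'d::finite fn \<Rightarrow> (real ^ 'd) set" where
  "supp \<phi> = closure {x. \<phi> x \<noteq> 0}"

definition test_fns :: "'d::finite fn set" where
  "test_fns = {\<phi> \<in> smooth_fns. compact (supp \<phi>)}"

definition schwartz_fns :: "'d::finite fn set" where
  "schwartz_fns = {\<phi> \<in> smooth_fns. \<forall>\<alpha> k. bounded (range (\<lambda>x. norm x ^ k *\<^sub>R partials \<alpha> \<phi> x))}"

definition test_seminorm :: "nat \<Rightarrow> 'd::finite fn \<Rightarrow> real" where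
  "test_seminorm m \<phi> = (\<Sum>\<alpha> | length \<alpha> \<le> m. SUP x. norm (partials \<alpha> \<phi> x))"

definition schwartz_seminorm :: "nat \<Rightarrow> 'd::finite fn \<Rightarrow> real" where
  "schwartz_seminorm m \<phi> =
     (\<Sum>\<alpha> | length \<alpha> \<le> m. SUP x. (1 + norm x) ^ m * norm (partials \<alpha> \<phi> x))"

text \<open>Uniform convergence of all derivatives on compact sets, exhausting by closed balls.\<close>

definition smooth_seminorm :: "nat \<Rightarrow> 'd::finite fn \<Rightarrow> real" where
  "smooth_seminorm m \<phi> =
     (\<Sum>\<alpha> | length \<alpha> \<le> m. SUP x\<in>cball 0 (real m). norm (partials \<alpha> \<phi> x))"

definition bounded_schwartz :: "'d::finite fn set \<Rightarrow> bool" where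
  "bounded_schwartz M \<longleftrightarrow>
     M \<subseteq> schwartz_fns \<and> (\<forall>m. \<exists>c. \<forall>\<phi>\<in>M. schwartz_seminorm m \<phi> \<le> c)"

definition bounded_smooth :: "'d::finite fn set \<Rightarrow> bool" where
  "bounded_smooth M \<longleftrightarrow>
     M \<subseteq> smooth_fns \<and> (\<forall>m. \<exists>c. \<forall>\<phi>\<in>M. smooth_seminorm m \<phi> \<le> c)"


section \<open>Distributions\<close>

definition linear_functional_on :: "'d::finite fn set \<Rightarrow> 'd functional \<Rightarrow> bool" where
  "linear_functional_on V u \<longleftrightarrow>
     (\<forall>\<phi>\<in>V. \<forall>\<psi>\<in>V. u (\<lambda>x. \<phi> x + \<psi> x) = u \<phi> + u \<psi>) \<and>
     (\<forall>c. \<forall>\<phi>\<in>V. u (\<lambda>x. c * \<phi> x) = c * u \<phi>)"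

definition distribution :: "'d::finite functional \<Rightarrow> bool" where
  "distribution u \<longleftrightarrow> linear_functional_on test_fns u \<and>
     (\<forall>K. compact K \<longrightarrow>
       (\<exists>C m. \<forall>\<phi>\<in>test_fns. supp \<phi> \<subseteq> K \<longrightarrow> norm (u \<phi>) \<le> C * test_seminorm m \<phi>))"

definition tempered_distribution :: "'d::finite functional \<Rightarrow> bool" where
  "tempered_distribution u \<longleftrightarrow> linear_functional_on schwartz_fns u \<and>
     (\<exists>C m. \<forall>\<phi>\<in>schwartz_fns. norm (u \<phi>) \<le> C * schwartz_seminorm m \<phi>)"

text \<open>The space \<open>\<E>'\<close>, as the dual of the Frechet space of all smooth functions.\<close>

definition compact_distribution :: "'d::finite functional \<Rightarrow> bool" where
  "compact_distribution u \<longleftrightarrow> linear_functional_on smooth_fns u \<and>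
     (\<exists>C m. \<forall>\<phi>\<in>smooth_fns. norm (u \<phi>) \<le> C * smooth_seminorm m \<phi>)"

text \<open>Boundedness in \<open>\<E>'\<close> with its strong dual topology.\<close>

definition bounded_compact_distributions :: "'d::finite functional set \<Rightarrow> bool" where
  "bounded_compact_distributions F \<longleftrightarrow> (\<forall>u\<in>F. compact_distribution u) \<and>
     (\<forall>M. bounded_smooth M \<longrightarrow> (\<exists>c. \<forall>u\<in>F. \<forall>\<phi>\<in>M. norm (u \<phi>) \<le> c))"

definition equal_on_open :: "(real ^ 'd) set \<Rightarrow> 'd::finite functional \<Rightarrow> 'd functional \<Rightarrow> bool" where
  "equal_on_open U u w \<longleftrightarrow> (\<forall>\<phi>\<in>test_fns. supp \<phi> \<subseteq> U \<longrightarrow> u \<phi> = w \<phi>)"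

definition mult_distribution :: "'d::finite fn \<Rightarrow> 'd functional \<Rightarrow> 'd functional" where
  "mult_distribution \<phi> u = (\<lambda>\<psi>. u (\<lambda>x. \<phi> x * \<psi> x))"

definition locally_integrable :: "(real ^ 'd::finite \<Rightarrow> complex) \<Rightarrow> bool" where
  "locally_integrable h \<longleftrightarrow> h \<in> borel_measurable lebesgue \<and>
     (\<forall>K. compact K \<longrightarrow> set_integrable lebesgue K h)"

text \<open>The distribution \<open>u\<close> is (given by) the function \<open>h\<close>.\<close>

definition is_function :: "'d::finite functional \<Rightarrow> 'd fn \<Rightarrow> bool" where
  "is_function u h \<longleftrightarrow> locally_integrable h \<and>
     (\<forall>\<phi>\<in>test_fns. u \<phi> = (LINT x|lebesgue. h x * \<phi> x))"


section \<open>Fourier transform\<close>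

definition fourier_const :: "'d::finite itself \<Rightarrow> real" where
  "fourier_const _ = (2 * pi) powr (- (real CARD('d) / 2))"

definition fourier :: "'d::finite fn \<Rightarrow> 'd fn" where
  "fourier \<phi> \<xi> = fourier_const TYPE('d) *\<^sub>R (LINT x|lebesgue. \<phi> x * exp (- \<i> * complex_of_real (x \<bullet> \<xi>)))"

definition fourier_tempered :: "'d::finite functional \<Rightarrow> 'd functional" where
  "fourier_tempered u = (\<lambda>\<phi>. u (fourier \<phi>))"

text \<open>
  The Fourier transform of an element of \<open>\<E>'\<close> is the smooth function obtained by pairing
  it with the exponentials.
\<close>

definition fourier_compact :: "'d::finite functional \<Rightarrow> 'd fn" where
  "fourier_compact u \<xi> = fourier_const TYPE('d) *\<^sub>R u (\<lambda>x. exp (- \<i> * complex_of_real (x \<bullet> \<xi>)))"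


section \<open>Weights\<close>

definition weight :: "(real ^ 'd::finite \<Rightarrow> real) \<Rightarrow> bool" where
  "weight w \<longleftrightarrow> (\<forall>x. w x > 0) \<and> w \<in> borel_measurable lebesgue \<and>
     (\<forall>K. compact K \<longrightarrow> (\<exists>c. AE x in lebesgue. x \<in> K \<longrightarrow> w x \<le> c))"

definition moderate :: "(real ^ 'd::finite \<Rightarrow> real) \<Rightarrow> (real ^ 'd \<Rightarrow> real) \<Rightarrow> bool" where
  "moderate v w \<longleftrightarrow> weight v \<and> weight w \<and> (\<exists>C. \<forall>x y. w (x + y) \<le> C * w x * v y)"

definition poly_moderate_weights :: "(real ^ 'd::finite \<Rightarrow> real) set" where
  "poly_moderate_weights = {w. \<exists>p. real_polynomial_function p \<and> moderate p w}"

definition submultiplicative_weight :: "(real ^ 'd::finite \<Rightarrow> real) \<Rightarrow> bool" where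
  "submultiplicative_weight v \<longleftrightarrow> moderate v v \<and> (\<forall>x. v (- x) = v x)"

definition weighted_L1 :: "(real ^ 'd::finite \<Rightarrow> real) \<Rightarrow> 'd fn set" where
  "weighted_L1 v = {f. locally_integrable f \<and> integrable lebesgue (\<lambda>x. f x * complex_of_real (v x))}"

definition weighted_L1_norm :: "(real ^ 'd::finite \<Rightarrow> real) \<Rightarrow> 'd fn \<Rightarrow> real" where
  "weighted_L1_norm v f = (LINT x|lebesgue. norm (f x) * v x)"


section \<open>Translation invariant BF-spaces\<close>

text \<open>
  Spaces of measurable functions are given by a carrier \<open>B\<close> of actual functions and a function
  \<open>nrm\<close> that is a norm on \<open>B\<close> once functions that agree almost everywhere are identified.
\<close>

definition banach_function_space :: "'d::finite fn set \<Rightarrow> ('d fn \<Rightarrow> real) \<Rightarrow> bool" where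
  "banach_function_space B nrm \<longleftrightarrow>
     B \<subseteq> borel_measurable lebesgue \<and>
     (\<lambda>x. 0) \<in> B \<and>
     (\<forall>f\<in>B. \<forall>g\<in>B. (\<lambda>x. f x + g x) \<in> B \<and> nrm (\<lambda>x. f x + g x) \<le> nrm f + nrm g) \<and>
     (\<forall>c. \<forall>f\<in>B. (\<lambda>x. c * f x) \<in> B \<and> nrm (\<lambda>x. c * f x) = norm c * nrm f) \<and>
     (\<forall>f\<in>B. nrm f \<ge> 0 \<and> (nrm f = 0 \<longleftrightarrow> (AE x in lebesgue. f x = 0))) \<and>
     (\<forall>F. range F \<subseteq> B \<and> (\<forall>e>0. \<exists>n0. \<forall>m\<ge>n0. \<forall>n\<ge>n0. nrm (\<lambda>x. F m x - F n x) < e) \<longrightarrow>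
        (\<exists>f\<in>B. (\<lambda>n. nrm (\<lambda>x. F n x - f x)) \<longlonglongrightarrow> 0))"

definition schwartz_embeds :: "'d::finite fn set \<Rightarrow> ('d fn \<Rightarrow> real) \<Rightarrow> bool" where
  "schwartz_embeds B nrm \<longleftrightarrow> schwartz_fns \<subseteq> B \<and>
     (\<exists>C m. \<forall>\<phi>\<in>schwartz_fns. nrm \<phi> \<le> C * schwartz_seminorm m \<phi>)"

text \<open>Continuity of the embedding into \<open>\<S>'\<close> refers to the strong dual topology.\<close>

definition embeds_tempered :: "'d::finite fn set \<Rightarrow> ('d fn \<Rightarrow> real) \<Rightarrow> bool" where
  "embeds_tempered B nrm \<longleftrightarrow>
     (\<forall>f\<in>B. \<exists>u. tempered_distribution u \<and> is_function u f) \<and>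
     (\<forall>M. bounded_schwartz M \<longrightarrow>
       (\<exists>C. \<forall>f\<in>B. \<forall>u. tempered_distribution u \<and> is_function u f \<longrightarrow>
          (\<forall>\<phi>\<in>M. norm (u \<phi>) \<le> C * nrm f)))"

definition convolve :: "'d::finite fn \<Rightarrow> 'd fn \<Rightarrow> 'd fn" where
  "convolve \<phi> f x = (LINT y|lebesgue. \<phi> y * f (x - y))"

text \<open>
  The last conjunct is the standing assumption that convolution extends to a continuous map
  \<open>B \<times> L\<^sup>1\<^sub>(\<^sub>v\<^sub>) \<rightarrow> B\<close>. Given the other conjuncts, \<open>\<phi> * f\<close> is defined almost everywhere by an
  absolutely convergent integral for all \<open>f\<close> in \<open>B\<close> and \<open>\<phi>\<close> in \<open>L\<^sup>1\<^sub>(\<^sub>v\<^sub>)\<close>. As the Schwartz functions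
  are dense in \<open>L\<^sup>1\<^sub>(\<^sub>v\<^sub>)\<close>, the map is then the only continuous extension of the convolution of
  Schwartz functions with elements of \<open>B\<close>. Uniqueness among extensions from pairs of Schwartz
  functions would in addition force these to be dense in \<open>B\<close>, which is not required.
\<close>

definition translation_invariant_BF_space ::
  "(real ^ 'd::finite \<Rightarrow> real) \<Rightarrow> 'd fn set \<Rightarrow> ('d fn \<Rightarrow> real) \<Rightarrow> bool" where
  "translation_invariant_BF_space v B nrm \<longleftrightarrow>
     submultiplicative_weight v \<and> v \<in> poly_moderate_weights \<and>
     banach_function_space B nrm \<and>
     (\<exists>C.
       schwartz_embeds B nrm \<and> embeds_tempered B nrm \<and>
       (\<forall>x. \<forall>f\<in>B. (\<lambda>y. f (y - x)) \<in> B \<and> nrm (\<lambda>y. f (y - x)) \<le> C * v x * nrm f) \<and>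
       (\<forall>f g. locally_integrable f \<and> locally_integrable g \<and> g \<in> B \<and>
              (AE x in lebesgue. norm (f x) \<le> norm (g x)) \<longrightarrow> f \<in> B \<and> nrm f \<le> C * nrm g) \<and>
       (\<forall>f\<in>B. \<forall>\<phi>\<in>weighted_L1 v. convolve \<phi> f \<in> B \<and>
              nrm (convolve \<phi> f) \<le> C * weighted_L1_norm v \<phi> * nrm f))"

definition fourier_BF :: "'d::finite fn set \<Rightarrow> 'd functional set" where
  "fourier_BF B = {u. tempered_distribution u \<and> (\<exists>b\<in>B. is_function (fourier_tempered u) b)}"


section \<open>Wave-front sets\<close>

definition open_conic_nbhd :: "real ^ 'd::finite \<Rightarrow> (real ^ 'd) set \<Rightarrow> bool" where
  "open_conic_nbhd \<xi>0 \<Gamma> \<longleftrightarrow>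
     open \<Gamma> \<and> \<xi>0 \<in> \<Gamma> \<and> 0 \<notin> \<Gamma> \<and> (\<forall>\<xi>\<in>\<Gamma>. \<forall>t>0. t *\<^sub>R \<xi> \<in> \<Gamma>)"

definition WF_FB :: "'d::finite fn set \<Rightarrow> 'd functional \<Rightarrow> ((real ^ 'd) \<times> (real ^ 'd)) set" where
  "WF_FB B f = {(x0, \<xi>0). \<xi>0 \<noteq> 0 \<and>
     (\<forall>\<Gamma> \<phi>. open_conic_nbhd \<xi>0 \<Gamma> \<and> \<phi> \<in> test_fns \<and> (\<exists>U. open U \<and> x0 \<in> U \<and> (\<forall>x\<in>U. \<phi> x = 1)) \<longrightarrow>
        (\<lambda>\<xi>. fourier_compact (mult_distribution \<phi> f) \<xi> * indicator \<Gamma> \<xi>) \<notin> B)}"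

definition WF_A :: "'d::finite functional \<Rightarrow> ((real ^ 'd) \<times> (real ^ 'd)) set" where
  "WF_A u = {(x0, \<xi>0). \<xi>0 \<noteq> 0 \<and>
     \<not> (\<exists>U \<Gamma> C w. open U \<and> x0 \<in> U \<and> open_conic_nbhd \<xi>0 \<Gamma> \<and>
          bounded_compact_distributions (w ` {1..}) \<and>
          (\<forall>N::nat\<ge>1. equal_on_open U (w N) u \<and>
             (\<forall>\<xi>\<in>\<Gamma>. norm (fourier_compact (w N) \<xi>) \<le> C * (C * (real N + 1) / norm \<xi>) ^ N)))}"

end

(* Let phi be a cutoff function equal to 1 near x0. If f - g is microlocally analytic at
   (x0, xi0), then F(phi (f - g)) decays rapidly in a cone around xi0, and rapidly decreasing functions
   belong to B, while F(phi g) is a multiple of the convolution of F(phi) with F(g), hence in B; so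
   F(phi f) is in B near the direction xi0. Conversely, if chi_Gamma F(phi f) is in B, take it to be the
   Fourier transform of g. Then F(phi f - g) vanishes in Gamma, and cutting phi f - g off by functions
   whose derivatives of order j <= N are bounded by (C N)^j gives the sequence required for
   analyticity at xi0.
   Both directions rest on the identity w(F a) = int a(eta) F(w)(eta) d eta for compactly supported w,
   proved by approximating F a by finite sums of plane waves, and on Fourier inversion. *)

theory Submission
  imports Defs "HOL-Probability.Characteristic_Functions" "HOL-Probability.Sinc_Integral"
begin

section \<open>Partial derivatives\<close>

text \<open>In the second direction frequencies outside Gamma keep a distance of at least epsilon
  |xi| from every xi in a smaller cone, so only the decay of the transformed cutoff at such
  distances matters. A single cutoff cannot give (C N / |xi|)^N for all N, because a nonzero
  function of compact support is not analytic; therefore the cutoff varies with N, while each fixed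
  derivative keeps a bound independent of N, as boundedness in E' requires. In the first direction
  one member of the analytic sequence suffices, since B only asks for polynomial decay of a fixed
  order. Elements of B are a priori just locally integrable. Two facts tie B to polynomial weights:
  convolving (1 + |x|)^(-n) with a bump gives a member of B that dominates functions of this decay,
  and the polynomial bound on translations makes every b in B integrable against (1 + |x|)^(-n), so
  that b can be integrated against Schwartz functions.\<close>

lemma partials_Nil [simp]: "partials [] \<phi> = \<phi>"
  by (simp add: partials_def)

lemma partials_Cons: "partials (i # \<alpha>) \<phi> = partial i (partials \<alpha> \<phi>)"
  by (simp add: partials_def)

lemma partials_append: "partials (\<alpha> @ \<beta>) \<phi> = partials \<alpha> (partials \<beta> \<phi>)"
  by (simp add: partials_def)

lemma partials_snoc: "partials (\<alpha> @ [i]) \<phi> = partials \<alpha> (partial i \<phi>)"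
  by (simp add: partials_append partials_Cons)

lemma partial_eqI: "(\<phi> has_derivative D) (at x) \<Longrightarrow> partial i \<phi> x = D (axis i 1)"
  by (metis frechet_derivative_at partial_def)

lemma has_derivative_partials:
  assumes "\<phi> differentiable (at x)"
  shows "(\<phi> has_derivative (\<lambda>h. \<Sum>i\<in>UNIV. h $ i *\<^sub>R partial i \<phi> x)) (at x)"
proof -
  have D: "(\<phi> has_derivative frechet_derivative \<phi> (at x)) (at x)"
    using assms frechet_derivative_works by blast
  then interpret bounded_linear "frechet_derivative \<phi> (at x)"
    by (rule has_derivative_bounded_linear)
  have "frechet_derivative \<phi> (at x) h = (\<Sum>i\<in>UNIV. h $ i *\<^sub>R partial i \<phi> x)" for h
  proof -
    have h: "h = (\<Sum>i\<in>UNIV. h $ i *\<^sub>R axis i 1)"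
      by (simp add: vec_eq_iff axis_def if_distrib cong: if_cong)
    have "frechet_derivative \<phi> (at x) h
        = (\<Sum>i\<in>UNIV. h $ i *\<^sub>R frechet_derivative \<phi> (at x) (axis i 1))"
      by (subst h) (simp only: sum scaleR)
    then show ?thesis by (simp add: partial_def)
  qed
  then have "frechet_derivative \<phi> (at x) = (\<lambda>h. \<Sum>i\<in>UNIV. h $ i *\<^sub>R partial i \<phi> x)" by blast
  with D show ?thesis by simp
qed

lemma smooth_differentiable: "\<phi> \<in> smooth_fns \<Longrightarrow> \<phi> differentiable (at x)"
  unfolding smooth_fns_def mem_Collect_eq by (drule spec[of _ "[]"]) simp

lemma smooth_partial: "\<phi> \<in> smooth_fns \<Longrightarrow> partial i \<phi> \<in> smooth_fns"
  by (simp add: smooth_fns_def flip: partials_snoc)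

lemma smooth_partials: "\<phi> \<in> smooth_fns \<Longrightarrow> partials \<alpha> \<phi> \<in> smooth_fns"
  by (induction \<alpha>) (auto simp: partials_Cons smooth_partial)

text \<open>All iterated derivatives stay inside \<open>S\<close>, by induction on the multi-index.
  Exhibiting a family closed under differentiation replaces formulas for higher derivatives when
  products, plane waves, Fourier integrals and tensor products are shown to be smooth.\<close>

lemma smooth_coinduct:
  assumes "\<phi> \<in> S" and diff: "\<And>\<psi> x. \<psi> \<in> S \<Longrightarrow> \<psi> differentiable (at x)"
    and partial: "\<And>\<psi> i. \<psi> \<in> S \<Longrightarrow> partial i \<psi> \<in> S"
  shows "\<phi> \<in> smooth_fns"
proof -
  have "partials \<alpha> \<phi> \<in> S" for \<alpha>
    by (induction \<alpha>) (auto simp: partials_Cons assms)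
  then show ?thesis using diff by (auto simp: smooth_fns_def)
qed

lemma smooth_continuous: "\<phi> \<in> smooth_fns \<Longrightarrow> continuous_on A \<phi>"
  by (meson continuous_at_imp_continuous_on differentiable_imp_continuous_within smooth_differentiable)

lemma smooth_borel: "\<phi> \<in> smooth_fns \<Longrightarrow> \<phi> \<in> borel_measurable borel"
  by (simp add: borel_measurable_continuous_onI smooth_continuous)

section \<open>Algebra of smooth functions\<close>

lemma partial_add:
  assumes "\<phi> differentiable (at x)" "\<psi> differentiable (at x)"
  shows "partial i (\<lambda>x. \<phi> x + \<psi> x) x = partial i \<phi> x + partial i \<psi> x"
  using partial_eqI[OF has_derivative_add[OF assms(1,2)[THEN frechet_derivative_works[THEN iffD1]]]]
  by (simp add: partial_def)

lemma partial_mult: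
  assumes "\<phi> differentiable (at x)" "\<psi> differentiable (at x)"
  shows "partial i (\<lambda>x. \<phi> x * \<psi> x) x = \<phi> x * partial i \<psi> x + partial i \<phi> x * \<psi> x"
  using partial_eqI[OF has_derivative_mult[OF assms(1,2)[THEN frechet_derivative_works[THEN iffD1]]]]
  by (simp add: partial_def)

lemma partial_const [simp]: "partial i (\<lambda>x. c :: complex) = (\<lambda>x. 0)"
  using partial_eqI[OF has_derivative_const] by fastforce

lemma partial_cmult:
  assumes "\<phi> differentiable (at x)"
  shows "partial i (\<lambda>x. c * \<phi> x) x = c * partial i \<phi> x"
  using partial_mult[of "\<lambda>_. c" x \<phi> i] assms by simp

lemma partials_add:
  assumes "\<phi> \<in> smooth_fns" "\<psi> \<in> smooth_fns"
  shows "partials \<alpha> (\<lambda>x. \<phi> x + \<psi> x) = (\<lambda>x. partials \<alpha> \<phi> x + partials \<alpha> \<psi> x)"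
  by (induction \<alpha>)
    (auto simp: partials_Cons intro!: ext partial_add smooth_differentiable smooth_partials assms)

lemma partials_cmult:
  assumes "\<phi> \<in> smooth_fns"
  shows "partials \<alpha> (\<lambda>x. c * \<phi> x) = (\<lambda>x. c * partials \<alpha> \<phi> x)"
  by (induction \<alpha>)
    (auto simp: partials_Cons intro!: ext partial_cmult smooth_differentiable smooth_partials assms)

lemma smooth_add:
  assumes "\<phi> \<in> smooth_fns" "\<psi> \<in> smooth_fns"
  shows "(\<lambda>x. \<phi> x + \<psi> x) \<in> smooth_fns"
  using assms smooth_differentiable[OF smooth_partials]
  by (auto simp: smooth_fns_def[of] partials_add intro!: differentiable_add)

lemma smooth_cmult:
  assumes "\<phi> \<in> smooth_fns"
  shows "(\<lambda>x. c * \<phi> x) \<in> smooth_fns"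
  using assms smooth_differentiable[OF smooth_partials]
  by (auto simp: smooth_fns_def[of] partials_cmult intro!: differentiable_mult)

lemma smooth_const: "(\<lambda>x. c) \<in> smooth_fns"
  by (rule smooth_coinduct[where S = "range (\<lambda>c x. c)"]) auto

lemma smooth_diff:
  assumes "\<phi> \<in> smooth_fns" "\<psi> \<in> smooth_fns"
  shows "(\<lambda>x. \<phi> x - \<psi> x) \<in> smooth_fns"
  using smooth_add[OF assms(1) smooth_cmult[OF assms(2), of "-1"]] by simp

lemma partials_diff:
  assumes "\<phi> \<in> smooth_fns" "\<psi> \<in> smooth_fns"
  shows "partials \<alpha> (\<lambda>x. \<phi> x - \<psi> x) = (\<lambda>x. partials \<alpha> \<phi> x - partials \<alpha> \<psi> x)"
  using partials_add[OF assms(1) smooth_cmult[OF assms(2), of "-1"]]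
    partials_cmult[OF assms(2), of _ "-1"] by simp

lemma smooth_sum:
  assumes "finite P" "\<And>p. p \<in> P \<Longrightarrow> \<phi> p \<in> smooth_fns"
  shows "(\<lambda>x. \<Sum>p\<in>P. \<phi> p x) \<in> smooth_fns"
  using assms by (induction P rule: finite_induct) (auto intro: smooth_add smooth_const)

lemma partials_const: "\<alpha> \<noteq> [] \<Longrightarrow> partials \<alpha> (\<lambda>x. c) = (\<lambda>x. 0)"
  by (induction \<alpha> rule: list_nonempty_induct) (auto simp: partials_Cons)

lemma partials_sum:
  assumes "finite P" "\<And>p. p \<in> P \<Longrightarrow> \<phi> p \<in> smooth_fns"
  shows "partials \<alpha> (\<lambda>x. \<Sum>p\<in>P. \<phi> p x) = (\<lambda>x. \<Sum>p\<in>P. partials \<alpha> (\<phi> p) x)"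
  using assms
proof (induction P rule: finite_induct)
  case empty
  then show ?case by (cases "\<alpha> = []") (auto simp: partials_const)
next
  case (insert p P)
  then have "partials \<alpha> (\<lambda>x. \<phi> p x + (\<Sum>p\<in>P. \<phi> p x))
    = (\<lambda>x. partials \<alpha> (\<phi> p) x + partials \<alpha> (\<lambda>x. \<Sum>p\<in>P. \<phi> p x) x)"
    by (intro partials_add smooth_sum) auto
  with insert show ?case by simp
qed

text \<open>Smoothness of products: the finite sums of products are closed under differentiation.\<close>

inductive_set product_span :: "'d::finite fn set" where
  prod: "\<phi> \<in> smooth_fns \<Longrightarrow> \<psi> \<in> smooth_fns \<Longrightarrow> (\<lambda>x. \<phi> x * \<psi> x) \<in> product_span"
| add: "\<phi> \<in> product_span \<Longrightarrow> \<psi> \<in> product_span \<Longrightarrow> (\<lambda>x. \<phi> x + \<psi> x) \<in> product_span"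

lemma product_span_differentiable: "\<phi> \<in> product_span \<Longrightarrow> \<phi> differentiable (at x)"
  by (induction rule: product_span.induct)
    (auto intro: differentiable_mult differentiable_add smooth_differentiable)

lemma product_span_partial: "\<phi> \<in> product_span \<Longrightarrow> partial i \<phi> \<in> product_span"
proof (induction rule: product_span.induct)
  case (prod \<phi> \<psi>)
  then have "partial i (\<lambda>x. \<phi> x * \<psi> x) = (\<lambda>x. \<phi> x * partial i \<psi> x + partial i \<phi> x * \<psi> x)"
    by (auto intro!: ext partial_mult smooth_differentiable)
  with prod show ?case by (auto intro!: product_span.intros smooth_partial)
next
  case (add \<phi> \<psi>)
  then have "partial i (\<lambda>x. \<phi> x + \<psi> x) = (\<lambda>x. partial i \<phi> x + partial i \<psi> x)"
    by (auto intro!: ext partial_add product_span_differentiable)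
  with add show ?case by (auto intro!: product_span.intros)
qed

lemma smooth_mult:
  assumes "\<phi> \<in> smooth_fns" "\<psi> \<in> smooth_fns"
  shows "(\<lambda>x. \<phi> x * \<psi> x) \<in> smooth_fns"
  using product_span.prod[OF assms] product_span_differentiable product_span_partial
  by (rule smooth_coinduct)

lemma partial_mult_fn:
  assumes "\<phi> \<in> smooth_fns" "\<psi> \<in> smooth_fns"
  shows "partial i (\<lambda>x. \<phi> x * \<psi> x) = (\<lambda>x. \<phi> x * partial i \<psi> x + partial i \<phi> x * \<psi> x)"
  by (intro ext partial_mult smooth_differentiable assms)

text \<open>Each differentiation replaces a product by two products, which accounts for the factor
  \<open>2 ^ length \<alpha>\<close>. The induction removes the last entry of the list, the
  derivative applied first, so that the hypotheses carry over from \<phi> and \<psi> to their first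
  derivatives.\<close>

lemma norm_partials_mult_le:
  assumes "\<phi> \<in> smooth_fns" "\<psi> \<in> smooth_fns"
    and "\<And>\<beta>. length \<beta> \<le> length \<alpha> \<Longrightarrow> norm (partials \<beta> \<phi> x) \<le> A"
    and "\<And>\<beta>. length \<beta> \<le> length \<alpha> \<Longrightarrow> norm (partials \<beta> \<psi> x) \<le> A'"
  shows "norm (partials \<alpha> (\<lambda>x. \<phi> x * \<psi> x) x) \<le> 2 ^ length \<alpha> * (A * A')"
  using assms
proof (induction \<alpha> arbitrary: \<phi> \<psi> rule: rev_induct)
  case Nil
  have "norm (\<phi> x) \<le> A" "norm (\<psi> x) \<le> A'" using Nil(3,4)[of "[]"] by auto
  then have "norm (\<phi> x) * norm (\<psi> x) \<le> A * A'" by (intro mult_mono') auto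
  then show ?case by (simp add: norm_mult)
next
  case (snoc i \<alpha>)
  have "partials (\<alpha> @ [i]) (\<lambda>x. \<phi> x * \<psi> x) x
      = partials \<alpha> (\<lambda>x. \<phi> x * partial i \<psi> x) x + partials \<alpha> (\<lambda>x. partial i \<phi> x * \<psi> x) x"
    using snoc(2,3)
    by (simp add: partials_snoc partial_mult_fn partials_add smooth_mult smooth_partial)
  also have "norm \<dots> \<le> 2 ^ length \<alpha> * (A * A') + 2 ^ length \<alpha> * (A * A')"
  proof (intro norm_triangle_mono snoc.IH)
    show "norm (partials \<beta> (partial i \<psi>) x) \<le> A'" "norm (partials \<beta> (partial i \<phi>) x) \<le> A"
      if "length \<beta> \<le> length \<alpha>" for \<beta>
      using snoc(4,5)[of "\<beta> @ [i]"] that by (auto simp: partials_snoc)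
  qed (use snoc in \<open>auto intro: smooth_partial\<close>)
  also have "\<dots> = 2 ^ length (\<alpha> @ [i]) * (A * A')" by simp
  finally show ?case .
qed

lemma partials_scale:
  assumes "\<phi> \<in> smooth_fns"
  shows "partials \<alpha> (\<lambda>x. \<phi> (c *\<^sub>R x)) = (\<lambda>x. c ^ length \<alpha> *\<^sub>R partials \<alpha> \<phi> (c *\<^sub>R x))"
proof (induction \<alpha>)
  case Nil
  then show ?case by simp
next
  case (Cons i \<alpha>)
  have "partial i (\<lambda>x. c ^ length \<alpha> *\<^sub>R partials \<alpha> \<phi> (c *\<^sub>R x)) x
    = c ^ length (i # \<alpha>) *\<^sub>R partials (i # \<alpha>) \<phi> (c *\<^sub>R x)" for x
  proof -
    have "(partials \<alpha> \<phi> has_derivative frechet_derivative (partials \<alpha> \<phi>) (at (c *\<^sub>R x))) (at (c *\<^sub>R x))"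
      using assms frechet_derivative_works smooth_differentiable smooth_partials by blast
    then have "((\<lambda>x. c ^ length \<alpha> *\<^sub>R partials \<alpha> \<phi> (c *\<^sub>R x)) has_derivative
       (\<lambda>h. c ^ length \<alpha> *\<^sub>R frechet_derivative (partials \<alpha> \<phi>) (at (c *\<^sub>R x)) (c *\<^sub>R h))) (at x)"
      by (intro has_derivative_scaleR_right has_derivative_compose[of "\<lambda>x. c *\<^sub>R x"])
        (auto intro!: derivative_eq_intros)
    from partial_eqI[OF this, of i] show ?thesis
      using linear_frechet_derivative[OF smooth_differentiable[OF smooth_partials[OF assms]]]
      by (simp add: partials_Cons partial_def linear_cmul)
  qed
  with Cons show ?case by (auto simp: partials_Cons)
qed

lemma smooth_scale:
  assumes "\<phi> \<in> smooth_fns"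
  shows "(\<lambda>x. \<phi> (c *\<^sub>R x)) \<in> smooth_fns"
proof -
  have "(\<lambda>x. c ^ length \<alpha> *\<^sub>R partials \<alpha> \<phi> (c *\<^sub>R x)) differentiable (at x)" for \<alpha> x
  proof -
    have "(partials \<alpha> \<phi> \<circ> (\<lambda>x. c *\<^sub>R x)) differentiable (at x)"
      by (intro differentiable_chain_at smooth_differentiable smooth_partials assms) auto
    then show ?thesis by (intro differentiable_scaleR) (auto simp: o_def)
  qed
  then show ?thesis by (simp add: smooth_fns_def partials_scale[OF assms])
qed

lemma partials_eq_on_open:
  assumes "open U" "\<And>x. x \<in> U \<Longrightarrow> \<phi> x = \<psi> x" "x \<in> U"
  shows "partials \<alpha> \<phi> x = partials \<alpha> \<psi> x"
  using assms(3)
proof (induction \<alpha> arbitrary: x)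
  case (Cons i \<alpha>)
  have "(partials \<alpha> \<phi> has_derivative D) (at x) \<longleftrightarrow> (partials \<alpha> \<psi> has_derivative D) (at x)" for D
    using has_derivative_transform_within_open[OF _ assms(1) Cons.prems, of "partials \<alpha> \<phi>" D UNIV "partials \<alpha> \<psi>"]
      has_derivative_transform_within_open[OF _ assms(1) Cons.prems, of "partials \<alpha> \<psi>" D UNIV "partials \<alpha> \<phi>"]
      Cons.IH by auto
  then have "frechet_derivative (partials \<alpha> \<phi>) (at x) = frechet_derivative (partials \<alpha> \<psi>) (at x)"
    by (simp add: frechet_derivative_def)
  then show ?case by (simp add: partials_Cons partial_def)
qed (use assms in auto)

section \<open>Supports and test functions\<close>

lemma partials_outside_supp: "x \<notin> supp \<phi> \<Longrightarrow> partials \<alpha> \<phi> x = 0"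
proof -
  assume x: "x \<notin> supp \<phi>"
  have "partials \<alpha> \<phi> x = partials \<alpha> (\<lambda>x. 0) x"
    by (rule partials_eq_on_open[of "- supp \<phi>"])
      (use x closure_subset[of "{x. \<phi> x \<noteq> 0}"] in \<open>auto simp: supp_def\<close>)
  then show ?thesis by (cases "\<alpha> = []") (auto simp: partials_const)
qed

lemma supp_mult_subset: "supp (\<lambda>x. \<phi> x * \<psi> x) \<subseteq> supp \<phi>"
  unfolding supp_def by (rule closure_mono) auto

lemma supp_subset: "closed K \<Longrightarrow> (\<And>x. \<phi> x \<noteq> 0 \<Longrightarrow> x \<in> K) \<Longrightarrow> supp \<phi> \<subseteq> K"
  unfolding supp_def by (rule closure_minimal) auto

lemma in_supp: "\<phi> x \<noteq> 0 \<Longrightarrow> x \<in> supp \<phi>"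
  unfolding supp_def using closure_subset by fastforce

lemma test_mult: "\<phi> \<in> test_fns \<Longrightarrow> \<psi> \<in> smooth_fns \<Longrightarrow> (\<lambda>x. \<phi> x * \<psi> x) \<in> test_fns"
  unfolding test_fns_def
  using smooth_mult supp_mult_subset[of \<phi> \<psi>] compact_Int_closed[of "supp \<phi>" "supp (\<lambda>x. \<phi> x * \<psi> x)"]
  by (auto simp: Int_absorb1 supp_def)

lemma test_smooth: "\<phi> \<in> test_fns \<Longrightarrow> \<phi> \<in> smooth_fns"
  by (simp add: test_fns_def)

lemma test_fnsI: "\<phi> \<in> smooth_fns \<Longrightarrow> compact K \<Longrightarrow> (\<And>x. \<phi> x \<noteq> 0 \<Longrightarrow> x \<in> K) \<Longrightarrow> \<phi> \<in> test_fns"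
  unfolding test_fns_def using supp_subset[of K \<phi>]
  by (auto simp: compact_imp_closed) (metis closed_closure compact_Int_closed inf.absorb_iff2 supp_def)

section \<open>Plane waves\<close>

definition wave :: "real ^ 'd::finite \<Rightarrow> 'd fn" where
  "wave \<zeta> x = exp (- \<i> * complex_of_real (x \<bullet> \<zeta>))"

text \<open>The monomial (-i \<zeta>)^\<alpha>: the factor by which \<open>partials \<alpha>\<close>
  acts on \<open>wave \<zeta>\<close> and, the kernel being symmetric, the multiplier that
  differentiating a Fourier integral produces.\<close>

definition freq :: "'d::finite list \<Rightarrow> real ^ 'd \<Rightarrow> complex" where
  "freq \<alpha> \<zeta> = prod_list (map (\<lambda>i. - \<i> * complex_of_real (\<zeta> $ i)) \<alpha>)"

lemma freq_simps [simp]: "freq [] \<zeta> = 1" "freq (i # \<alpha>) \<zeta> = - \<i> * complex_of_real (\<zeta> $ i) * freq \<alpha> \<zeta>"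
  by (auto simp: freq_def)

lemma norm_wave [simp]: "norm (wave \<zeta> x) = 1"
  by (simp add: wave_def)

lemma wave_has_derivative:
  "(wave \<zeta> has_derivative (\<lambda>h. wave \<zeta> x * (- \<i> * complex_of_real (h \<bullet> \<zeta>)))) (at x)"
proof -
  have "((\<lambda>x. - \<i> * complex_of_real (x \<bullet> \<zeta>)) has_derivative (\<lambda>h. - \<i> * complex_of_real (h \<bullet> \<zeta>))) (at x)"
    by (auto intro!: derivative_eq_intros)
  from has_derivative_compose[OF this DERIV_exp[unfolded has_field_derivative_def]]
  show ?thesis by (simp add: wave_def[abs_def])
qed

lemma partial_wave: "partial i (wave \<zeta>) x = - \<i> * complex_of_real (\<zeta> $ i) * wave \<zeta> x"
  using partial_eqI[OF wave_has_derivative] by (simp add: inner_axis' mult_ac)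

lemma smooth_wave: "wave \<zeta> \<in> smooth_fns"
proof (rule smooth_coinduct[where S = "range (\<lambda>c x. c * wave \<zeta> x)"])
  show "wave \<zeta> \<in> range (\<lambda>c x. c * wave \<zeta> x)" by (rule range_eqI[of _ _ 1]) auto
  have d: "wave \<zeta> differentiable (at x)" for x
    using wave_has_derivative differentiableI by blast
  then show "\<psi> differentiable (at x)" if "\<psi> \<in> range (\<lambda>c x. c * wave \<zeta> x)" for \<psi> x
    using that by (auto intro!: differentiable_mult)
  show "partial i \<psi> \<in> range (\<lambda>c x. c * wave \<zeta> x)" if "\<psi> \<in> range (\<lambda>c x. c * wave \<zeta> x)" for \<psi> i
  proof -
    from that obtain c where "\<psi> = (\<lambda>x. c * wave \<zeta> x)" by auto
    then have "partial i \<psi> = (\<lambda>x. (c * (- \<i> * complex_of_real (\<zeta> $ i))) * wave \<zeta> x)"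
      by (auto simp: partial_cmult[OF d] partial_wave)
    then show ?thesis by blast
  qed
qed

lemma partials_wave: "partials \<alpha> (wave \<zeta>) = (\<lambda>x. freq \<alpha> \<zeta> * wave \<zeta> x)"
  by (induction \<alpha>)
    (auto simp: partials_Cons partial_cmult[OF smooth_differentiable[OF smooth_wave]] partial_wave intro!: ext)

lemma norm_freq_le: "norm (freq \<alpha> \<zeta>) \<le> (1 + norm \<zeta>) ^ length \<alpha>"
proof (induction \<alpha>)
  case (Cons i \<alpha>)
  have "\<bar>\<zeta> $ i\<bar> \<le> 1 + norm \<zeta>" using component_le_norm_cart[of \<zeta> i] by simp
  with Cons show ?case by (simp add: norm_mult mult_mono')
qed simp

text \<open>The phase enters through \<open>cis\<close>, which is 1-Lipschitz by the mean value
  inequality, and the two phases differ by \<open>x \<bullet> (\<zeta> - \<eta>)\<close>.\<close>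

lemma norm_wave_diff_le: "norm (wave \<zeta> x - wave \<eta> x) \<le> norm x * norm (\<zeta> - \<eta>)"
proof -
  have "wave \<zeta> x - wave \<eta> x = cis (- (x \<bullet> \<zeta>)) - cis (- (x \<bullet> \<eta>))"
    by (simp add: wave_def cis_conv_exp)
  also have "norm \<dots> \<le> \<bar>- (x \<bullet> \<zeta>) - - (x \<bullet> \<eta>)\<bar>"
  proof -
    have D: "(cis has_derivative (\<lambda>h. h *\<^sub>R (\<i> * cis t))) (at t)" for t
    proof -
      have "((\<lambda>t. \<i> * complex_of_real t) has_derivative (\<lambda>h. \<i> * complex_of_real h)) (at t)"
        by (auto intro!: derivative_eq_intros)
      from has_derivative_compose[OF this DERIV_exp[unfolded has_field_derivative_def]]
      show ?thesis by (simp add: cis_conv_exp[abs_def] scaleR_conv_of_real mult_ac)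
    qed
    have "onorm (\<lambda>h. h *\<^sub>R (\<i> * cis t)) \<le> 1" for t
      by (rule onorm_le) (simp add: norm_mult)
    then have "norm (cis a - cis b) \<le> norm (a - b)" for a b
      using differentiable_bound[of UNIV cis "\<lambda>t h. h *\<^sub>R (\<i> * cis t)" 1 a b] D
      by (simp add: has_derivative_at_withinI)
    from this[of "- (x \<bullet> \<zeta>)" "- (x \<bullet> \<eta>)"] show ?thesis by simp
  qed
  also have "\<dots> = \<bar>x \<bullet> (\<zeta> - \<eta>)\<bar>" by (simp add: inner_diff_right)
  also have "\<dots> \<le> norm x * norm (\<zeta> - \<eta>)" by (rule Cauchy_Schwarz_ineq2)
  finally show ?thesis .
qed

text \<open>A further derivative multiplies by a component of the frequency. Splitting the
  difference of the two products leaves one extra term, with the difference of the components, and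
  this raises the constant by one. The estimate serves both the continuity in the frequency and the
  cost of rounding frequencies.\<close>

lemma norm_partials_wave_diff_le:
  assumes "norm x \<le> b" "norm \<zeta> \<le> R" "norm \<eta> \<le> R"
  shows "norm (partials \<alpha> (wave \<zeta>) x - partials \<alpha> (wave \<eta>) x)
    \<le> (b + length \<alpha>) * (1 + R) ^ length \<alpha> * norm (\<zeta> - \<eta>)"
proof (induction \<alpha>)
  case Nil
  have "norm x * norm (\<zeta> - \<eta>) \<le> b * norm (\<zeta> - \<eta>)" using assms by (simp add: mult_right_mono)
  with norm_wave_diff_le[of \<zeta> x \<eta>] show ?case by simp
next
  case (Cons i \<alpha>)
  let ?G = "\<lambda>\<zeta>. partials \<alpha> (wave \<zeta>) x" and ?k = "length \<alpha>"
  have b: "0 \<le> b" "0 \<le> R" using assms norm_ge_zero[of x] norm_ge_zero[of \<zeta>] by linarith+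
  have "partials (i # \<alpha>) (wave \<zeta>) x - partials (i # \<alpha>) (wave \<eta>) x
    = - \<i> * (complex_of_real (\<zeta> $ i) * (?G \<zeta> - ?G \<eta>) + complex_of_real ((\<zeta> - \<eta>) $ i) * ?G \<eta>)"
    by (simp add: partials_wave algebra_simps)
  also have "norm \<dots> \<le> \<bar>\<zeta> $ i\<bar> * norm (?G \<zeta> - ?G \<eta>) + \<bar>(\<zeta> - \<eta>) $ i\<bar> * norm (?G \<eta>)"
    using norm_triangle_ineq[of "complex_of_real (\<zeta> $ i) * (?G \<zeta> - ?G \<eta>)" "complex_of_real ((\<zeta> - \<eta>) $ i) * ?G \<eta>"]
    by (simp add: norm_mult flip: of_real_diff)
  also have "\<dots> \<le> (1 + R) * ((b + ?k) * (1 + R) ^ ?k * norm (\<zeta> - \<eta>)) + norm (\<zeta> - \<eta>) * ((1 + R) ^ Suc ?k)"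
  proof (intro add_mono mult_mono Cons)
    show "\<bar>\<zeta> $ i\<bar> \<le> 1 + R" using component_le_norm_cart[of \<zeta> i] assms by linarith
    show "\<bar>(\<zeta> - \<eta>) $ i\<bar> \<le> norm (\<zeta> - \<eta>)" by (rule component_le_norm_cart)
    have "norm (?G \<eta>) \<le> (1 + norm \<eta>) ^ ?k" using norm_freq_le by (simp add: partials_wave norm_mult)
    also have "\<dots> \<le> (1 + R) ^ ?k" using assms by (intro power_mono) auto
    also have "\<dots> \<le> (1 + R) ^ Suc ?k" using b by (intro power_increasing) auto
    finally show "norm (?G \<eta>) \<le> (1 + R) ^ Suc ?k" .
  qed (use b in auto)
  also have "\<dots> = (b + length (i # \<alpha>)) * (1 + R) ^ length (i # \<alpha>) * norm (\<zeta> - \<eta>)"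
    by (simp add: algebra_simps)
  finally show ?case .
qed

section \<open>Integration on Euclidean space\<close>

lemma borel_imp_lebesgue: "f \<in> borel_measurable borel \<Longrightarrow> f \<in> borel_measurable lebesgue"
  by (simp add: measurable_completion)

text \<open>The completed measure is a constant multiple of its image under the affine map. The case
  c = 1 gives translations, c = -1 reflections, and small positive c the dilations of Fourier
  inversion.\<close>

lemma
  fixes f :: "'a::euclidean_space \<Rightarrow> 'b::{banach, second_countable_topology}"
  assumes f: "f \<in> borel_measurable lebesgue" and c: "c \<noteq> 0"
  shows borel_measurable_lebesgue_affine: "(\<lambda>x. f (t + c *\<^sub>R x)) \<in> borel_measurable lebesgue"
    and integrable_lebesgue_affine:
      "integrable lebesgue (\<lambda>x. f (t + c *\<^sub>R x)) \<longleftrightarrow> integrable lebesgue f"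
    and integral_lebesgue_affine:
      "integral\<^sup>L lebesgue f = \<bar>c\<bar> ^ DIM('a) *\<^sub>R (LINT x|lebesgue. f (t + c *\<^sub>R x))"
proof -
  have T: "(\<lambda>x. t + (\<Sum>j\<in>Basis. (c * (x \<bullet> j)) *\<^sub>R j)) = (\<lambda>x. t + c *\<^sub>R x)"
    by (simp add: euclidean_representation flip: scaleR_scaleR scaleR_sum_right)
  have m: "(\<lambda>x. t + c *\<^sub>R x) \<in> lebesgue \<rightarrow>\<^sub>M lebesgue"
    using lebesgue_affine_measurable[of "\<lambda>_. c" t] c by (simp add: T)
  have L: "lebesgue = density (distr lebesgue lebesgue (\<lambda>x. t + c *\<^sub>R x)) (\<lambda>_. ennreal (\<bar>c\<bar> ^ DIM('a)))"
    using lebesgue_affine_euclidean[of "\<lambda>_. c" t] c by (simp add: T ennreal_power)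
  show "(\<lambda>x. f (t + c *\<^sub>R x)) \<in> borel_measurable lebesgue"
    using measurable_compose[OF m f] .
  have c': "\<bar>c\<bar> ^ DIM('a) \<noteq> 0" using c by simp
  have "integrable lebesgue f
      \<longleftrightarrow> integrable (density (distr lebesgue lebesgue (\<lambda>x. t + c *\<^sub>R x)) (\<lambda>_. ennreal (\<bar>c\<bar> ^ DIM('a)))) f"
    using L by simp
  also have "\<dots> \<longleftrightarrow> integrable lebesgue (\<lambda>x. f (t + c *\<^sub>R x))"
    using f m c' integrable_scaleR_right[of "inverse (\<bar>c\<bar> ^ DIM('a))" lebesgue "\<lambda>x. \<bar>c\<bar> ^ DIM('a) *\<^sub>R f (t + c *\<^sub>R x)"]
    by (subst integrable_density) (auto simp: integrable_distr_eq)
  finally show "integrable lebesgue (\<lambda>x. f (t + c *\<^sub>R x)) \<longleftrightarrow> integrable lebesgue f" ..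
  have "integral\<^sup>L lebesgue f
      = integral\<^sup>L (density (distr lebesgue lebesgue (\<lambda>x. t + c *\<^sub>R x)) (\<lambda>_. ennreal (\<bar>c\<bar> ^ DIM('a)))) f"
    using L by simp
  also have "\<dots> = \<bar>c\<bar> ^ DIM('a) *\<^sub>R (LINT x|lebesgue. f (t + c *\<^sub>R x))"
    using f m by (subst integral_density) (auto simp: integral_distr)
  finally show "integral\<^sup>L lebesgue f = \<bar>c\<bar> ^ DIM('a) *\<^sub>R (LINT x|lebesgue. f (t + c *\<^sub>R x))" .
qed

lemma integral_lebesgue_reflect:
  fixes f :: "'a::euclidean_space \<Rightarrow> 'b::{banach, second_countable_topology}"
  assumes "f \<in> borel_measurable lebesgue"
  shows "(LINT x|lebesgue. f (t - x)) = integral\<^sup>L lebesgue f"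
  using integral_lebesgue_affine[OF assms, of "-1" t] by simp

text \<open>\<open>lborel\<close> is the image of the product measure over the standard basis, where
  the product formula for integrals is available; what remains is to index basis vectors by
  coordinates.\<close>

lemma
  fixes f :: "'d::finite \<Rightarrow> real \<Rightarrow> 'b::{real_normed_field, banach, second_countable_topology}"
  assumes f: "\<And>i. integrable lborel (f i)"
  shows integrable_lborel_vec_prod: "integrable lborel (\<lambda>x :: real ^ 'd. \<Prod>i\<in>UNIV. f i (x $ i))" (is ?I)
    and integral_lborel_vec_prod:
      "(LINT x|lborel. (\<Prod>i\<in>UNIV. f i ((x :: real ^ 'd) $ i))) = (\<Prod>i\<in>UNIV. integral\<^sup>L lborel (f i))" (is ?E)
proof -
  interpret product_sigma_finite "\<lambda>_::real ^ 'd. lborel :: real measure" by standard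
  \<comment> \<open>\<open>J\<close> recovers the coordinate to which a basis vector
    belongs.\<close>
  define J :: "real ^ 'd \<Rightarrow> 'd" where "J b = (SOME i. b = axis i 1)" for b
  have J: "J (axis i 1) = i" for i
    unfolding J_def by (rule some_equality) (auto simp: axis_eq_axis)
  have B: "(Basis :: (real ^ 'd) set) = range (\<lambda>i. axis i 1)"
    by (auto simp: Basis_vec_def)
  have inj: "inj (\<lambda>i :: 'd. axis i (1::real))" by (auto simp: inj_on_def axis_eq_axis)
  have re: "(\<Prod>i\<in>UNIV. F i) = (\<Prod>b\<in>Basis. F (J b))" for F :: "'d \<Rightarrow> 'b"
    unfolding B prod.reindex[OF inj] by (simp add: J)
  have comp: "(\<Sum>b\<in>Basis. z b *\<^sub>R b) $ J b = z b" if "b \<in> Basis" for z and b :: "real ^ 'd"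
  proof -
    from that obtain i where i: "b = axis i 1" unfolding B by blast
    have "(\<Sum>b\<in>Basis. z b *\<^sub>R b) \<bullet> axis i 1 = z (axis i 1)"
      using that i by (simp add: inner_sum_left_Basis)
    then show ?thesis by (simp add: i J inner_axis)
  qed
  have meas [measurable]: "f i \<in> borel_measurable borel" for i
    using borel_measurable_integrable[OF f[of i]] by simp
  have m: "(\<lambda>x :: real ^ 'd. \<Prod>i\<in>UNIV. f i (x $ i)) \<in> borel_measurable borel" by measurable
  have S: "(\<lambda>z. \<Sum>b\<in>Basis. z b *\<^sub>R b) \<in> (\<Pi>\<^sub>M b\<in>(Basis :: (real ^ 'd) set). lborel) \<rightarrow>\<^sub>M borel"
    by measurable
  have eq: "(\<Prod>i\<in>UNIV. f i ((\<Sum>b\<in>Basis. z b *\<^sub>R b :: real ^ 'd) $ i)) = (\<Prod>b\<in>Basis. f (J b) (z b))" for z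
    by (subst re) (intro prod.cong refl arg_cong[where f = "f _"] comp)
  have "integrable (\<Pi>\<^sub>M b\<in>(Basis :: (real ^ 'd) set). lborel) (\<lambda>z. \<Prod>b\<in>Basis. f (J b) (z b))"
    by (intro product_integrable_prod f) auto
  then show ?I
    by (subst lborel_eq) (simp only: integrable_distr_eq[OF S m] eq)
  have "(LINT z|(\<Pi>\<^sub>M b\<in>(Basis :: (real ^ 'd) set). lborel). (\<Prod>b\<in>Basis. f (J b) (z b)))
     = (\<Prod>b\<in>Basis. integral\<^sup>L lborel (f (J b)))"
    by (intro product_integral_prod f) auto
  then show ?E
    by (subst lborel_eq) (simp only: integral_distr[OF S m] eq re[of "\<lambda>i. integral\<^sup>L lborel (f i)"])
qed

text \<open>The product of the integrable functions 1 / (1 + x_i^2) dominates, since each 1 + x_i^2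
  is at most (1 + norm x)^2. This product bound is the origin of the exponent
  \<open>2 * CARD('d)\<close> that recurs in the later integrability arguments.\<close>

lemma integrable_decay:
  assumes "2 * CARD('d::finite) \<le> k"
  shows "integrable lebesgue (\<lambda>x :: real ^ 'd. 1 / (1 + norm x) ^ k)"
proof -
  have 1: "integrable lborel (\<lambda>t::real. 1 / (1 + t\<^sup>2))"
    using integrable_inverse_1_plus_square
    by (simp add: set_integrable_def inverse_eq_divide)
  have 2: "integrable lborel (\<lambda>x :: real ^ 'd. \<Prod>i\<in>UNIV. 1 / (1 + (x $ i)\<^sup>2))"
    by (rule integrable_lborel_vec_prod) (rule 1)
  have "integrable lborel (\<lambda>x :: real ^ 'd. 1 / (1 + norm x) ^ k)"
  proof (rule Bochner_Integration.integrable_bound[OF 2])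
    show "AE x in lborel. norm (1 / (1 + norm x) ^ k) \<le> norm (\<Prod>i\<in>UNIV. 1 / (1 + ((x :: real ^ 'd) $ i)\<^sup>2))"
    proof (intro AE_I2)
      fix x :: "real ^ 'd"
      have "(\<Prod>i\<in>UNIV. 1 + (x $ i)\<^sup>2) \<le> (\<Prod>i\<in>(UNIV :: 'd set). (1 + norm x)\<^sup>2)"
      proof (intro prod_mono conjI)
        fix i
        have "(x $ i)\<^sup>2 \<le> (norm x)\<^sup>2"
          using component_le_norm_cart[of x i] by (metis abs_le_square_iff abs_norm_cancel)
        then show "1 + (x $ i)\<^sup>2 \<le> (1 + norm x)\<^sup>2"
            using norm_ge_zero[of x] by (simp only: power2_sum power_one)
      qed auto
      also have "\<dots> = (1 + norm x) ^ (2 * CARD('d))" by (simp add: power_mult)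
      also have "\<dots> \<le> (1 + norm x) ^ k" using assms by (intro power_increasing) auto
      finally have "(\<Prod>i\<in>UNIV. 1 + (x $ i)\<^sup>2) \<le> (1 + norm x) ^ k" .
      moreover have p: "0 < (\<Prod>i\<in>UNIV. 1 + (x $ i)\<^sup>2)" by (intro prod_pos) (auto simp: add_pos_nonneg)
      ultimately have "1 / (1 + norm x) ^ k \<le> 1 / (\<Prod>i\<in>UNIV. 1 + (x $ i)\<^sup>2)"
        by (intro divide_left_mono mult_pos_pos) auto
      with p show "norm (1 / (1 + norm x) ^ k) \<le> norm (\<Prod>i\<in>UNIV. 1 / (1 + (x $ i)\<^sup>2))"
        by (simp add: prod_dividef abs_of_nonneg)
    qed
  qed simp
  then show ?thesis by (subst integrable_completion) auto
qed

lemma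
  fixes f :: "real ^ 'd::finite \<Rightarrow> 'b::{banach, second_countable_topology}"
  assumes f: "f \<in> borel_measurable lebesgue" and le: "\<And>x. norm (f x) \<le> C / (1 + norm x) ^ k"
    and k: "2 * CARD('d) \<le> k"
  shows integrable_decayI: "integrable lebesgue f"
    and integral_decay_le: "norm (integral\<^sup>L lebesgue f) \<le> C * (LINT x|lebesgue. 1 / (1 + norm (x :: real ^ 'd)) ^ k)"
proof -
  have C: "integrable lebesgue (\<lambda>x :: real ^ 'd. C / (1 + norm x) ^ k)"
    using integrable_mult_right[OF integrable_decay[OF k], of C] by simp
  show I: "integrable lebesgue f"
    by (rule Bochner_Integration.integrable_bound[OF C f]) (use le abs_ge_self order_trans in fastforce)
  have "norm (integral\<^sup>L lebesgue f) \<le> (LINT x|lebesgue. norm (f x))"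
    by (rule integral_norm_bound)
  also have "\<dots> \<le> (LINT x|lebesgue. C / (1 + norm (x :: real ^ 'd)) ^ k)"
    by (rule integral_mono[OF integrable_norm[OF I] C le])
  also have "\<dots> = C * (LINT x|lebesgue. 1 / (1 + norm (x :: real ^ 'd)) ^ k)"
    using integral_mult_right_zero[of lebesgue C "\<lambda>x :: real ^ 'd. 1 / (1 + norm x) ^ k"] by simp
  finally show "norm (integral\<^sup>L lebesgue f) \<le> C * (LINT x|lebesgue. 1 / (1 + norm (x :: real ^ 'd)) ^ k)" .
qed

section \<open>Fourier integrals of rapidly decreasing functions\<close>

text \<open>Moments of all orders are what repeated differentiation under the Fourier integral
  consumes. The class is closed under multiplication by coordinates and asks for no smoothness of
  the function itself.\<close>

definition rapid :: "'d::finite fn \<Rightarrow> bool" where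
  "rapid a \<longleftrightarrow> a \<in> borel_measurable lebesgue \<and>
     (\<forall>k. integrable lebesgue (\<lambda>x. (1 + norm x) ^ k * norm (a x)))"

lemma rapid_measurable: "rapid a \<Longrightarrow> a \<in> borel_measurable lebesgue"
  by (simp add: rapid_def)

lemma rapid_moment: "rapid a \<Longrightarrow> integrable lebesgue (\<lambda>x. (1 + norm x) ^ k * norm (a x))"
  by (simp add: rapid_def)

lemma norm_measurable_lebesgue [measurable]: "norm \<in> borel_measurable (lebesgue :: (real ^ 'd::finite) measure)"
  by (rule borel_imp_lebesgue) simp

lemma rapidI:
  fixes a :: "'d::finite fn"
  assumes "a \<in> borel_measurable lebesgue" and "\<And>k. \<exists>C. \<forall>x. (1 + norm x) ^ k * norm (a x) \<le> C"
  shows "rapid a"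
  unfolding rapid_def
proof (intro conjI allI assms(1))
  fix k
  from assms(2)[of "k + 2 * CARD('d)"]
  obtain C where C: "\<And>x. (1 + norm x) ^ (k + 2 * CARD('d)) * norm (a x) \<le> C" by blast
  have "norm ((1 + norm x) ^ k * norm (a x)) \<le> C / (1 + norm x) ^ (2 * CARD('d))" for x
  proof -
    have "0 < (1 + norm x) ^ (2 * CARD('d))" by (intro zero_less_power) (simp add: add_pos_nonneg)
    then show ?thesis using C[of x] by (simp add: pos_le_divide_eq power_add mult_ac)
  qed
  moreover have "(\<lambda>x. (1 + norm x) ^ k * norm (a x)) \<in> borel_measurable lebesgue"
    using assms(1) by measurable
  ultimately show "integrable lebesgue (\<lambda>x. (1 + norm x) ^ k * norm (a x))"
    by (intro integrable_decayI[where k = "2 * CARD('d)" and C = C]) auto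
qed

lemma rapid_bound:
  assumes "rapid a" "b \<in> borel_measurable lebesgue" "\<And>x. norm (b x) \<le> C * (1 + norm x) ^ k * norm (a x)"
  shows "rapid b"
  unfolding rapid_def
proof (intro conjI allI assms(2))
  fix j
  show "integrable lebesgue (\<lambda>x. (1 + norm x) ^ j * norm (b x))"
  proof (rule Bochner_Integration.integrable_bound[OF integrable_mult_right[OF rapid_moment[OF assms(1), of "j + k"], of C]])
    show "AE x in lebesgue. norm ((1 + norm x) ^ j * norm (b x)) \<le> norm (C * ((1 + norm x) ^ (j + k) * norm (a x)))"
    proof (intro AE_I2)
      fix x
      have "(1 + norm x) ^ j * norm (b x) \<le> (1 + norm x) ^ j * (C * (1 + norm x) ^ k * norm (a x))"
        by (intro mult_left_mono assms(3)) auto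
      then show "norm ((1 + norm x) ^ j * norm (b x)) \<le> norm (C * ((1 + norm x) ^ (j + k) * norm (a x)))"
        by (simp add: power_add mult_ac)
    qed
    show "(\<lambda>x. (1 + norm x) ^ j * norm (b x)) \<in> borel_measurable lebesgue"
      using assms(2) by measurable
  qed
qed

lemma rapid_integrable: "rapid a \<Longrightarrow> integrable lebesgue a"
  using rapid_moment[of a 0] by (simp add: rapid_def integrable_norm_iff)

lemma wave_measurable: "wave \<xi> \<in> borel_measurable lebesgue"
  by (intro borel_imp_lebesgue smooth_borel smooth_wave)

lemma integrable_mult_wave: "integrable lebesgue a \<Longrightarrow> integrable lebesgue (\<lambda>x. a x * wave \<xi> x)"
  by (rule Bochner_Integration.integrable_bound[where f = a])
    (auto simp: norm_mult intro!: borel_measurable_times wave_measurable)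

lemma fourier_const_pos: "0 < fourier_const TYPE('d::finite)"
  by (simp add: fourier_const_def)

lemma fourier_wave: "fourier a \<xi> = fourier_const TYPE('d) *\<^sub>R (LINT x|lebesgue. a x * wave \<xi> x)"
  for a :: "'d::finite fn"
  by (simp add: fourier_def wave_def)

lemma norm_fourier_le:
  fixes a :: "'d::finite fn"
  shows "norm (fourier a \<xi>) \<le> fourier_const TYPE('d) * (LINT x|lebesgue. norm (a x))"
  using integral_norm_bound[of lebesgue "\<lambda>x. a x * wave \<xi> x"] fourier_const_pos[where 'd = 'd]
  by (simp add: fourier_wave norm_mult mult_left_mono)

lemma has_derivative_quadratic:
  fixes f :: "'a::real_normed_vector \<Rightarrow> 'b::real_normed_vector"
  assumes D: "bounded_linear D" and le: "\<And>h. norm (f (x + h) - f x - D h) \<le> K * (norm h)\<^sup>2"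
  shows "(f has_derivative D) (at x)"
  unfolding has_derivative_at
proof (intro conjI D)
  have "((\<lambda>h::'a. K * norm h) \<longlongrightarrow> 0) (at 0)"
    by (auto intro!: tendsto_eq_intros)
  moreover have "norm (norm (f (x + h) - f x - D h) / norm h) \<le> K * norm h" for h
    using le[of h] by (cases "h = 0") (auto simp: field_simps power2_eq_square)
  ultimately show "(\<lambda>h. norm (f (x + h) - f x - D h) / norm h) \<midarrow>0\<rightarrow> 0"
    using Lim_null_comparison[of "\<lambda>h. norm (f (x + h) - f x - D h) / norm h" "\<lambda>h. K * norm h" "at 0"]
    by simp
qed

lemma norm_wave_taylor: "norm (wave (\<xi> + h) x - wave \<xi> x - wave \<xi> x * (- \<i> * complex_of_real (x \<bullet> h))) \<le> (norm x)\<^sup>2 * (norm h)\<^sup>2"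
proof -
  define s where "s = - (x \<bullet> h)"
  have w: "wave (\<xi> + h) x = wave \<xi> x * exp (\<i> * complex_of_real s)"
    by (simp add: wave_def s_def inner_add_right algebra_simps flip: exp_add)
  have "wave (\<xi> + h) x - wave \<xi> x - wave \<xi> x * (- \<i> * complex_of_real (x \<bullet> h))
     = wave \<xi> x * (exp (\<i> * complex_of_real s) - (\<Sum>k\<le>1. (\<i> * s) ^ k / fact k))"
    unfolding w by (simp add: s_def algebra_simps)
  also have "norm \<dots> \<le> \<bar>s\<bar> ^ 2"
  proof -
    have "norm (exp (\<i> * complex_of_real s) - (\<Sum>k\<le>1. (\<i> * s) ^ k / fact k)) \<le> \<bar>s\<bar> ^ 2 / 2"
      using iexp_approx1[of s 1] by (simp add: power2_eq_square)
    also have "\<dots> \<le> \<bar>s\<bar> ^ 2" by simp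
    finally show ?thesis by (simp only: norm_mult norm_wave mult_1)
  qed
  also have "\<dots> \<le> (norm x * norm h) ^ 2"
    unfolding s_def using Cauchy_Schwarz_ineq2[of x h] by (intro power_mono) auto
  finally show ?thesis by (simp add: power_mult_distrib)
qed

lemma component_measurable_lebesgue [measurable]:
  "(\<lambda>x :: real ^ 'd::finite. x $ i) \<in> borel_measurable lebesgue"
  by (rule borel_imp_lebesgue) simp

text \<open>The factor that \<open>partial i\<close> brings down from the kernel of the Fourier
  integral.\<close>

definition mult_coord :: "'d::finite \<Rightarrow> 'd fn \<Rightarrow> 'd fn" where
  "mult_coord i a x = - \<i> * complex_of_real (x $ i) * a x"

lemma rapid_mult_coord:
  assumes "rapid a"
  shows "rapid (mult_coord i a)"
proof (rule rapid_bound[OF assms, where C = 1 and k = 1])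
  show "mult_coord i a \<in> borel_measurable lebesgue"
    unfolding mult_coord_def[abs_def] using rapid_measurable[OF assms] by measurable
  show "norm (mult_coord i a x) \<le> 1 * (1 + norm x) ^ 1 * norm (a x)" for x
    using component_le_norm_cart[of x i] by (auto simp: mult_coord_def norm_mult intro!: mult_right_mono)
qed

text \<open>Differentiation under the integral in quantitative form: the Taylor remainder of a plane
  wave is at most (norm x)^2 (norm h)^2, so the second moment of \<open>a\<close> bounds the
  remainder of the transform by a multiple of (norm h)^2, and no limit theorem is involved.\<close>

lemma fourier_has_derivative:
  fixes a :: "'d::finite fn"
  assumes "rapid a"
  shows "(fourier a has_derivative (\<lambda>h. \<Sum>i\<in>UNIV. h $ i *\<^sub>R fourier (mult_coord i a) \<xi>)) (at \<xi>)"
proof (rule has_derivative_quadratic)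
  let ?c = "fourier_const TYPE('d)"
  show "bounded_linear (\<lambda>h. \<Sum>i\<in>UNIV. h $ i *\<^sub>R fourier (mult_coord i a) \<xi>)"
    by (intro bounded_linear_sum bounded_linear_scaleR_const bounded_linear_vec_nth)
  fix h
  let ?R = "\<lambda>x. a x * (wave (\<xi> + h) x - wave \<xi> x - wave \<xi> x * (- \<i> * complex_of_real (x \<bullet> h)))"
  have I: "integrable lebesgue (\<lambda>x. a x * wave \<zeta> x)" for \<zeta>
    by (intro integrable_mult_wave rapid_integrable assms)
  have Ii: "integrable lebesgue (\<lambda>x. mult_coord i a x * wave \<xi> x)" for i
    by (intro integrable_mult_wave rapid_integrable rapid_mult_coord assms)
  have Is: "integrable lebesgue (\<lambda>x. \<Sum>i\<in>UNIV. h $ i *\<^sub>R (mult_coord i a x * wave \<xi> x))"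
    using Ii by auto
  have S: "(\<Sum>i\<in>UNIV. h $ i *\<^sub>R (mult_coord i a x * wave \<xi> x))
      = a x * (wave \<xi> x * (- \<i> * complex_of_real (x \<bullet> h)))" for x
    by (simp add: mult_coord_def inner_vec_def scaleR_conv_of_real sum_distrib_left sum_distrib_right mult_ac)
  have "fourier a (\<xi> + h) - fourier a \<xi> - (\<Sum>i\<in>UNIV. h $ i *\<^sub>R fourier (mult_coord i a) \<xi>)
    = ?c *\<^sub>R ((LINT x|lebesgue. a x * wave (\<xi> + h) x) - (LINT x|lebesgue. a x * wave \<xi> x)
        - (\<Sum>i\<in>UNIV. h $ i *\<^sub>R (LINT x|lebesgue. mult_coord i a x * wave \<xi> x)))"
    by (simp add: fourier_wave scaleR_diff_right scaleR_sum_right mult_ac)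
  also have "(\<Sum>i\<in>UNIV. h $ i *\<^sub>R (LINT x|lebesgue. mult_coord i a x * wave \<xi> x))
     = (LINT x|lebesgue. (\<Sum>i\<in>UNIV. h $ i *\<^sub>R (mult_coord i a x * wave \<xi> x)))"
    using Ii by (subst Bochner_Integration.integral_sum) auto
  also have "(LINT x|lebesgue. a x * wave (\<xi> + h) x) - (LINT x|lebesgue. a x * wave \<xi> x) - \<dots>
      = (LINT x|lebesgue. a x * wave (\<xi> + h) x - a x * wave \<xi> x
          - (\<Sum>i\<in>UNIV. h $ i *\<^sub>R (mult_coord i a x * wave \<xi> x)))"
    by (simp only: Bochner_Integration.integral_diff Bochner_Integration.integrable_diff I Is)
  also have "\<dots> = (LINT x|lebesgue. ?R x)"
    by (simp only: S right_diff_distrib)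
  also have "norm (?c *\<^sub>R (LINT x|lebesgue. ?R x)) \<le> ?c * (LINT x|lebesgue. (norm h)\<^sup>2 * ((1 + norm x) ^ 2 * norm (a x)))"
  proof -
    have "norm (?R x) \<le> (norm h)\<^sup>2 * ((1 + norm x) ^ 2 * norm (a x))" for x
    proof -
      have "norm (?R x) \<le> norm (a x) * ((norm x)\<^sup>2 * (norm h)\<^sup>2)"
        unfolding norm_mult by (intro mult_left_mono) (use norm_wave_taylor[of \<xi> h x] in \<open>auto simp: norm_mult\<close>)
      also have "\<dots> \<le> norm (a x) * ((1 + norm x)\<^sup>2 * (norm h)\<^sup>2)"
        by (intro mult_left_mono mult_right_mono power_mono) auto
      finally show ?thesis by (simp add: mult_ac)
    qed
    moreover have "integrable lebesgue ?R"
      using Bochner_Integration.integrable_diff[OF Bochner_Integration.integrable_diff[OF I I] Is]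
      by (simp only: S right_diff_distrib)
    ultimately have "norm (LINT x|lebesgue. ?R x) \<le> (LINT x|lebesgue. (norm h)\<^sup>2 * ((1 + norm x) ^ 2 * norm (a x)))"
      by (intro order_trans[OF integral_norm_bound] integral_mono integrable_norm)
        (use rapid_moment[OF assms, of 2] in auto)
    then show ?thesis
      using fourier_const_pos[where 'd = 'd] by (simp add: mult_left_mono)
  qed
  also have "\<dots> = ?c * (LINT x|lebesgue. (1 + norm x) ^ 2 * norm (a x)) * (norm h)\<^sup>2"
    by (simp only: integral_mult_right_zero) (simp add: mult_ac)
  finally show "norm (fourier a (\<xi> + h) - fourier a \<xi> - (\<Sum>i\<in>UNIV. h $ i *\<^sub>R fourier (mult_coord i a) \<xi>))
    \<le> ?c * (LINT x|lebesgue. (1 + norm x) ^ 2 * norm (a x)) * (norm h)\<^sup>2" .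
qed

lemma partial_fourier: "rapid a \<Longrightarrow> partial i (fourier a) = fourier (mult_coord i a)"
  using partial_eqI[OF fourier_has_derivative, of a i]
  by (auto simp: axis_def if_distribR if_distrib[of "\<lambda>r. r *\<^sub>R _"] cong: if_cong)

lemma smooth_fourier:
  assumes "rapid a" shows "fourier a \<in> smooth_fns"
proof (rule smooth_coinduct[where S = "fourier ` Collect rapid"])
  show "\<psi> differentiable (at x)" if "\<psi> \<in> fourier ` Collect rapid" for \<psi> and x :: "real ^ 'a"
    using that fourier_has_derivative differentiableI by blast
qed (use assms in \<open>auto simp: partial_fourier rapid_mult_coord\<close>)

lemma partials_fourier:
  assumes "rapid a"
  shows "partials \<alpha> (fourier a) = fourier (\<lambda>x. freq \<alpha> x * a x)" "rapid (\<lambda>x. freq \<alpha> x * a x)"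
proof (induction \<alpha>)
  case (Cons i \<alpha>)
  { case 1 from Cons show ?case
      by (simp add: partials_Cons partial_fourier) (simp add: mult_coord_def[abs_def] mult_ac) }
  { case 2 from Cons rapid_mult_coord[of "\<lambda>x. freq \<alpha> x * a x" i] show ?case
      by (simp add: mult_coord_def[abs_def] mult_ac) }
qed (use assms in auto)

section \<open>Seminorms\<close>

lemma finite_lists_le: "finite {\<alpha> :: 'd::finite list. length \<alpha> \<le> m}"
  using finite_lists_length_le[of "UNIV :: 'd set" m] by simp

text \<open>Boundedness matters because the real \<open>SUP\<close> of an unbounded set carries no
  information; nonnegativity allows the other summands to be dropped.\<close>

lemma sum_SUP_ge:
  fixes F :: "'d::finite list \<Rightarrow> 'a \<Rightarrow> real"
  assumes "\<And>\<beta>. length \<beta> \<le> m \<Longrightarrow> bdd_above (F \<beta> ` X)" "\<And>\<beta> x. 0 \<le> F \<beta> x"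
    and "x \<in> X" "length \<alpha> \<le> m"
  shows "F \<alpha> x \<le> (\<Sum>\<beta> | length \<beta> \<le> m. SUP x\<in>X. F \<beta> x)"
proof -
  have up: "F \<beta> x \<le> (SUP x\<in>X. F \<beta> x)" if "length \<beta> \<le> m" for \<beta>
    using cSUP_upper[OF assms(3) assms(1)[OF that]] .
  then have "F \<alpha> x \<le> (SUP x\<in>X. F \<alpha> x)" using assms(4) by blast
  also have "\<dots> \<le> (\<Sum>\<beta> | length \<beta> \<le> m. SUP x\<in>X. F \<beta> x)"
    using assms(2,4) up by (intro member_le_sum finite_lists_le) (auto intro: order_trans)
  finally show ?thesis .
qed

text \<open>The seminorms are sums of suprema, so a pointwise bound turns into a seminorm bound at
  the price of the number of multi-indices.\<close>

lemma sum_SUP_le: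
  fixes F :: "'d::finite list \<Rightarrow> 'a \<Rightarrow> real" and K :: real
  assumes "X \<noteq> {}" "\<And>\<alpha> x. length \<alpha> \<le> m \<Longrightarrow> x \<in> X \<Longrightarrow> F \<alpha> x \<le> K"
  shows "(\<Sum>\<beta> | length \<beta> \<le> m. SUP x\<in>X. F \<beta> x) \<le> card {\<alpha> :: 'd list. length \<alpha> \<le> m} * K"
  by (rule sum_bounded_above) (use assms in \<open>auto intro!: cSUP_least\<close>)

lemma smooth_partials_bounded_on:
  assumes "\<phi> \<in> smooth_fns" "compact X"
  shows "bdd_above ((\<lambda>x. norm (partials \<alpha> \<phi> x)) ` X)"
  by (intro bounded_imp_bdd_above compact_imp_bounded compact_continuous_image assms
      continuous_on_norm smooth_continuous smooth_partials)

lemma le_smooth_seminorm: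
  assumes "\<phi> \<in> smooth_fns" "norm x \<le> m" "length \<alpha> \<le> m"
  shows "norm (partials \<alpha> \<phi> x) \<le> smooth_seminorm m \<phi>"
  unfolding smooth_seminorm_def
  by (rule sum_SUP_ge[where F = "\<lambda>\<alpha> x. norm (partials \<alpha> \<phi> x)"])
    (use assms in \<open>auto intro!: smooth_partials_bounded_on\<close>)

lemma smooth_seminorm_le:
  fixes \<phi> :: "'d::finite fn" and K :: real
  assumes "\<And>\<alpha> x. length \<alpha> \<le> m \<Longrightarrow> norm x \<le> m \<Longrightarrow> norm (partials \<alpha> \<phi> x) \<le> K"
  shows "smooth_seminorm m \<phi> \<le> card {\<alpha> :: 'd list. length \<alpha> \<le> m} * K"
  unfolding smooth_seminorm_def by (rule sum_SUP_le) (use assms in auto)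

lemma test_bound:
  assumes "\<phi> \<in> test_fns"
  shows "\<exists>C\<ge>0. \<forall>x. (1 + norm x) ^ k * norm (partials \<alpha> \<phi> x) \<le> C"
proof -
  have "bounded ((\<lambda>x. (1 + norm x) ^ k * norm (partials \<alpha> \<phi> x)) ` supp \<phi>)"
    using assms by (auto simp: test_fns_def intro!: compact_imp_bounded compact_continuous_image
        continuous_intros smooth_continuous smooth_partials)
  then obtain C where C: "\<And>x. x \<in> supp \<phi> \<Longrightarrow> (1 + norm x) ^ k * norm (partials \<alpha> \<phi> x) \<le> C"
    unfolding bounded_iff by fastforce
  have "(1 + norm x) ^ k * norm (partials \<alpha> \<phi> x) \<le> max C 0" for x
    using C[of x] partials_outside_supp[of x \<phi> \<alpha>] by (cases "x \<in> supp \<phi>") auto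
  then show ?thesis by (intro exI[of _ "max C 0"]) auto
qed

lemma le_test_seminorm:
  assumes "\<phi> \<in> test_fns" "length \<alpha> \<le> m"
  shows "norm (partials \<alpha> \<phi> x) \<le> test_seminorm m \<phi>"
  unfolding test_seminorm_def
proof (rule sum_SUP_ge[where F = "\<lambda>\<alpha> x. norm (partials \<alpha> \<phi> x)"])
  show "bdd_above (range (\<lambda>x. norm (partials \<beta> \<phi> x)))" for \<beta>
  proof -
    obtain C where "\<forall>x. (1 + norm x) ^ 0 * norm (partials \<beta> \<phi> x) \<le> C"
      using test_bound[OF assms(1)] by blast
    then show ?thesis by (intro bdd_aboveI2[where M = C]) auto
  qed
qed (use assms in auto)

lemma test_seminorm_le:
  fixes \<phi> :: "'d::finite fn" and K :: real
  assumes "\<And>\<alpha> x. length \<alpha> \<le> m \<Longrightarrow> norm (partials \<alpha> \<phi> x) \<le> K"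
  shows "test_seminorm m \<phi> \<le> card {\<alpha> :: 'd list. length \<alpha> \<le> m} * K"
  unfolding test_seminorm_def by (rule sum_SUP_le) (use assms in auto)

section \<open>Schwartz functions\<close>

lemma schwartzI:
  assumes "\<phi> \<in> smooth_fns" "\<And>\<alpha> k. \<exists>C. \<forall>x. (1 + norm x) ^ k * norm (partials \<alpha> \<phi> x) \<le> C"
  shows "\<phi> \<in> schwartz_fns"
  unfolding schwartz_fns_def
proof (intro CollectI conjI assms(1) allI)
  fix \<alpha> k
  from assms(2)[of k \<alpha>] obtain C where C: "\<And>x. (1 + norm x) ^ k * norm (partials \<alpha> \<phi> x) \<le> C" by blast
  have "norm (norm x ^ k *\<^sub>R partials \<alpha> \<phi> x) \<le> C" for x
  proof -
    have "norm x ^ k * norm (partials \<alpha> \<phi> x) \<le> (1 + norm x) ^ k * norm (partials \<alpha> \<phi> x)"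
      by (intro mult_right_mono power_mono) auto
    with C[of x] show ?thesis by simp
  qed
  then show "bounded (range (\<lambda>x. norm x ^ k *\<^sub>R partials \<alpha> \<phi> x))"
    by (auto simp: bounded_iff)
qed

lemma schwartz_smooth: "\<phi> \<in> schwartz_fns \<Longrightarrow> \<phi> \<in> smooth_fns"
  by (simp add: schwartz_fns_def)

lemma one_plus_power_le:
  fixes t :: real
  assumes "0 \<le> t"
  shows "(1 + t) ^ k \<le> 2 ^ k * (1 + t ^ k)"
proof (cases "t \<le> 1")
  case True
  then have "(1 + t) ^ k \<le> 2 ^ k" using assms by (intro power_mono) auto
  also have "\<dots> \<le> 2 ^ k * (1 + t ^ k)" using assms by simp
  finally show ?thesis .
next
  case False
  then have "(1 + t) ^ k \<le> (2 * t) ^ k" by (intro power_mono) auto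
  also have "\<dots> \<le> 2 ^ k * (1 + t ^ k)" by (simp add: power_mult_distrib)
  finally show ?thesis .
qed

text \<open>The definition weights with powers of \<open>norm x\<close>; the bounds for the powers 0
  and k together give the weight \<open>(1 + norm x) ^ k\<close>.\<close>

lemma schwartz_bound:
  assumes "\<phi> \<in> schwartz_fns"
  shows "\<exists>C. \<forall>x. (1 + norm x) ^ k * norm (partials \<alpha> \<phi> x) \<le> C"
proof -
  have "\<exists>C. \<forall>x. norm x ^ k * norm (partials \<alpha> \<phi> x) \<le> C" for k
  proof -
    from assms have "bounded (range (\<lambda>x. norm x ^ k *\<^sub>R partials \<alpha> \<phi> x))"
      by (simp add: schwartz_fns_def)
    then show ?thesis by (auto simp: bounded_iff)
  qed
  from this[of 0] this[of k] obtain C0 C where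
    C: "\<And>x. norm (partials \<alpha> \<phi> x) \<le> C0" "\<And>x. norm x ^ k * norm (partials \<alpha> \<phi> x) \<le> C" by auto
  have "(1 + norm x) ^ k * norm (partials \<alpha> \<phi> x) \<le> 2 ^ k * (C0 + C)" for x
  proof -
    have "(1 + norm x) ^ k \<le> 2 ^ k * (1 + norm x ^ k)" by (rule one_plus_power_le) simp
    then have "(1 + norm x) ^ k * norm (partials \<alpha> \<phi> x) \<le> (2 ^ k * (1 + norm x ^ k)) * norm (partials \<alpha> \<phi> x)"
      by (rule mult_right_mono) auto
    also have "\<dots> = 2 ^ k * (norm (partials \<alpha> \<phi> x) + norm x ^ k * norm (partials \<alpha> \<phi> x))"
      by (simp add: algebra_simps)
    also have "\<dots> \<le> 2 ^ k * (C0 + C)" by (intro mult_left_mono add_mono C) auto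
    finally show ?thesis .
  qed
  then show ?thesis by blast
qed

lemma le_schwartz_seminorm:
  assumes "\<phi> \<in> schwartz_fns" "length \<alpha> \<le> m" "k \<le> m"
  shows "(1 + norm x) ^ k * norm (partials \<alpha> \<phi> x) \<le> schwartz_seminorm m \<phi>"
proof -
  have "(1 + norm x) ^ k * norm (partials \<alpha> \<phi> x) \<le> (1 + norm x) ^ m * norm (partials \<alpha> \<phi> x)"
    by (intro mult_right_mono power_increasing assms) auto
  also have "\<dots> \<le> schwartz_seminorm m \<phi>"
    unfolding schwartz_seminorm_def
  proof (rule sum_SUP_ge[where F = "\<lambda>\<alpha> x. (1 + norm x) ^ m * norm (partials \<alpha> \<phi> x)"])
    show "bdd_above (range (\<lambda>x. (1 + norm x) ^ m * norm (partials \<beta> \<phi> x)))" for \<beta>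
    proof -
      obtain C where "\<forall>x. (1 + norm x) ^ m * norm (partials \<beta> \<phi> x) \<le> C"
        using schwartz_bound[OF assms(1)] by blast
      then show ?thesis by (intro bdd_aboveI2[where M = C]) auto
    qed
  qed (use assms in auto)
  finally show ?thesis .
qed

lemma schwartz_seminorm_nonneg: "\<phi> \<in> schwartz_fns \<Longrightarrow> 0 \<le> schwartz_seminorm m \<phi>"
  using order_trans[OF norm_ge_zero, of "\<phi> 0" "schwartz_seminorm m \<phi>"]
    le_schwartz_seminorm[of \<phi> "[]" m 0 0] by simp

lemma schwartz_seminorm_le:
  fixes \<phi> :: "'d::finite fn" and K :: real
  assumes "\<And>\<alpha> x. length \<alpha> \<le> m \<Longrightarrow> (1 + norm x) ^ m * norm (partials \<alpha> \<phi> x) \<le> K"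
  shows "schwartz_seminorm m \<phi> \<le> card {\<alpha> :: 'd list. length \<alpha> \<le> m} * K"
  unfolding schwartz_seminorm_def by (rule sum_SUP_le) (use assms in auto)

section \<open>Operations on Schwartz functions\<close>

lemma test_schwartz: "\<phi> \<in> test_fns \<Longrightarrow> \<phi> \<in> schwartz_fns"
  using test_bound by (intro schwartzI test_smooth) blast+

lemma schwartz_partial: "\<phi> \<in> schwartz_fns \<Longrightarrow> partial i \<phi> \<in> schwartz_fns"
  by (rule schwartzI)
    (auto simp: schwartz_smooth smooth_partial schwartz_bound simp flip: partials_snoc)

lemma schwartz_partials: "\<phi> \<in> schwartz_fns \<Longrightarrow> partials \<alpha> \<phi> \<in> schwartz_fns"
  by (induction \<alpha>) (auto simp: partials_Cons schwartz_partial)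

lemma schwartz_seminorm_partial:
  fixes \<phi> :: "'d::finite fn"
  assumes "\<phi> \<in> schwartz_fns"
  shows "schwartz_seminorm m (partial i \<phi>) \<le> card {\<alpha> :: 'd list. length \<alpha> \<le> m} * schwartz_seminorm (Suc m) \<phi>"
  by (rule schwartz_seminorm_le)
    (auto simp flip: partials_snoc intro!: le_schwartz_seminorm assms)

lemma schwartz_seminorm_Suc:
  fixes \<phi> :: "'d::finite fn"
  assumes "\<phi> \<in> schwartz_fns"
  shows "schwartz_seminorm m \<phi> \<le> card {\<alpha> :: 'd list. length \<alpha> \<le> m} * schwartz_seminorm (Suc m) \<phi>"
  by (rule schwartz_seminorm_le) (auto intro!: le_schwartz_seminorm assms)

lemma schwartz_rapid:
  assumes "\<phi> \<in> schwartz_fns" shows "rapid \<phi>"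
  by (rule rapidI)
    (use schwartz_bound[OF assms, of _ "[]"] in
      \<open>auto intro!: borel_imp_lebesgue smooth_borel schwartz_smooth assms\<close>)

lemma smooth_mult_coord_factor: "(\<lambda>x :: real ^ 'd::finite. - \<i> * complex_of_real (x $ i)) \<in> smooth_fns"
  and partial_mult_coord_factor:
    "partial j (\<lambda>x :: real ^ 'd::finite. - \<i> * complex_of_real (x $ i)) = (\<lambda>x. if j = i then - \<i> else 0)"
proof -
  let ?X = "\<lambda>x :: real ^ 'd. - \<i> * complex_of_real (x $ i)"
  have D: "(?X has_derivative ?X) (at x)" for x
    by (auto intro!: derivative_eq_intros bounded_linear.has_derivative[OF bounded_linear_vec_nth])
  show P: "partial j ?X = (\<lambda>x. if j = i then - \<i> else 0)" for j
    using partial_eqI[OF D, of j] by (auto simp: axis_def)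
  show "?X \<in> smooth_fns"
  proof (rule smooth_coinduct[where S = "insert ?X (range (\<lambda>c x. c))"])
    show "\<psi> differentiable (at x)" if "\<psi> \<in> insert ?X (range (\<lambda>c x. c))" for \<psi> x
      using that D[THEN differentiableI] by auto
    show "partial k \<psi> \<in> insert ?X (range (\<lambda>c x. c))" if "\<psi> \<in> insert ?X (range (\<lambda>c x. c))" for \<psi> k
      using that P[of k] by auto
  qed simp
qed

lemma norm_partials_mult_coord_factor:
  "norm (partials \<beta> (\<lambda>x :: real ^ 'd::finite. - \<i> * complex_of_real (x $ i)) x) \<le> 1 + norm x"
proof (cases \<beta> rule: rev_cases)
  case Nil
  then show ?thesis using component_le_norm_cart[of x i] by (simp add: norm_mult)
next
  case (snoc \<gamma> j)
  then show ?thesis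
    by (cases "\<gamma> = []") (auto simp: partials_snoc partials_Cons partial_mult_coord_factor[simplified] partials_const)
qed

text \<open>A coordinate and its derivatives are bounded by 1 + norm x, so one more power of decay
  of \<phi> pays for the multiplication; this is the step from m to \<open>Suc m\<close> in the
  seminorm.\<close>

lemma mult_coord_schwartz:
  fixes \<phi> :: "'d::finite fn"
  assumes \<phi>: "\<phi> \<in> schwartz_fns"
  shows schwartz_mult_coord: "mult_coord i \<phi> \<in> schwartz_fns"
    and schwartz_seminorm_mult_coord:
      "schwartz_seminorm m (mult_coord i \<phi>)
        \<le> card {\<alpha> :: 'd list. length \<alpha> \<le> m} * (2 ^ m * schwartz_seminorm (Suc m) \<phi>)"
proof -
  let ?X = "\<lambda>x :: real ^ 'd. - \<i> * complex_of_real (x $ i)"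
  have le: "(1 + norm x) ^ m * norm (partials \<alpha> (mult_coord i \<phi>) x) \<le> 2 ^ m * schwartz_seminorm (Suc m) \<phi>"
    if "length \<alpha> \<le> m" for \<alpha> x m
  proof -
    define A where "A = schwartz_seminorm (Suc m) \<phi> / (1 + norm x) ^ Suc m"
    have pos: "0 < 1 + norm x" by (simp add: add_pos_nonneg)
    have "norm (partials \<beta> \<phi> x) \<le> A" if "length \<beta> \<le> length \<alpha>" for \<beta>
      using le_schwartz_seminorm[OF \<phi>, of \<beta> "Suc m" "Suc m" x] that \<open>length \<alpha> \<le> m\<close> pos
      unfolding A_def by (subst pos_le_divide_eq) (auto simp: mult_ac)
    then have "norm (partials \<alpha> (\<lambda>x. ?X x * \<phi> x) x) \<le> 2 ^ length \<alpha> * ((1 + norm x) * A)"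
      by (intro norm_partials_mult_le smooth_mult_coord_factor schwartz_smooth \<phi> norm_partials_mult_coord_factor)
    also have "\<dots> \<le> 2 ^ m * ((1 + norm x) * A)"
      using that pos schwartz_seminorm_nonneg[OF \<phi>]
      by (intro mult_right_mono power_increasing) (auto simp: A_def)
    finally have "(1 + norm x) ^ m * norm (partials \<alpha> (mult_coord i \<phi>) x)
        \<le> (1 + norm x) ^ m * (2 ^ m * ((1 + norm x) * A))"
      by (intro mult_left_mono) (auto simp: mult_coord_def[abs_def])
    also have "\<dots> = 2 ^ m * schwartz_seminorm (Suc m) \<phi>"
      using pos by (simp add: A_def)
    finally show ?thesis .
  qed
  show "mult_coord i \<phi> \<in> schwartz_fns"
  proof (rule schwartzI)
    show "mult_coord i \<phi> \<in> smooth_fns"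
      unfolding mult_coord_def[abs_def] by (intro smooth_mult smooth_mult_coord_factor schwartz_smooth \<phi>)
    fix \<alpha> :: "'d list" and k
    show "\<exists>C. \<forall>x. (1 + norm x) ^ k * norm (partials \<alpha> (mult_coord i \<phi>) x) \<le> C"
    proof (intro exI allI)
      fix x
      have "(1 + norm x) ^ k * norm (partials \<alpha> (mult_coord i \<phi>) x)
          \<le> (1 + norm x) ^ (k + length \<alpha>) * norm (partials \<alpha> (mult_coord i \<phi>) x)"
        by (intro mult_right_mono power_increasing) auto
      also note le[of \<alpha> "k + length \<alpha>" x]
      finally show "(1 + norm x) ^ k * norm (partials \<alpha> (mult_coord i \<phi>) x)
        \<le> 2 ^ (k + length \<alpha>) * schwartz_seminorm (Suc (k + length \<alpha>)) \<phi>" by simp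
    qed
  qed
  show "schwartz_seminorm m (mult_coord i \<phi>)
        \<le> card {\<alpha> :: 'd list. length \<alpha> \<le> m} * (2 ^ m * schwartz_seminorm (Suc m) \<phi>)"
    by (rule schwartz_seminorm_le) (rule le)
qed

lemma schwartz_freq_mult:
  "\<exists>C\<ge>0. \<forall>\<phi>\<in>schwartz_fns. (\<lambda>x :: real ^ 'd::finite. freq \<alpha> x * \<phi> x) \<in> schwartz_fns \<and>
     schwartz_seminorm m (\<lambda>x. freq \<alpha> x * \<phi> x) \<le> C * schwartz_seminorm (m + length \<alpha>) \<phi>"
proof (induction \<alpha> arbitrary: m)
  case Nil
  then show ?case by (auto intro!: exI[of _ 1])
next
  case (Cons i \<alpha>)
  from Cons[of "Suc m"] obtain C where C: "0 \<le> C" "\<And>\<phi>. \<phi> \<in> schwartz_fns \<Longrightarrow> (\<lambda>x. freq \<alpha> x * \<phi> x) \<in> schwartz_fns"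
    "\<And>\<phi>. \<phi> \<in> schwartz_fns \<Longrightarrow>
      schwartz_seminorm (Suc m) (\<lambda>x. freq \<alpha> x * \<phi> x) \<le> C * schwartz_seminorm (m + length (i # \<alpha>)) \<phi>"
    by auto
  let ?K = "card {\<alpha> :: 'd list. length \<alpha> \<le> m}"
  have eq: "(\<lambda>x. freq (i # \<alpha>) x * \<phi> x) = mult_coord i (\<lambda>x. freq \<alpha> x * \<phi> x)" for \<phi> :: "'d fn"
    by (simp add: mult_coord_def fun_eq_iff)
  show ?case
  proof (intro exI[of _ "?K * (2 ^ m * C)"] conjI ballI)
    fix \<phi> :: "'d fn" assume \<phi>: "\<phi> \<in> schwartz_fns"
    show "(\<lambda>x. freq (i # \<alpha>) x * \<phi> x) \<in> schwartz_fns"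
      unfolding eq by (intro schwartz_mult_coord C \<phi>)
    have "schwartz_seminorm m (\<lambda>x. freq (i # \<alpha>) x * \<phi> x)
        \<le> ?K * (2 ^ m * schwartz_seminorm (Suc m) (\<lambda>x. freq \<alpha> x * \<phi> x))"
      unfolding eq by (intro schwartz_seminorm_mult_coord C \<phi>)
    also have "\<dots> \<le> ?K * (2 ^ m * (C * schwartz_seminorm (m + length (i # \<alpha>)) \<phi>))"
      by (intro mult_left_mono C \<phi>) auto
    finally show "schwartz_seminorm m (\<lambda>x. freq (i # \<alpha>) x * \<phi> x)
        \<le> ?K * (2 ^ m * C) * schwartz_seminorm (m + length (i # \<alpha>)) \<phi>" by (simp add: mult_ac)
  qed (use C in auto)
qed

lemma schwartz_mult_wave:
  fixes \<phi> :: "'d::finite fn"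
  assumes \<phi>: "\<phi> \<in> schwartz_fns"
  shows "(\<lambda>x. \<phi> x * wave \<zeta> x) \<in> schwartz_fns"
proof (rule schwartzI)
  show "(\<lambda>x. \<phi> x * wave \<zeta> x) \<in> smooth_fns" by (intro smooth_mult schwartz_smooth \<phi> smooth_wave)
  fix \<alpha> :: "'d list" and k
  define m where "m = k + length \<alpha>"
  have "(1 + norm x) ^ k * norm (partials \<alpha> (\<lambda>x. \<phi> x * wave \<zeta> x) x)
     \<le> 2 ^ length \<alpha> * schwartz_seminorm m \<phi> * (1 + norm \<zeta>) ^ length \<alpha>" for x
  proof -
    have pos: "0 < (1 + norm x) ^ k" by (simp add: add_pos_nonneg)
    have "norm (partials \<alpha> (\<lambda>x. \<phi> x * wave \<zeta> x) x)
      \<le> 2 ^ length \<alpha> * (schwartz_seminorm m \<phi> / (1 + norm x) ^ k * (1 + norm \<zeta>) ^ length \<alpha>)"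
    proof (rule norm_partials_mult_le[OF schwartz_smooth[OF \<phi>] smooth_wave])
      fix \<beta> :: "'d list" assume b: "length \<beta> \<le> length \<alpha>"
      show "norm (partials \<beta> \<phi> x) \<le> schwartz_seminorm m \<phi> / (1 + norm x) ^ k"
        using le_schwartz_seminorm[OF \<phi>, of \<beta> m k x] b pos
        by (subst pos_le_divide_eq) (auto simp: mult_ac m_def)
      have "norm (partials \<beta> (wave \<zeta>) x) \<le> (1 + norm \<zeta>) ^ length \<beta>"
        by (simp add: partials_wave norm_mult norm_freq_le)
      also have "\<dots> \<le> (1 + norm \<zeta>) ^ length \<alpha>" using b by (intro power_increasing) auto
      finally show "norm (partials \<beta> (wave \<zeta>) x) \<le> (1 + norm \<zeta>) ^ length \<alpha>" .
    qed
    from mult_left_mono[OF this, of "(1 + norm x) ^ k"] pos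
    show ?thesis using norm_ge_zero[of x] by (simp add: mult_ac split: if_splits)
  qed
  then show "\<exists>C. \<forall>x. (1 + norm x) ^ k * norm (partials \<alpha> (\<lambda>x. \<phi> x * wave \<zeta> x) x) \<le> C" by blast
qed

text \<open>Translation invariance makes the integral of every difference quotient zero, and
  dominated convergence passes to the derivative.\<close>

lemma integral_partial_eq_0:
  fixes \<phi> :: "'d::finite fn"
  assumes \<phi>: "\<phi> \<in> schwartz_fns"
  shows "(LINT x|lebesgue. partial i \<phi> x) = 0"
proof -
  let ?e = "axis i 1 :: real ^ 'd" and ?k = "2 * CARD('d)"
  define d where "d n x = real (Suc n) *\<^sub>R (\<phi> (x + inverse (real (Suc n)) *\<^sub>R ?e) - \<phi> x)" for n x
  obtain C where C: "\<And>x. (1 + norm x) ^ ?k * norm (partial i \<phi> x) \<le> C"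
    using schwartz_bound[OF \<phi>, of ?k "[i]"] by (auto simp: partials_Cons)
  have int: "integrable lebesgue \<phi>" "\<phi> \<in> borel_measurable lebesgue"
    using schwartz_rapid[OF \<phi>] rapid_integrable rapid_measurable by blast+
  have mt: "(\<lambda>x. \<phi> (x + v)) \<in> borel_measurable lebesgue"
    and it: "integrable lebesgue (\<lambda>x. \<phi> (x + v))"
    and et: "(LINT x|lebesgue. \<phi> (x + v)) = integral\<^sup>L lebesgue \<phi>" for v
    using borel_measurable_lebesgue_affine[OF int(2), of 1 v] integrable_lebesgue_affine[OF int(2), of 1 v]
      integral_lebesgue_affine[OF int(2), of 1 v] int(1) by (simp_all add: add.commute)
  have D: "((\<lambda>t. \<phi> (x + t *\<^sub>R ?e)) has_derivative (\<lambda>s. s *\<^sub>R partial i \<phi> (x + t *\<^sub>R ?e))) (at t)" for x t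
  proof -
    have "(\<phi> has_derivative (\<lambda>h. \<Sum>j\<in>UNIV. h $ j *\<^sub>R partial j \<phi> (x + t *\<^sub>R ?e))) (at (x + t *\<^sub>R ?e))"
      by (intro has_derivative_partials smooth_differentiable schwartz_smooth \<phi>)
    moreover have "((\<lambda>t. x + t *\<^sub>R ?e) has_derivative (\<lambda>s. s *\<^sub>R ?e)) (at t)"
      by (auto intro!: derivative_eq_intros)
    ultimately have "((\<lambda>t. \<phi> (x + t *\<^sub>R ?e)) has_derivative
        (\<lambda>s. \<Sum>j\<in>UNIV. (s *\<^sub>R ?e) $ j *\<^sub>R partial j \<phi> (x + t *\<^sub>R ?e))) (at t)"
      by (rule has_derivative_compose[rotated])
    moreover have "(\<Sum>j\<in>UNIV. (s *\<^sub>R ?e) $ j *\<^sub>R partial j \<phi> y) = s *\<^sub>R partial i \<phi> y" for s y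
      by (simp add: axis_def if_distrib[of "\<lambda>r. (s * r) *\<^sub>R _"] cong: if_cong)
    ultimately show ?thesis by simp
  qed
  have lim: "(\<lambda>n. d n x) \<longlonglongrightarrow> partial i \<phi> x" for x
  proof -
    have "(\<lambda>h. norm (\<phi> (x + h *\<^sub>R ?e) - \<phi> x - h *\<^sub>R partial i \<phi> x) / norm h) \<midarrow>0\<rightarrow> 0"
      using D[of x 0] by (simp add: has_derivative_at)
    moreover have "filterlim (\<lambda>n. inverse (real (Suc n))) (at 0) sequentially"
      unfolding filterlim_at using LIMSEQ_inverse_real_of_nat by auto
    ultimately have "(\<lambda>n. norm (\<phi> (x + inverse (real (Suc n)) *\<^sub>R ?e) - \<phi> x - inverse (real (Suc n)) *\<^sub>R partial i \<phi> x)
        / norm (inverse (real (Suc n)))) \<longlonglongrightarrow> 0"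
      by (rule filterlim_compose)
    moreover have "norm (\<phi> (x + inverse (real (Suc n)) *\<^sub>R ?e) - \<phi> x - inverse (real (Suc n)) *\<^sub>R partial i \<phi> x)
        / norm (inverse (real (Suc n))) = norm (d n x - partial i \<phi> x)" for n
    proof -
      have "d n x - partial i \<phi> x = real (Suc n) *\<^sub>R
          (\<phi> (x + inverse (real (Suc n)) *\<^sub>R ?e) - \<phi> x - inverse (real (Suc n)) *\<^sub>R partial i \<phi> x)"
        by (simp add: d_def scaleR_diff_right)
      then show ?thesis by (simp add: divide_inverse mult.commute del: of_nat_Suc)
    qed
    ultimately have "(\<lambda>n. norm (d n x - partial i \<phi> x)) \<longlonglongrightarrow> 0" by simp
    then show ?thesis by (rule LIM_zero_cancel[OF tendsto_norm_zero_cancel])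
  qed
  have bound: "norm (d n x) \<le> (2 ^ ?k * C) / (1 + norm x) ^ ?k" for n x
  proof -
    let ?r = "inverse (real (Suc n))"
    have r: "0 < ?r" "?r \<le> 1" by (auto simp: inverse_le_1_iff)
    have L: "norm (\<phi> (x + ?r *\<^sub>R ?e) - \<phi> (x + 0 *\<^sub>R ?e)) \<le> ((2 ^ ?k * C) / (1 + norm x) ^ ?k) * norm (?r - 0)"
    proof (rule differentiable_bound[where S = "{0..?r}"])
      fix t assume t: "t \<in> {0..?r}"
      show "((\<lambda>t. \<phi> (x + t *\<^sub>R ?e)) has_derivative (\<lambda>s. s *\<^sub>R partial i \<phi> (x + t *\<^sub>R ?e))) (at t within {0..?r})"
        using D by (rule has_derivative_at_withinI)
      let ?y = "x + t *\<^sub>R ?e"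
      \<comment> \<open>The point \<open>?y\<close> is within distance 1 of x, so the weights at the
        two points differ at most by a factor 2 in the base; this is where \<open>2 ^ ?k\<close>
        comes from.\<close>
      have "1 + a \<le> 2 * (1 + b)" if "a \<le> b + c" "c \<le> 1" "0 \<le> b" for a b c :: real
        using that by (simp add: algebra_simps)
      moreover have "norm x \<le> norm ?y + norm (t *\<^sub>R ?e)"
        using norm_triangle_ineq4[of ?y "t *\<^sub>R ?e"] by simp
      moreover have "norm (t *\<^sub>R ?e) \<le> 1" using t r by auto
      ultimately have "1 + norm x \<le> 2 * (1 + norm ?y)" by (meson norm_ge_zero)
      then have "(1 + norm x) ^ ?k \<le> (2 * (1 + norm ?y)) ^ ?k" by (intro power_mono) auto
      then have "(1 + norm x) ^ ?k * norm (partial i \<phi> ?y) \<le> (2 * (1 + norm ?y)) ^ ?k * norm (partial i \<phi> ?y)"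
        by (intro mult_right_mono) auto
      also have "\<dots> = 2 ^ ?k * ((1 + norm ?y) ^ ?k * norm (partial i \<phi> ?y))" by (simp only: power_mult_distrib mult.assoc)
      also have "\<dots> \<le> 2 ^ ?k * C" by (intro mult_left_mono C) auto
      finally have "norm (partial i \<phi> ?y) \<le> (2 ^ ?k * C) / (1 + norm x) ^ ?k"
        by (subst pos_le_divide_eq) (auto simp: mult_ac add_pos_nonneg)
      moreover have "onorm (\<lambda>s. s *\<^sub>R p) \<le> K" if "norm p \<le> K" for p :: complex and K
        using that by (intro onorm_le) (auto simp: mult.commute[of K] intro: mult_left_mono)
      ultimately show "onorm (\<lambda>s. s *\<^sub>R partial i \<phi> ?y) \<le> (2 ^ ?k * C) / (1 + norm x) ^ ?k"
        by blast
    qed (use r in auto)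
    have "norm (real (Suc n) *\<^sub>R (\<phi> (x + ?r *\<^sub>R ?e) - \<phi> x)) = real (Suc n) * norm (\<phi> (x + ?r *\<^sub>R ?e) - \<phi> (x + 0 *\<^sub>R ?e))" by simp
    also have "\<dots> \<le> real (Suc n) * (((2 ^ ?k * C) / (1 + norm x) ^ ?k) * ?r)"
      using L by (intro mult_left_mono) auto
    also have "real (Suc n) * (K * ?r) = K" for K by simp
    finally show ?thesis by (simp add: d_def)
  qed
  have md: "d n \<in> borel_measurable lebesgue" for n
    unfolding d_def[abs_def] using mt int(2) by measurable
  have "integral\<^sup>L lebesgue (d n) = 0" for n
    unfolding d_def[abs_def] using it int(1) by (simp add: et)
  moreover have "(\<lambda>n. integral\<^sup>L lebesgue (d n)) \<longlonglongrightarrow> (LINT x|lebesgue. partial i \<phi> x)"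
  proof (rule integral_dominated_convergence[where w = "\<lambda>x. (2 ^ ?k * C) / (1 + norm x) ^ ?k"])
    show "integrable lebesgue (\<lambda>x :: real ^ 'd. (2 ^ ?k * C) / (1 + norm x) ^ ?k)"
      using integrable_mult_right[OF integrable_decay[where 'd = 'd, OF order_refl], of "2 ^ ?k * C"] by simp
    show "partial i \<phi> \<in> borel_measurable lebesgue"
      by (intro borel_imp_lebesgue smooth_borel smooth_partial schwartz_smooth \<phi>)
  qed (use md lim bound in auto)
  ultimately show ?thesis by (simp add: LIMSEQ_const_iff)
qed

text \<open>Integration by parts: the derivative of \<phi> times a plane wave has integral zero, and
  the product rule splits it into the two sides.\<close>

lemma fourier_partial:
  fixes \<phi> :: "'d::finite fn"
  assumes \<phi>: "\<phi> \<in> schwartz_fns"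
  shows "fourier (partial i \<phi>) \<xi> = \<i> * complex_of_real (\<xi> $ i) * fourier \<phi> \<xi>"
proof -
  have "partial i (\<lambda>x. \<phi> x * wave \<xi> x) = (\<lambda>x. \<phi> x * (- \<i> * complex_of_real (\<xi> $ i) * wave \<xi> x) + partial i \<phi> x * wave \<xi> x)"
    using partial_mult_fn[OF schwartz_smooth[OF \<phi>] smooth_wave[of \<xi>], of i] by (simp add: partial_wave)
  then have eq: "partial i (\<lambda>x. \<phi> x * wave \<xi> x)
      = (\<lambda>x. partial i \<phi> x * wave \<xi> x - \<i> * complex_of_real (\<xi> $ i) * (\<phi> x * wave \<xi> x))"
    by (simp add: fun_eq_iff mult_ac)
  have I: "integrable lebesgue (\<lambda>x. partial i \<phi> x * wave \<xi> x)" "integrable lebesgue (\<lambda>x. \<phi> x * wave \<xi> x)"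
    by (intro integrable_mult_wave rapid_integrable schwartz_rapid schwartz_partial \<phi>)+
  have "0 = (LINT x|lebesgue. partial i \<phi> x * wave \<xi> x - \<i> * complex_of_real (\<xi> $ i) * (\<phi> x * wave \<xi> x))"
    using integral_partial_eq_0[OF schwartz_mult_wave[OF \<phi>, of \<xi>], of i] unfolding eq by simp
  also have "\<dots> = (LINT x|lebesgue. partial i \<phi> x * wave \<xi> x) - \<i> * complex_of_real (\<xi> $ i) * (LINT x|lebesgue. \<phi> x * wave \<xi> x)"
    by (subst Bochner_Integration.integral_diff)
      (auto simp only: I integral_mult_right_zero integrable_mult_right)
  finally show ?thesis by (simp add: fourier_wave)
qed

text \<open>In the induction a factor 1 + norm \<xi> is at most 1 plus the sum of the |\<xi>_i|, and
  each |\<xi>_i| turns into a derivative of \<phi>. The constant is uniform in \<phi>, as the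
  continuity of the transform on Schwartz functions demands.\<close>

lemma fourier_decay:
  "\<exists>C\<ge>0. \<forall>\<phi>\<in>schwartz_fns. \<forall>\<xi> :: real ^ 'd::finite.
     (1 + norm \<xi>) ^ m * norm (fourier \<phi> \<xi>) \<le> C * schwartz_seminorm (m + 2 * CARD('d)) \<phi>"
proof (induction m)
  case 0
  let ?c = "fourier_const TYPE('d)" and ?k = "2 * CARD('d)"
  let ?J = "LINT x|lebesgue. 1 / (1 + norm (x :: real ^ 'd)) ^ ?k"
  have J: "0 \<le> ?J" by (intro integral_nonneg_AE) auto
  have "norm (fourier \<phi> \<xi>) \<le> ?c * ?J * schwartz_seminorm ?k \<phi>"
    if \<phi>: "\<phi> \<in> schwartz_fns" for \<phi> and \<xi> :: "real ^ 'd"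
  proof -
    have "norm (LINT x|lebesgue. \<phi> x * wave \<xi> x) \<le> schwartz_seminorm ?k \<phi> * ?J"
    proof (rule integral_decay_le)
      show "(\<lambda>x. \<phi> x * wave \<xi> x) \<in> borel_measurable lebesgue"
        by (intro borel_measurable_times wave_measurable rapid_measurable schwartz_rapid \<phi>)
      show "norm (\<phi> x * wave \<xi> x) \<le> schwartz_seminorm ?k \<phi> / (1 + norm x) ^ ?k" for x
        using le_schwartz_seminorm[OF \<phi>, of "[]" ?k ?k x]
        by (subst pos_le_divide_eq) (auto simp: norm_mult mult_ac add_pos_nonneg)
    qed simp
    then show ?thesis
      using fourier_const_pos[where 'd = 'd] by (simp add: fourier_wave mult_ac mult_left_mono)
  qed
  then show ?case
    using J fourier_const_pos[where 'd = 'd] by (intro exI[of _ "?c * ?J"]) auto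
next
  case (Suc m)
  then obtain C where C: "0 \<le> C" "\<And>\<phi> \<xi> :: real ^ 'd. \<phi> \<in> schwartz_fns \<Longrightarrow>
     (1 + norm \<xi>) ^ m * norm (fourier \<phi> \<xi>) \<le> C * schwartz_seminorm (m + 2 * CARD('d)) \<phi>" by blast
  let ?k = "m + 2 * CARD('d)"
  let ?K = "real (card {\<alpha> :: 'd list. length \<alpha> \<le> ?k})"
  have "(1 + norm \<xi>) ^ Suc m * norm (fourier \<phi> \<xi>) \<le> (C * ?K * (1 + CARD('d))) * schwartz_seminorm (Suc ?k) \<phi>"
    if \<phi>: "\<phi> \<in> schwartz_fns" for \<phi> and \<xi> :: "real ^ 'd"
  proof -
    have "(1 + norm \<xi>) ^ Suc m * norm (fourier \<phi> \<xi>)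
        = (1 + norm \<xi>) ^ m * ((1 + norm \<xi>) * norm (fourier \<phi> \<xi>))"
      by (simp add: mult_ac)
    also have "\<dots> \<le> (1 + norm \<xi>) ^ m * ((1 + (\<Sum>i\<in>UNIV. \<bar>\<xi> $ i\<bar>)) * norm (fourier \<phi> \<xi>))"
      using norm_le_l1_cart[of \<xi>] by (intro mult_left_mono mult_right_mono) auto
    also have "\<dots> = (1 + norm \<xi>) ^ m * norm (fourier \<phi> \<xi>)
        + (\<Sum>i\<in>UNIV. (1 + norm \<xi>) ^ m * norm (fourier (partial i \<phi>) \<xi>))"
      by (simp add: fourier_partial[OF \<phi>] norm_mult algebra_simps sum_distrib_left sum_distrib_right)
    also have "\<dots> \<le> C * (?K * schwartz_seminorm (Suc ?k) \<phi>) + (\<Sum>i\<in>(UNIV :: 'd set). C * (?K * schwartz_seminorm (Suc ?k) \<phi>))"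
    proof (intro add_mono sum_mono)
      show "(1 + norm \<xi>) ^ m * norm (fourier \<phi> \<xi>) \<le> C * (?K * schwartz_seminorm (Suc ?k) \<phi>)"
        by (rule order_trans[OF C(2)[OF \<phi>] mult_left_mono[OF schwartz_seminorm_Suc[OF \<phi>] C(1)]])
      show "(1 + norm \<xi>) ^ m * norm (fourier (partial i \<phi>) \<xi>) \<le> C * (?K * schwartz_seminorm (Suc ?k) \<phi>)" for i
        by (rule order_trans[OF C(2)[OF schwartz_partial[OF \<phi>]] mult_left_mono[OF schwartz_seminorm_partial[OF \<phi>] C(1)]])
    qed
    also have "\<dots> = (C * ?K * (1 + CARD('d))) * schwartz_seminorm (Suc ?k) \<phi>"
      by (simp add: algebra_simps)
    finally show ?thesis .
  qed
  then show ?case using C(1) by (intro exI[of _ "C * ?K * (1 + CARD('d))"]) auto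
qed

lemma schwartz_fourier:
  fixes \<phi> :: "'d::finite fn"
  assumes \<phi>: "\<phi> \<in> schwartz_fns"
  shows "fourier \<phi> \<in> schwartz_fns"
proof (rule schwartzI)
  show "fourier \<phi> \<in> smooth_fns" by (intro smooth_fourier schwartz_rapid \<phi>)
  fix \<alpha> :: "'d list" and k
  have "(\<lambda>x. freq \<alpha> x * \<phi> x) \<in> schwartz_fns" using schwartz_freq_mult[of \<alpha> 0] \<phi> by blast
  with fourier_decay[of k, where 'd = 'd]
  show "\<exists>C. \<forall>\<xi>. (1 + norm \<xi>) ^ k * norm (partials \<alpha> (fourier \<phi>) \<xi>) \<le> C"
    by (auto simp: partials_fourier[OF schwartz_rapid[OF \<phi>]])
qed

lemma schwartz_seminorm_mono:
  fixes \<phi> :: "'d::finite fn"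
  assumes "m \<le> n"
  shows "\<exists>C\<ge>0. \<forall>\<phi> :: 'd fn \<in> schwartz_fns. schwartz_seminorm m \<phi> \<le> C * schwartz_seminorm n \<phi>"
proof -
  have "schwartz_seminorm m \<phi> \<le> card {\<alpha> :: 'd list. length \<alpha> \<le> m} * schwartz_seminorm n \<phi>"
    if "\<phi> \<in> schwartz_fns" for \<phi> :: "'d fn"
    by (rule schwartz_seminorm_le) (use assms in \<open>auto intro!: le_schwartz_seminorm that\<close>)
  then show ?thesis by (intro exI[of _ "real (card {\<alpha> :: 'd list. length \<alpha> \<le> m})"]) auto
qed

text \<open>Derivatives of the transform are transforms of \<open>freq \<alpha>\<close> times
  \<phi>; the constants belonging to the finitely many multi-indices of length at most m are
  summed.\<close>

lemma fourier_seminorm: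
  "\<exists>C k. \<forall>\<phi> :: 'd::finite fn \<in> schwartz_fns. schwartz_seminorm m (fourier \<phi>) \<le> C * schwartz_seminorm k \<phi>"
proof -
  let ?n = "m + 2 * CARD('d)" and ?L = "{\<alpha> :: 'd list. length \<alpha> \<le> m}"
  obtain C where C: "0 \<le> C" "\<And>\<phi> \<xi> :: real ^ 'd. \<phi> \<in> schwartz_fns \<Longrightarrow>
     (1 + norm \<xi>) ^ m * norm (fourier \<phi> \<xi>) \<le> C * schwartz_seminorm ?n \<phi>"
    using fourier_decay by blast
  have "\<exists>D\<ge>0. \<forall>\<phi> :: 'd fn \<in> schwartz_fns. (\<lambda>x. freq \<alpha> x * \<phi> x) \<in> schwartz_fns \<and>
     schwartz_seminorm ?n (\<lambda>x. freq \<alpha> x * \<phi> x) \<le> D * schwartz_seminorm (?n + m) \<phi>"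
    if "\<alpha> \<in> ?L" for \<alpha> :: "'d list"
  proof -
    obtain D1 where D1: "0 \<le> D1" "\<And>\<phi> :: 'd fn. \<phi> \<in> schwartz_fns \<Longrightarrow> (\<lambda>x. freq \<alpha> x * \<phi> x) \<in> schwartz_fns"
     "\<And>\<phi> :: 'd fn. \<phi> \<in> schwartz_fns \<Longrightarrow> schwartz_seminorm ?n (\<lambda>x. freq \<alpha> x * \<phi> x) \<le> D1 * schwartz_seminorm (?n + length \<alpha>) \<phi>"
      using schwartz_freq_mult by blast
    have "?n + length \<alpha> \<le> ?n + m" using that by simp
    from schwartz_seminorm_mono[OF this, where 'd = 'd] obtain D2 where
      D2: "0 \<le> D2" "\<And>\<phi> :: 'd fn. \<phi> \<in> schwartz_fns \<Longrightarrow> schwartz_seminorm (?n + length \<alpha>) \<phi> \<le> D2 * schwartz_seminorm (?n + m) \<phi>"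
      by blast
    have "schwartz_seminorm ?n (\<lambda>x. freq \<alpha> x * \<phi> x) \<le> (D1 * D2) * schwartz_seminorm (?n + m) \<phi>"
      if "\<phi> \<in> schwartz_fns" for \<phi> :: "'d fn"
      using order_trans[OF D1(3)[OF that] mult_left_mono[OF D2(2)[OF that] D1(1)]] by (simp add: mult_ac)
    with D1 D2 show ?thesis by (intro exI[of _ "D1 * D2"]) auto
  qed
  then have "\<exists>D. \<forall>\<alpha>\<in>?L. D \<alpha> \<ge> 0 \<and> (\<forall>\<phi> :: 'd fn \<in> schwartz_fns. (\<lambda>x. freq \<alpha> x * \<phi> x) \<in> schwartz_fns \<and>
     schwartz_seminorm ?n (\<lambda>x. freq \<alpha> x * \<phi> x) \<le> D \<alpha> * schwartz_seminorm (?n + m) \<phi>)"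
    by (intro bchoice) blast
  then obtain D where D: "\<And>\<alpha>. \<alpha> \<in> ?L \<Longrightarrow> 0 \<le> D \<alpha>"
    "\<And>\<alpha> \<phi>. \<alpha> \<in> ?L \<Longrightarrow> \<phi> \<in> schwartz_fns \<Longrightarrow> (\<lambda>x. freq \<alpha> x * \<phi> x) \<in> schwartz_fns"
    "\<And>\<alpha> \<phi>. \<alpha> \<in> ?L \<Longrightarrow> \<phi> \<in> schwartz_fns \<Longrightarrow>
      schwartz_seminorm ?n (\<lambda>x. freq \<alpha> x * \<phi> x) \<le> D \<alpha> * schwartz_seminorm (?n + m) \<phi>"
    by blast
  have "schwartz_seminorm m (fourier \<phi>) \<le> (card ?L * (C * (\<Sum>\<alpha>\<in>?L. D \<alpha>))) * schwartz_seminorm (?n + m) \<phi>"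
    if \<phi>: "\<phi> \<in> schwartz_fns" for \<phi> :: "'d fn"
  proof -
    have "schwartz_seminorm m (fourier \<phi>) \<le> card ?L * (C * ((\<Sum>\<alpha>\<in>?L. D \<alpha>) * schwartz_seminorm (?n + m) \<phi>))"
    proof (rule schwartz_seminorm_le)
      fix \<alpha> :: "'d list" and \<xi> :: "real ^ 'd" assume \<alpha>: "length \<alpha> \<le> m"
      then have \<alpha>': "\<alpha> \<in> ?L" by simp
      have "(1 + norm \<xi>) ^ m * norm (partials \<alpha> (fourier \<phi>) \<xi>)
          \<le> C * schwartz_seminorm ?n (\<lambda>x. freq \<alpha> x * \<phi> x)"
        using C(2)[OF D(2)[OF \<alpha>' \<phi>]] by (simp add: partials_fourier[OF schwartz_rapid[OF \<phi>]])
      also have "\<dots> \<le> C * (D \<alpha> * schwartz_seminorm (?n + m) \<phi>)"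
        by (intro mult_left_mono D \<phi> \<alpha>' C)
      also have "\<dots> \<le> C * ((\<Sum>\<alpha>\<in>?L. D \<alpha>) * schwartz_seminorm (?n + m) \<phi>)"
        using D(1) \<alpha>' by (intro mult_left_mono mult_right_mono C schwartz_seminorm_nonneg \<phi> member_le_sum finite_lists_le) auto
      finally show "(1 + norm \<xi>) ^ m * norm (partials \<alpha> (fourier \<phi>) \<xi>)
        \<le> C * ((\<Sum>\<alpha>\<in>?L. D \<alpha>) * schwartz_seminorm (?n + m) \<phi>)" .
    qed
    then show ?thesis by (simp add: mult_ac)
  qed
  then show ?thesis by blast
qed

section \<open>Fourier inversion\<close>

lemma gaussian_integrable: "integrable lborel (\<lambda>t. exp (- t\<^sup>2 / 2) :: real)"
proof -
  have "integrable lborel (\<lambda>t. sqrt (2 * pi) * std_normal_density t)"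
    by (intro integrable_mult_right integrable_normal_density) auto
  then show ?thesis by (simp add: std_normal_density_def)
qed

text \<open>The characteristic function of the standard normal distribution is exp(-s^2 / 2); only
  the normalisation of the density has to be removed.\<close>

lemma gaussian_fourier_integral:
  "(LINT t|lborel. complex_of_real (exp (- t\<^sup>2 / 2)) * iexp (s * t)) = complex_of_real (sqrt (2 * pi) * exp (- s\<^sup>2 / 2))"
proof -
  have "complex_of_real (exp (- s\<^sup>2 / 2)) = char std_normal_distribution s"
    by (simp add: char_std_normal_distribution)
  also have "\<dots> = (LINT t|lborel. std_normal_density t *\<^sub>R iexp (s * t))"
    unfolding char_def by (subst integral_density) auto
  also have "\<dots> = (LINT t|lborel. complex_of_real (1 / sqrt (2 * pi)) * (complex_of_real (exp (- t\<^sup>2 / 2)) * iexp (s * t)))"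
    by (simp add: std_normal_density_def scaleR_conv_of_real)
  also have "\<dots> = complex_of_real (1 / sqrt (2 * pi)) * (LINT t|lborel. complex_of_real (exp (- t\<^sup>2 / 2)) * iexp (s * t))"
    by (rule integral_mult_right_zero)
  finally have "complex_of_real (sqrt (2 * pi)) * complex_of_real (exp (- s\<^sup>2 / 2))
     = complex_of_real (sqrt (2 * pi)) * (complex_of_real (1 / sqrt (2 * pi)) * (LINT t|lborel. complex_of_real (exp (- t\<^sup>2 / 2)) * iexp (s * t)))"
    by (rule arg_cong)
  then show ?thesis by (simp flip: mult.assoc of_real_mult)
qed

lemma
  assumes "0 < \<epsilon>"
  shows scaled_gaussian_integrable: "integrable lborel (\<lambda>t. complex_of_real (exp (- (\<epsilon> * t)\<^sup>2 / 2)) * iexp (- s * t))"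
    and scaled_gaussian_fourier_integral:
      "(LINT t|lborel. complex_of_real (exp (- (\<epsilon> * t)\<^sup>2 / 2)) * iexp (- s * t))
        = complex_of_real (sqrt (2 * pi) / \<epsilon> * exp (- (s / \<epsilon>)\<^sup>2 / 2))"
proof -
  let ?f = "\<lambda>t. complex_of_real (exp (- t\<^sup>2 / 2)) * iexp (- (s / \<epsilon>) * t)"
  have f: "?f (0 + \<epsilon> * t) = complex_of_real (exp (- (\<epsilon> * t)\<^sup>2 / 2)) * iexp (- s * t)" for t
    using assms by simp
  have "integrable lborel ?f"
    by (rule Bochner_Integration.integrable_bound[OF gaussian_integrable]) (auto simp: norm_mult)
  then have "integrable lborel (\<lambda>t. ?f (0 + \<epsilon> * t))"
    using assms by (intro lborel_integrable_real_affine) auto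
  then show "integrable lborel (\<lambda>t. complex_of_real (exp (- (\<epsilon> * t)\<^sup>2 / 2)) * iexp (- s * t))"
    unfolding f .
  have "complex_of_real (sqrt (2 * pi) * exp (- (s / \<epsilon>)\<^sup>2 / 2)) = (LINT t|lborel. ?f t)"
    by (subst gaussian_fourier_integral) simp
  also have "\<dots> = \<epsilon> *\<^sub>R (LINT t|lborel. ?f (0 + \<epsilon> * t))"
    using assms by (subst lborel_integral_real_affine[where c = \<epsilon> and t = 0]) auto
  finally show "(LINT t|lborel. complex_of_real (exp (- (\<epsilon> * t)\<^sup>2 / 2)) * iexp (- s * t))
        = complex_of_real (sqrt (2 * pi) / \<epsilon> * exp (- (s / \<epsilon>)\<^sup>2 / 2))"
    unfolding f using assms by (simp add: scaleR_conv_of_real field_simps)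
qed

text \<open>The Gaussian exp(-(\<epsilon> |x|)^2 / 2), written as a product over the coordinates so
  that its Fourier integral factorises.\<close>

definition gauss :: "real \<Rightarrow> real ^ 'd::finite \<Rightarrow> complex" where
  "gauss \<epsilon> x = (\<Prod>i\<in>UNIV. complex_of_real (exp (- (\<epsilon> * x $ i)\<^sup>2 / 2)))"

lemma gauss_measurable [measurable]: "gauss \<epsilon> \<in> borel_measurable borel"
  unfolding gauss_def[abs_def] by measurable

lemma norm_gauss_le: "norm (gauss \<epsilon> x) \<le> 1"
  unfolding gauss_def prod_norm[symmetric] by (rule prod_le_1) auto

lemma gauss_wave:
  "gauss \<epsilon> x * wave \<zeta> x = (\<Prod>i\<in>UNIV. complex_of_real (exp (- (\<epsilon> * x $ i)\<^sup>2 / 2)) * iexp (- (\<zeta> $ i) * x $ i))"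
proof -
  have "wave \<zeta> x = (\<Prod>i\<in>UNIV. iexp (- (\<zeta> $ i) * x $ i))"
    by (simp add: wave_def inner_vec_def sum_distrib_left mult_ac flip: exp_sum sum_negf)
  then show ?thesis by (simp add: gauss_def prod.distrib)
qed

lemma fourier_const_sqrt: "fourier_const TYPE('d::finite) * sqrt (2 * pi) ^ CARD('d) = 1"
proof -
  have "sqrt (2 * pi) ^ CARD('d) = (2 * pi) powr (real CARD('d) / 2)"
    by (simp add: powr_half_sqrt[symmetric] powr_power)
  then show ?thesis by (simp add: fourier_const_def flip: powr_add)
qed

lemma
  fixes \<zeta> :: "real ^ 'd::finite"
  assumes "0 < \<epsilon>"
  shows integrable_gauss_wave: "integrable lborel (\<lambda>x. gauss \<epsilon> x * wave \<zeta> x)"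
    and integral_gauss_wave: "fourier_const TYPE('d) *\<^sub>R (LINT x|lborel. gauss \<epsilon> x * wave \<zeta> x)
        = (1 / \<epsilon>) ^ CARD('d) *\<^sub>R gauss (1 / \<epsilon>) \<zeta>"
proof -
  show "integrable lborel (\<lambda>x. gauss \<epsilon> x * wave \<zeta> x)"
    unfolding gauss_wave by (intro integrable_lborel_vec_prod scaled_gaussian_integrable assms)
  have "(LINT x|lborel. gauss \<epsilon> x * wave \<zeta> x)
      = (\<Prod>i\<in>UNIV. complex_of_real (sqrt (2 * pi) / \<epsilon> * exp (- (\<zeta> $ i / \<epsilon>)\<^sup>2 / 2)))"
    unfolding gauss_wave
    by (subst integral_lborel_vec_prod)
      (simp_all only: scaled_gaussian_integrable[OF assms] scaled_gaussian_fourier_integral[OF assms])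
  also have "\<dots> = complex_of_real ((sqrt (2 * pi) / \<epsilon>) ^ CARD('d)) * gauss (1 / \<epsilon>) \<zeta>"
    by (simp add: gauss_def prod.distrib power_divide prod_dividef)
  finally show "fourier_const TYPE('d) *\<^sub>R (LINT x|lborel. gauss \<epsilon> x * wave \<zeta> x)
        = (1 / \<epsilon>) ^ CARD('d) *\<^sub>R gauss (1 / \<epsilon>) \<zeta>"
    using fourier_const_sqrt[where 'd = 'd]
    by (simp add: scaleR_conv_of_real power_divide field_simps flip: of_real_mult of_real_power)
qed

lemma fourier_lborel:
  fixes a :: "'d::finite fn"
  assumes "a \<in> borel_measurable borel"
  shows "fourier a \<xi> = fourier_const TYPE('d) *\<^sub>R (LINT x|lborel. a x * wave \<xi> x)"
  unfolding fourier_wave using assms smooth_borel[OF smooth_wave, of \<xi>] by (subst integral_completion) auto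

text \<open>Fubini together with the symmetry of the kernel,
  \<open>wave \<xi> x = wave x \<xi>\<close>. The Borel assumptions keep the argument on the product
  of \<open>lborel\<close> with itself.\<close>

lemma fourier_mult_formula:
  fixes a b :: "'d::finite fn"
  assumes [measurable]: "a \<in> borel_measurable borel" "b \<in> borel_measurable borel"
    and a: "integrable lborel a" and b: "integrable lborel b"
  shows "(LINT \<xi>|lborel. fourier a \<xi> * b \<xi>) = (LINT x|lborel. a x * fourier b x)"
proof -
  let ?c = "fourier_const TYPE('d)"
  let ?f = "\<lambda>(x, \<xi>). a x * b \<xi> * wave \<xi> x"
  have m: "?f \<in> borel_measurable (lborel \<Otimes>\<^sub>M lborel)"
    unfolding wave_def by measurable
  have I: "integrable (lborel \<Otimes>\<^sub>M lborel) ?f"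
  proof (rule lborel_pair.Fubini_integrable[OF m])
    show "integrable lborel (\<lambda>x. LINT \<xi>|lborel. norm (?f (x, \<xi>)))"
      using a by (simp add: norm_mult)
    show "AE x in lborel. integrable lborel (\<lambda>\<xi>. ?f (x, \<xi>))"
    proof (intro AE_I2)
      fix x
      have "integrable lborel (\<lambda>\<xi>. a x * b \<xi>)" using b by simp
      then show "integrable lborel (\<lambda>\<xi>. ?f (x, \<xi>))"
        by (rule Bochner_Integration.integrable_bound) (auto simp: norm_mult wave_def[abs_def])
    qed
  qed
  have w: "wave \<xi> x = wave x \<xi>" for \<xi> x :: "real ^ 'd"
    by (simp add: wave_def inner_commute)
  have "(LINT \<xi>|lborel. fourier a \<xi> * b \<xi>) = ?c *\<^sub>R (LINT \<xi>|lborel. (LINT x|lborel. ?f (x, \<xi>)))"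
  proof -
    have "fourier a \<xi> * b \<xi> = ?c *\<^sub>R (LINT x|lborel. ?f (x, \<xi>))" for \<xi>
    proof -
      have "(LINT x|lborel. ?f (x, \<xi>)) = (LINT x|lborel. (a x * wave \<xi> x) * b \<xi>)"
        by (simp add: mult_ac)
      also have "\<dots> = (LINT x|lborel. a x * wave \<xi> x) * b \<xi>"
        by (rule integral_mult_left_zero)
      finally show ?thesis by (simp add: fourier_lborel)
    qed
    then show ?thesis by simp
  qed
  also have "\<dots> = ?c *\<^sub>R (LINT x|lborel. (LINT \<xi>|lborel. ?f (x, \<xi>)))"
    using lborel_pair.Fubini_integral[of "\<lambda>x \<xi>. a x * b \<xi> * wave \<xi> x"] I by simp
  also have "\<dots> = (LINT x|lborel. a x * fourier b x)"
  proof -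
    have "a x * fourier b x = ?c *\<^sub>R (LINT \<xi>|lborel. ?f (x, \<xi>))" for x
    proof -
      have "(LINT \<xi>|lborel. ?f (x, \<xi>)) = (LINT \<xi>|lborel. a x * (b \<xi> * wave x \<xi>))"
        using w by (simp add: mult_ac)
      also have "\<dots> = a x * (LINT \<xi>|lborel. b \<xi> * wave x \<xi>)"
        by (rule integral_mult_right_zero)
      finally show ?thesis by (simp add: fourier_lborel)
    qed
    then show ?thesis by simp
  qed
  finally show ?thesis .
qed

text \<open>The double integral behind the twofold transform does not converge absolutely, so a
  Gaussian of width 1 / r is inserted. The multiplication formula moves the transform onto the
  Gaussian factor, which becomes an approximate identity at x; after the substitution y = x + r z
  both sides have limits as r tends to 0.\<close>

theorem fourier_inversion:
  fixes \<phi> :: "'d::finite fn"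
  assumes \<phi>: "\<phi> \<in> schwartz_fns"
  shows "fourier (fourier \<phi>) (- x) = \<phi> x"
proof -
  let ?c = "fourier_const TYPE('d)"
  define r where "r n = inverse (real (Suc n))" for n
  have r: "0 < r n" for n by (simp add: r_def)
  have rlim: "r \<longlonglongrightarrow> 0" unfolding r_def by (rule LIMSEQ_inverse_real_of_nat)
  have m\<phi>: "\<phi> \<in> borel_measurable borel" "fourier \<phi> \<in> borel_measurable borel"
    by (intro smooth_borel schwartz_smooth schwartz_fourier \<phi>)+
  have I: "integrable lborel \<phi>" "integrable lborel (fourier \<phi>)"
    using rapid_integrable[OF schwartz_rapid[OF \<phi>]] rapid_integrable[OF schwartz_rapid[OF schwartz_fourier[OF \<phi>]]] m\<phi>
    by (auto simp: integrable_completion)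
  have mw [measurable]: "wave \<zeta> \<in> borel_measurable borel" for \<zeta> :: "real ^ 'd"
    by (intro smooth_borel smooth_wave)
  have mg [measurable]: "(\<lambda>y :: real ^ 'd. gauss e (y - x)) \<in> borel_measurable borel" for e
    by (rule measurable_compose[OF _ gauss_measurable]) simp
  have ww: "wave (- x) \<xi> * wave y \<xi> = wave (y - x) \<xi>" for y \<xi>
    by (simp add: wave_def inner_diff_right algebra_simps flip: exp_add)
  have eq: "(LINT \<xi>|lborel. fourier \<phi> \<xi> * (gauss (r n) \<xi> * wave (- x) \<xi>))
      = (LINT z|lebesgue. \<phi> (x + r n *\<^sub>R z) * gauss 1 z)" (is "?L n = ?R n") for n
  proof -
    have M: "(\<lambda>y. (1 / r n) ^ CARD('d) *\<^sub>R (\<phi> y * gauss (1 / r n) (y - x))) \<in> borel_measurable borel"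
      by (intro borel_measurable_scaleR borel_measurable_const borel_measurable_times m\<phi> mg)
    have "?L n = (LINT y|lborel. \<phi> y * fourier (\<lambda>\<xi>. gauss (r n) \<xi> * wave (- x) \<xi>) y)"
      by (intro fourier_mult_formula m\<phi> I integrable_gauss_wave r) measurable
    also have "\<dots> = (LINT y|lborel. (1 / r n) ^ CARD('d) *\<^sub>R (\<phi> y * gauss (1 / r n) (y - x)))"
    proof -
      have "fourier (\<lambda>\<xi>. gauss (r n) \<xi> * wave (- x) \<xi>) y = (1 / r n) ^ CARD('d) *\<^sub>R gauss (1 / r n) (y - x)" for y
        unfolding integral_gauss_wave[OF r, symmetric]
        by (subst fourier_lborel) (measurable, simp add: mult.assoc ww)
      then show ?thesis by simp
    qed
    also have "\<dots> = (LINT y|lebesgue. (1 / r n) ^ CARD('d) *\<^sub>R (\<phi> y * gauss (1 / r n) (y - x)))"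
      by (rule integral_completion[symmetric]) (simp only: measurable_lborel1 measurable_lborel2 M)
    also have "\<dots> = \<bar>r n\<bar> ^ DIM(real ^ 'd) *\<^sub>R
       (LINT z|lebesgue. (1 / r n) ^ CARD('d) *\<^sub>R (\<phi> (x + r n *\<^sub>R z) * gauss (1 / r n) (x + r n *\<^sub>R z - x)))"
    proof (rule integral_lebesgue_affine)
      show "(\<lambda>y. (1 / r n) ^ CARD('d) *\<^sub>R (\<phi> y * gauss (1 / r n) (y - x))) \<in> borel_measurable lebesgue"
        by (rule borel_imp_lebesgue[OF M])
    qed (use r[of n] in auto)
    also have "\<dots> = ?R n"
      using r[of n] by (simp add: gauss_def power_divide)
    finally show ?thesis .
  qed
  have "?L \<longlonglongrightarrow> (LINT \<xi>|lborel. fourier \<phi> \<xi> * wave (- x) \<xi>)"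
  proof (rule integral_dominated_convergence[where w = "\<lambda>\<xi>. norm (fourier \<phi> \<xi>)"])
    show "AE \<xi> in lborel. (\<lambda>n. fourier \<phi> \<xi> * (gauss (r n) \<xi> * wave (- x) \<xi>)) \<longlonglongrightarrow> fourier \<phi> \<xi> * wave (- x) \<xi>"
    proof (intro AE_I2)
      fix \<xi> :: "real ^ 'd"
      have "(\<lambda>n. gauss (r n) \<xi>) \<longlonglongrightarrow> (\<Prod>i\<in>(UNIV :: 'd set). complex_of_real (exp (- (0 * \<xi> $ i)\<^sup>2 / 2)))"
        unfolding gauss_def by (intro tendsto_intros rlim) auto
      then have "(\<lambda>n. gauss (r n) \<xi>) \<longlonglongrightarrow> 1" by simp
      then have "(\<lambda>n. fourier \<phi> \<xi> * (gauss (r n) \<xi> * wave (- x) \<xi>)) \<longlonglongrightarrow> fourier \<phi> \<xi> * (1 * wave (- x) \<xi>)"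
        by (intro tendsto_intros)
      then show "(\<lambda>n. fourier \<phi> \<xi> * (gauss (r n) \<xi> * wave (- x) \<xi>)) \<longlonglongrightarrow> fourier \<phi> \<xi> * wave (- x) \<xi>" by simp
    qed
    show "AE \<xi> in lborel. norm (fourier \<phi> \<xi> * (gauss (r n) \<xi> * wave (- x) \<xi>)) \<le> norm (fourier \<phi> \<xi>)" for n
      by (auto simp: norm_mult mult_left_le norm_gauss_le)
  qed (use m\<phi> I in auto)
  moreover have "?R \<longlonglongrightarrow> (LINT z|lebesgue. \<phi> x * gauss 1 (z :: real ^ 'd))"
  proof -
    obtain C where C: "\<And>x. norm (\<phi> x) \<le> C" using schwartz_bound[OF \<phi>, of 0 "[]"] by auto
    have cont: "continuous_on UNIV \<phi>" by (intro smooth_continuous schwartz_smooth \<phi>)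
    have "integrable lborel (\<lambda>z :: real ^ 'd. gauss 1 z)"
      using integrable_gauss_wave[of 1 "0 :: real ^ 'd"] by (simp add: wave_def)
    then have g: "integrable lebesgue (\<lambda>z :: real ^ 'd. gauss 1 z)" by (simp add: integrable_completion)
    show ?thesis
    proof (rule integral_dominated_convergence[where w = "\<lambda>z :: real ^ 'd. C * norm (gauss 1 z)"])
      show "(\<lambda>z :: real ^ 'd. \<phi> x * gauss 1 z) \<in> borel_measurable lebesgue"
        by (intro borel_imp_lebesgue) measurable
      show "(\<lambda>z. \<phi> (x + r n *\<^sub>R z) * gauss 1 z) \<in> borel_measurable lebesgue" for n
        by (intro borel_imp_lebesgue borel_measurable_times gauss_measurable
            measurable_compose[OF _ m\<phi>(1)] borel_measurable_continuous_onI continuous_intros)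
      show "AE z in lebesgue. (\<lambda>n. \<phi> (x + r n *\<^sub>R z) * gauss 1 z) \<longlonglongrightarrow> \<phi> x * gauss 1 z"
      proof (intro AE_I2 tendsto_intros)
        fix z :: "real ^ 'd"
        have "(\<lambda>n. x + r n *\<^sub>R z) \<longlonglongrightarrow> x + 0 *\<^sub>R z" by (intro tendsto_intros rlim)
        then show "(\<lambda>n. \<phi> (x + r n *\<^sub>R z)) \<longlonglongrightarrow> \<phi> x"
          using continuous_on_tendsto_compose[OF cont, of "\<lambda>n. x + r n *\<^sub>R z" x] by simp
      qed
      show "integrable lebesgue (\<lambda>z. C * norm (gauss 1 (z :: real ^ 'd)))" using g by auto
      show "AE z in lebesgue. norm (\<phi> (x + r n *\<^sub>R z) * gauss 1 z) \<le> C * norm (gauss 1 z)" for n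
        by (auto simp: norm_mult intro!: mult_right_mono C)
    qed
  qed
  ultimately have "(LINT \<xi>|lborel. fourier \<phi> \<xi> * wave (- x) \<xi>) = (LINT z|lebesgue. \<phi> x * gauss 1 (z :: real ^ 'd))"
    unfolding eq by (rule LIMSEQ_unique)
  also have "\<dots> = \<phi> x * (LINT z|lborel. gauss 1 (z :: real ^ 'd) * wave 0 z)"
    by (subst integral_completion) (auto simp: wave_def)
  finally have "fourier (fourier \<phi>) (- x) = \<phi> x * (?c *\<^sub>R (LINT z|lborel. gauss 1 (z :: real ^ 'd) * wave 0 z))"
    by (simp add: fourier_lborel[OF m\<phi>(2)])
  \<comment> \<open>At \<epsilon> = 1 and \<zeta> = 0 the transform of the Gaussian has the value 1,
    which settles the normalisation.\<close>
  also have "\<dots> = \<phi> x"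
    by (subst integral_gauss_wave) (auto simp: gauss_def)
  finally show ?thesis .
qed

section \<open>Pairing compactly supported distributions with Fourier integrals\<close>

lemma compact_distribution_add:
  "compact_distribution w \<Longrightarrow> \<phi> \<in> smooth_fns \<Longrightarrow> \<psi> \<in> smooth_fns \<Longrightarrow> w (\<lambda>x. \<phi> x + \<psi> x) = w \<phi> + w \<psi>"
  by (simp add: compact_distribution_def linear_functional_on_def)

lemma compact_distribution_cmult:
  "compact_distribution w \<Longrightarrow> \<phi> \<in> smooth_fns \<Longrightarrow> w (\<lambda>x. c * \<phi> x) = c * w \<phi>"
  by (simp add: compact_distribution_def linear_functional_on_def)

lemma compact_distribution_diff:
  assumes "compact_distribution w" "\<phi> \<in> smooth_fns" "\<psi> \<in> smooth_fns"
  shows "w (\<lambda>x. \<phi> x - \<psi> x) = w \<phi> - w \<psi>"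
  using compact_distribution_add[OF assms(1,2) smooth_cmult[OF assms(3), of "-1"]]
    compact_distribution_cmult[OF assms(1,3), of "-1"] by simp

lemma compact_distribution_0: "compact_distribution w \<Longrightarrow> w (\<lambda>x. 0) = 0"
  using compact_distribution_cmult[of w "\<lambda>x. 0" 0] by (simp add: smooth_const)

lemma compact_distribution_sum:
  assumes "compact_distribution w" "finite P" "\<And>p. p \<in> P \<Longrightarrow> \<phi> p \<in> smooth_fns"
  shows "w (\<lambda>x. \<Sum>p\<in>P. c p * \<phi> p x) = (\<Sum>p\<in>P. c p * w (\<phi> p))"
  using assms(2,3)
proof (induction P rule: finite_induct)
  case empty
  then show ?case by (simp add: compact_distribution_0 assms(1))
next
  case (insert p P)
  then have "w (\<lambda>x. c p * \<phi> p x + (\<Sum>p\<in>P. c p * \<phi> p x)) = w (\<lambda>x. c p * \<phi> p x) + w (\<lambda>x. \<Sum>p\<in>P. c p * \<phi> p x)"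
    by (intro compact_distribution_add assms(1) smooth_cmult smooth_sum) auto
  with insert show ?case by (simp add: compact_distribution_cmult[OF assms(1)])
qed

text \<open>Continuity in pointwise form: a bound K for the derivatives up to order m on the ball of
  radius m is all that w sees. Estimates for plane waves and their differences then apply without
  evaluating seminorms.\<close>

lemma compact_distribution_bound:
  fixes w :: "'d::finite functional"
  assumes "compact_distribution w"
  shows "\<exists>C m. 0 \<le> C \<and> 1 \<le> m \<and> (\<forall>\<phi>\<in>smooth_fns. \<forall>K. (\<forall>\<alpha> x. length \<alpha> \<le> m \<longrightarrow> norm x \<le> real m \<longrightarrow> norm (partials \<alpha> \<phi> x) \<le> K) \<longrightarrow> norm (w \<phi>) \<le> C * K)"
proof -
  obtain C m where C: "\<And>\<phi>. \<phi> \<in> smooth_fns \<Longrightarrow> norm (w \<phi>) \<le> C * smooth_seminorm m \<phi>"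
    using assms by (auto simp: compact_distribution_def)
  let ?K = "real (card {\<alpha> :: 'd list. length \<alpha> \<le> m})"
  have "norm (w \<phi>) \<le> (\<bar>C\<bar> * ?K) * K" if "\<phi> \<in> smooth_fns"
    "\<forall>\<alpha> x. length \<alpha> \<le> Suc m \<longrightarrow> norm x \<le> real (Suc m) \<longrightarrow> norm (partials \<alpha> \<phi> x) \<le> K" for \<phi> K
  proof -
    have 1: "0 \<le> smooth_seminorm m \<phi>"
      using order_trans[OF norm_ge_zero le_smooth_seminorm[OF that(1), of 0 m "[]"]] by simp
    have 2: "smooth_seminorm m \<phi> \<le> ?K * K" by (rule smooth_seminorm_le) (use that(2) in auto)
    have "norm (w \<phi>) \<le> \<bar>C\<bar> * smooth_seminorm m \<phi>"
      using order_trans[OF C[OF that(1)] mult_right_mono[OF abs_ge_self 1]] .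
    also have "\<dots> \<le> \<bar>C\<bar> * (?K * K)" using 2 by (intro mult_left_mono) auto
    finally show ?thesis by (simp add: mult_ac)
  qed
  then show ?thesis by (intro exI[of _ "\<bar>C\<bar> * ?K"] exI[of _ "Suc m"]) auto
qed

text \<open>Derivatives of order at most m of a plane wave are bounded by
  \<open>(1 + norm \<eta>) ^ m\<close>, which gives polynomial growth; the Lipschitz dependence of
  plane waves on bounded frequencies gives continuity.\<close>

lemma compact_distribution_wave:
  fixes w :: "'d::finite functional"
  assumes w: "compact_distribution w"
  shows compact_distribution_wave_bound: "\<exists>C m. 0 \<le> C \<and> (\<forall>\<eta>. norm (w (wave \<eta>)) \<le> C * (1 + norm \<eta>) ^ m)"
    and compact_distribution_wave_continuous: "continuous_on UNIV (\<lambda>\<eta>. w (wave \<eta>))"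
proof -
  obtain C m where C: "0 \<le> C" and le: "\<And>\<phi> K. \<phi> \<in> smooth_fns \<Longrightarrow>
    (\<And>\<alpha> x. length \<alpha> \<le> m \<Longrightarrow> norm x \<le> real m \<Longrightarrow> norm (partials \<alpha> \<phi> x) \<le> K) \<Longrightarrow> norm (w \<phi>) \<le> C * K"
    using compact_distribution_bound[OF w] by blast
  have "norm (w (wave \<eta>)) \<le> C * (1 + norm \<eta>) ^ m" for \<eta>
  proof (rule le[OF smooth_wave])
    fix \<alpha> :: "'d list" and x :: "real ^ 'd" assume "length \<alpha> \<le> m"
    then have "(1 + norm \<eta>) ^ length \<alpha> \<le> (1 + norm \<eta>) ^ m" by (intro power_increasing) auto
    with norm_freq_le[of \<alpha> \<eta>] show "norm (partials \<alpha> (wave \<eta>) x) \<le> (1 + norm \<eta>) ^ m"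
      by (simp add: partials_wave norm_mult)
  qed
  with C show "\<exists>C m. 0 \<le> C \<and> (\<forall>\<eta>. norm (w (wave \<eta>)) \<le> C * (1 + norm \<eta>) ^ m)" by blast
  have lip: "norm (w (wave \<zeta>) - w (wave \<eta>)) \<le> C * (2 * m * (1 + R) ^ m * norm (\<zeta> - \<eta>))"
    if "norm \<zeta> \<le> R" "norm \<eta> \<le> R" for \<zeta> \<eta> and R :: real
    unfolding compact_distribution_diff[OF w smooth_wave smooth_wave, symmetric]
  proof (rule le[OF smooth_diff[OF smooth_wave smooth_wave]])
    fix \<alpha> :: "'d list" and x :: "real ^ 'd" assume a: "length \<alpha> \<le> m" "norm x \<le> real m"
    have R: "0 \<le> R" using that norm_ge_zero order_trans by blast
    have "norm (partials \<alpha> (wave \<zeta>) x - partials \<alpha> (wave \<eta>) x)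
      \<le> (m + length \<alpha>) * (1 + R) ^ length \<alpha> * norm (\<zeta> - \<eta>)"
      using norm_partials_wave_diff_le[OF a(2) that] by simp
    also have "\<dots> \<le> (2 * m) * (1 + R) ^ m * norm (\<zeta> - \<eta>)"
      using a R by (intro mult_mono power_increasing mult_nonneg_nonneg) auto
    finally show "norm (partials \<alpha> (\<lambda>x. wave \<zeta> x - wave \<eta> x) x) \<le> 2 * m * (1 + R) ^ m * norm (\<zeta> - \<eta>)"
      by (simp add: partials_diff smooth_wave)
  qed
  show "continuous_on UNIV (\<lambda>\<eta>. w (wave \<eta>))"
  proof (intro continuous_at_imp_continuous_on ballI)
    fix \<eta> :: "real ^ 'd"
    let ?K = "C * (2 * m * (1 + (norm \<eta> + 1)) ^ m)"
    have "((\<lambda>\<zeta>. ?K * norm (\<zeta> - \<eta>)) \<longlongrightarrow> ?K * norm (\<eta> - \<eta>)) (at \<eta>)"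
      by (intro tendsto_intros)
    then have lim: "((\<lambda>\<zeta>. ?K * norm (\<zeta> - \<eta>)) \<longlongrightarrow> 0) (at \<eta>)" by simp
    have "eventually (\<lambda>\<zeta>. \<zeta> \<in> ball \<eta> 1) (at \<eta>)"
      by (rule eventually_at_in_open') auto
    then have "eventually (\<lambda>\<zeta>. norm (w (wave \<zeta>) - w (wave \<eta>)) \<le> ?K * norm (\<zeta> - \<eta>)) (at \<eta>)"
    proof eventually_elim
      case (elim \<zeta>)
      then have "norm \<zeta> \<le> norm \<eta> + 1"
        using norm_triangle_sub[of \<zeta> \<eta>] by (simp add: dist_norm norm_minus_commute)
      from lip[OF this, of \<eta>] show ?case by (simp add: mult_ac)
    qed
    then have "((\<lambda>\<zeta>. w (wave \<zeta>) - w (wave \<eta>)) \<longlongrightarrow> 0) (at \<eta>)"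
      using lim by (rule Lim_null_comparison)
    then show "isCont (\<lambda>\<eta>. w (wave \<eta>)) \<eta>"
      unfolding isCont_def by (rule LIM_zero_cancel)
  qed
qed

section \<open>Fourier transforms of compactly supported distributions\<close>

lemma norm_fourier_const_scaleR_le:
  "norm z \<le> K \<Longrightarrow> norm (fourier_const TYPE('d::finite) *\<^sub>R z) \<le> fourier_const TYPE('d) * K"
  using fourier_const_pos[where 'd = 'd] by (simp add: mult_left_mono)

lemma fourier_compact_wave: "fourier_compact w \<xi> = fourier_const TYPE('d) *\<^sub>R w (wave \<xi>)"
  for w :: "'d::finite functional"
  by (simp add: fourier_compact_def wave_def[abs_def])

lemma fourier_compact_bound:
  fixes w :: "'d::finite functional"
  assumes w: "compact_distribution w"
  shows "\<exists>C m. 0 \<le> C \<and> (\<forall>\<xi>. norm (fourier_compact w \<xi>) \<le> C * (1 + norm \<xi>) ^ m)"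
proof -
  let ?c = "fourier_const TYPE('d)"
  obtain C m where C: "0 \<le> C" "\<And>\<xi>. norm (w (wave \<xi>)) \<le> C * (1 + norm \<xi>) ^ m"
    using compact_distribution_wave_bound[OF w] by blast
  then have "norm (fourier_compact w \<xi>) \<le> (?c * C) * (1 + norm \<xi>) ^ m" for \<xi>
    using fourier_const_pos[where 'd = 'd] by (simp add: fourier_compact_wave mult.assoc mult_left_mono)
  with C(1) fourier_const_pos[where 'd = 'd] show ?thesis
    by (intro exI[of _ "?c * C"] exI[of _ m]) auto
qed

lemma fourier_compact_measurable:
  assumes "compact_distribution w"
  shows "fourier_compact w \<in> borel_measurable lebesgue"
  unfolding fourier_compact_wave[abs_def]
  by (intro borel_imp_lebesgue borel_measurable_scaleR borel_measurable_const
      borel_measurable_continuous_onI compact_distribution_wave_continuous assms)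

text \<open>The frequencies in \<open>cball 0 n\<close> are rounded to the lattice of mesh \<open>1 / n\<close>, which
  replaces a Fourier integral by a finite linear combination of plane waves.\<close>

definition round_freq :: "nat \<Rightarrow> real ^ 'd::finite \<Rightarrow> real ^ 'd" where
  "round_freq n \<eta> = (\<chi> i. of_int \<lfloor>real n * \<eta> $ i\<rfloor> / real n)"

lemma norm_round_freq_diff:
  fixes \<eta> :: "real ^ 'd::finite"
  assumes "0 < n"
  shows "norm (\<eta> - round_freq n \<eta>) \<le> CARD('d) / n"
proof -
  have "norm (\<eta> - round_freq n \<eta>) \<le> (\<Sum>i\<in>UNIV. \<bar>(\<eta> - round_freq n \<eta>) $ i\<bar>)"
    by (rule norm_le_l1_cart)
  also have "\<dots> \<le> (\<Sum>i\<in>(UNIV :: 'd set). 1 / n)"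
  proof (rule sum_mono)
    fix i
    have "\<bar>real n * \<eta> $ i - of_int \<lfloor>real n * \<eta> $ i\<rfloor>\<bar> \<le> 1" by linarith
    moreover have "(\<eta> - round_freq n \<eta>) $ i = (real n * \<eta> $ i - of_int \<lfloor>real n * \<eta> $ i\<rfloor>) / n"
      using assms by (simp add: round_freq_def field_simps)
    ultimately show "\<bar>(\<eta> - round_freq n \<eta>) $ i\<bar> \<le> 1 / n"
      using assms by (simp add: divide_right_mono)
  qed
  finally show ?thesis by simp
qed

lemma round_freq_measurable: "round_freq n \<in> borel_measurable lebesgue"
proof -
  have "(\<lambda>\<eta>. round_freq n \<eta> $ i) \<in> borel_measurable lebesgue" for i
    unfolding round_freq_def by (intro borel_imp_lebesgue) simp
  then show ?thesis
    by (subst borel_measurable_euclidean_space) (auto simp: Basis_vec_def inner_axis)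
qed

lemma finite_round_freq:
  fixes n :: nat
  shows "finite (round_freq n ` cball (0 :: real ^ 'd::finite) r)"
proof -
  let ?Z = "(\<lambda>k. of_int k / real n) ` {\<lfloor>- (real n * r)\<rfloor> .. \<lfloor>real n * r\<rfloor>}"
  have "round_freq n ` cball 0 r \<subseteq> (\<lambda>f. \<chi> i. f i) ` (UNIV \<rightarrow>\<^sub>E ?Z :: ('d \<Rightarrow> real) set)"
  proof (clarify)
    fix \<eta> :: "real ^ 'd" assume "\<eta> \<in> cball 0 r"
    then have "\<bar>\<eta> $ i\<bar> \<le> r" for i using component_le_norm_cart[of \<eta> i] by simp
    then have "\<eta> $ i \<le> r" "- r \<le> \<eta> $ i" for i by (auto simp: abs_le_iff minus_le_iff)
    then have "real n * \<eta> $ i \<le> real n * r" "- (real n * r) \<le> real n * \<eta> $ i" for i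
      using mult_left_mono[of "\<eta> $ i" r "real n"] mult_left_mono[of "- r" "\<eta> $ i" "real n"] by auto
    then have "of_int \<lfloor>real n * \<eta> $ i\<rfloor> / real n \<in> ?Z" for i
      by (intro imageI) (auto intro: floor_mono)
    then show "round_freq n \<eta> \<in> (\<lambda>f. \<chi> i. f i) ` (UNIV \<rightarrow>\<^sub>E ?Z)"
      by (intro image_eqI[of _ _ "\<lambda>i. of_int \<lfloor>real n * \<eta> $ i\<rfloor> / real n"]) (auto simp: round_freq_def)
  qed
  moreover have "finite ((\<lambda>f. \<chi> i. f i) ` (UNIV \<rightarrow>\<^sub>E ?Z :: ('d \<Rightarrow> real) set))"
    by (intro finite_imageI finite_PiE) auto
  ultimately show ?thesis by (rule finite_subset)
qed

lemma integral_finite_range: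
  fixes F :: "'b \<Rightarrow> complex" and a :: "'a \<Rightarrow> complex"
  assumes a: "integrable M a" and P: "finite P"
    and S: "\<And>p. p \<in> P \<Longrightarrow> {x \<in> space M. x \<in> X \<and> s x = p} \<in> sets M"
    and sP: "\<And>x. x \<in> X \<Longrightarrow> s x \<in> P"
  shows "integrable M (\<lambda>x. a x * (if x \<in> X then F (s x) else 0))"
    and "(LINT x|M. a x * (if x \<in> X then F (s x) else 0))
      = (\<Sum>p\<in>P. (LINT x|M. a x * indicator {x. x \<in> X \<and> s x = p} x) * F p)"
proof -
  have I: "integrable M (\<lambda>x. a x * indicator {x. x \<in> X \<and> s x = p} x)" if "p \<in> P" for p
  proof -
    have "integrable M (\<lambda>x. indicator {x \<in> space M. x \<in> X \<and> s x = p} x *\<^sub>R a x)"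
      by (intro integrable_mult_indicator S a that)
    then show ?thesis
      by (rule Bochner_Integration.integrable_cong[THEN iffD1, rotated 2]) (auto simp: indicator_def)
  qed
  have eq: "a x * (if x \<in> X then F (s x) else 0) = (\<Sum>p\<in>P. (a x * indicator {x. x \<in> X \<and> s x = p} x) * F p)" for x
  proof (cases "x \<in> X")
    case True
    have "(\<Sum>p\<in>P. (a x * indicator {x. x \<in> X \<and> s x = p} x) * F p) = (\<Sum>p\<in>P. if p = s x then a x * F p else 0)"
      by (rule sum.cong) (use True in \<open>auto simp: indicator_def\<close>)
    also have "\<dots> = a x * F (s x)" using sP[OF True] P by simp
    finally show ?thesis using True by simp
  qed simp
  show "integrable M (\<lambda>x. a x * (if x \<in> X then F (s x) else 0))"
    unfolding eq using I by auto
  show "(LINT x|M. a x * (if x \<in> X then F (s x) else 0))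
      = (\<Sum>p\<in>P. (LINT x|M. a x * indicator {x. x \<in> X \<and> s x = p} x) * F p)"
    unfolding eq using I by (subst Bochner_Integration.integral_sum) auto
qed

lemma rapid_mult_integrable:
  assumes a: "rapid a" and b: "b \<in> borel_measurable lebesgue" and le: "\<And>x. norm (b x) \<le> C * (1 + norm x) ^ k"
  shows "integrable lebesgue (\<lambda>x. a x * b x)"
proof (rule Bochner_Integration.integrable_bound[OF integrable_mult_right[OF rapid_moment[OF a, of k], of C]])
  show "(\<lambda>x. a x * b x) \<in> borel_measurable lebesgue"
    using rapid_measurable[OF a] b by simp
  show "AE x in lebesgue. norm (a x * b x) \<le> norm (C * ((1 + norm x) ^ k * norm (a x)))"
  proof (intro AE_I2)
    fix x
    have "norm (a x) * norm (b x) \<le> norm (a x) * (C * (1 + norm x) ^ k)"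
      by (intro mult_left_mono le) auto
    also have "\<dots> \<le> norm (C * ((1 + norm x) ^ k * norm (a x)))"
      by (simp add: mult_ac)
    finally show "norm (a x * b x) \<le> norm (C * ((1 + norm x) ^ k * norm (a x)))" by (simp add: norm_mult)
  qed
qed

lemma norm_integral_rapid_le:
  assumes a: "rapid a" and le: "\<And>x. norm (b x) \<le> C * (1 + norm x) ^ k"
    and b: "integrable lebesgue (\<lambda>x. a x * b x)"
  shows "norm (LINT x|lebesgue. a x * b x) \<le> C * (LINT x|lebesgue. (1 + norm x) ^ k * norm (a x))"
proof -
  have "norm (LINT x|lebesgue. a x * b x) \<le> (LINT x|lebesgue. norm (a x * b x))"
    by (rule integral_norm_bound)
  also have "\<dots> \<le> (LINT x|lebesgue. C * ((1 + norm x) ^ k * norm (a x)))"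
  proof (intro integral_mono integrable_norm b integrable_mult_right rapid_moment a)
    fix x
    have "norm (a x) * norm (b x) \<le> norm (a x) * (C * (1 + norm x) ^ k)"
      by (intro mult_left_mono le) auto
    then show "norm (a x * b x) \<le> C * ((1 + norm x) ^ k * norm (a x))" by (simp add: norm_mult mult_ac)
  qed
  also have "\<dots> = C * (LINT x|lebesgue. (1 + norm x) ^ k * norm (a x))"
    by (rule integral_mult_right_zero)
  finally show ?thesis .
qed

text \<open>A functional known only through linearity and seminorm bounds cannot be moved under an
  integral by Fubini. On a finite sum of plane waves it acts by linearity, and both the error before
  applying w and the error after it are O(1 / n).\<close>

theorem compact_distribution_fourier:
  fixes w :: "'d::finite functional"
  assumes w: "compact_distribution w" and a: "rapid a"
  shows "w (fourier a) = (LINT \<eta>|lebesgue. a \<eta> * fourier_compact w \<eta>)"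
proof -
  let ?c = "fourier_const TYPE('d)" and ?d = "real CARD('d)"
  obtain C m where C: "0 \<le> C" and m: "1 \<le> m" and le: "\<And>\<phi> K. \<phi> \<in> smooth_fns \<Longrightarrow>
    (\<And>\<alpha> x. length \<alpha> \<le> m \<Longrightarrow> norm x \<le> real m \<Longrightarrow> norm (partials \<alpha> \<phi> x) \<le> K) \<Longrightarrow> norm (w \<phi>) \<le> C * K"
    using compact_distribution_bound[OF w] by blast
  \<comment> \<open>\<open>(L / n) * (1 + norm \<eta>) ^ Suc m\<close> will bound the derivatives of
    the error at the frequency \<eta>. The first summand of \<open>L\<close> comes from rounding,
    the summand 1 from frequencies outside the ball; \<open>J\<close> is the matching moment of
    \<open>a\<close>.\<close>
  define L where "L = 2 * m * (1 + ?d) ^ m * ?d + 1"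
  define J where "J = (LINT \<eta>|lebesgue. (1 + norm \<eta>) ^ Suc m * norm (a \<eta>))"
  have wI: "integrable lebesgue (\<lambda>\<eta>. a \<eta> * w (wave \<eta>))"
  proof -
    obtain D k where "\<And>\<eta>. norm (w (wave \<eta>)) \<le> D * (1 + norm \<eta>) ^ k"
      using compact_distribution_wave_bound[OF w] by blast
    then show ?thesis
      by (intro rapid_mult_integrable[OF a] borel_imp_lebesgue borel_measurable_continuous_onI
          compact_distribution_wave_continuous w)
  qed
  have main: "norm (w (fourier a) - ?c *\<^sub>R (LINT \<eta>|lebesgue. a \<eta> * w (wave \<eta>))) \<le> (2 * ?c * C * L * J) / n"
    if n: "0 < n" for n :: nat
  proof -
    define X where "X = cball (0 :: real ^ 'd) n"
    define P where "P = round_freq n ` X"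
    define b where "b p = (LINT \<eta>|lebesgue. a \<eta> * indicator {\<eta>. \<eta> \<in> X \<and> round_freq n \<eta> = p} \<eta>)" for p
    have P: "finite P" unfolding P_def X_def by (rule finite_round_freq)
    have S: "{\<eta> \<in> space lebesgue. \<eta> \<in> X \<and> round_freq n \<eta> = p} \<in> sets lebesgue" for p
    proof -
      have "X \<inter> (round_freq n -` {p} \<inter> space lebesgue) \<in> sets lebesgue"
        by (intro sets.Int measurable_sets[OF round_freq_measurable]) (auto simp: X_def)
      moreover have "{\<eta> \<in> space lebesgue. \<eta> \<in> X \<and> round_freq n \<eta> = p} = X \<inter> (round_freq n -` {p} \<inter> space lebesgue)" by auto
      ultimately show ?thesis by simp
    qed
    have FR: "integrable lebesgue (\<lambda>\<eta>. a \<eta> * (if \<eta> \<in> X then F (round_freq n \<eta>) else 0))"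
      "(LINT \<eta>|lebesgue. a \<eta> * (if \<eta> \<in> X then F (round_freq n \<eta>) else 0)) = (\<Sum>p\<in>P. b p * F p)" for F :: "real ^ 'd \<Rightarrow> complex"
      unfolding b_def
      by (rule integral_finite_range[OF rapid_integrable[OF a] P S]; simp add: P_def)+
    \<comment> \<open>The error made at the frequency \<eta>: rounding inside the ball, omission
      outside.\<close>
    define E :: "real ^ 'd \<Rightarrow> 'd fn" where "E \<eta> = (\<lambda>x. wave \<eta> x - (if \<eta> \<in> X then wave (round_freq n \<eta>) x else 0))" for \<eta>
    have Eeq: "E \<eta> = (if \<eta> \<in> X then (\<lambda>x. wave \<eta> x - wave (round_freq n \<eta>) x) else wave \<eta>)" for \<eta>
      by (auto simp: E_def)
    have Esm: "E \<eta> \<in> smooth_fns" for \<eta> unfolding Eeq by (auto intro: smooth_diff smooth_wave)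
    have Ele: "norm (partials \<alpha> (E \<eta>) x) \<le> (L / n) * (1 + norm \<eta>) ^ Suc m" if \<alpha>: "length \<alpha> \<le> m" "norm x \<le> real m" for \<alpha> x \<eta>
    proof (cases "\<eta> \<in> X")
      case True
      let ?R = "norm \<eta> + ?d"
      have nd: "norm (\<eta> - round_freq n \<eta>) \<le> ?d / n" by (rule norm_round_freq_diff[OF n])
      also have "?d / n \<le> ?d / 1" using n by (intro divide_left_mono) auto
      finally have "norm (\<eta> - round_freq n \<eta>) \<le> ?d" by simp
      then have r: "norm (round_freq n \<eta>) \<le> ?R"
        using norm_triangle_sub[of "round_freq n \<eta>" \<eta>] by (simp add: norm_minus_commute)
      have "norm (partials \<alpha> (E \<eta>) x) \<le> (m + length \<alpha>) * (1 + ?R) ^ length \<alpha> * norm (\<eta> - round_freq n \<eta>)"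
        using norm_partials_wave_diff_le[OF \<alpha>(2) _ r, of \<eta> \<alpha>] True by (simp add: Eeq partials_diff smooth_wave)
      also have "\<dots> \<le> (2 * m) * ((1 + ?d) * (1 + norm \<eta>)) ^ m * (?d / n)"
      proof (intro mult_mono nd)
        have "(1 + ?R) ^ length \<alpha> \<le> (1 + ?R) ^ m" using \<alpha> by (intro power_increasing) auto
        also have "\<dots> \<le> ((1 + ?d) * (1 + norm \<eta>)) ^ m" by (intro power_mono) (auto simp: algebra_simps)
        finally show "(1 + ?R) ^ length \<alpha> \<le> ((1 + ?d) * (1 + norm \<eta>)) ^ m" .
      qed (use \<alpha> in auto)
      also have "\<dots> = (2 * m * (1 + ?d) ^ m * ?d) / n * (1 + norm \<eta>) ^ m"
        by (simp add: power_mult_distrib)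
      also have "\<dots> \<le> (L / n) * (1 + norm \<eta>) ^ Suc m"
        using n by (intro mult_mono divide_right_mono power_increasing) (auto simp: L_def)
      finally show ?thesis .
    next
      case False
      then have "real n < norm \<eta>" by (simp add: X_def)
      \<comment> \<open>Outside the ball 1 + norm \<eta> exceeds n, so one more power of the weight
        yields the factor 1 / n. Hence the exponent \<open>Suc m\<close>.\<close>
      then have 1: "1 \<le> 1 / n * (1 + norm \<eta>)" using n by (simp add: field_simps)
      have "norm (partials \<alpha> (E \<eta>) x) \<le> (1 + norm \<eta>) ^ length \<alpha>"
        using False norm_freq_le[of \<alpha> \<eta>] by (simp add: Eeq partials_wave norm_mult)
      also have "\<dots> \<le> (1 + norm \<eta>) ^ m" using \<alpha> by (intro power_increasing) auto
      also have "\<dots> \<le> (1 / n * (1 + norm \<eta>)) * (1 + norm \<eta>) ^ m"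
        using mult_right_mono[OF 1, of "(1 + norm \<eta>) ^ m"] by simp
      also have "\<dots> = (1 / n) * (1 + norm \<eta>) ^ Suc m" by simp
      also have "\<dots> \<le> (L / n) * (1 + norm \<eta>) ^ Suc m"
        using n by (intro mult_right_mono divide_right_mono) (auto simp: L_def)
      finally show ?thesis .
    qed
    let ?A = "\<lambda>x. \<Sum>p\<in>P. (?c *\<^sub>R b p) * wave p x"
    have Asm: "?A \<in> smooth_fns" by (intro smooth_sum P smooth_cmult smooth_wave)
    have fsm: "fourier a \<in> smooth_fns" by (rule smooth_fourier[OF a])
    \<comment> \<open>Comparison before applying w: the derivatives of \<open>fourier a\<close>
      minus \<open>?A\<close> are integrals of \<open>a\<close> against the derivatives of
      \<open>E\<close>.\<close>
    have 1: "norm (w (\<lambda>x. fourier a x - ?A x)) \<le> C * (?c * (L / n * J))"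
    proof (rule le[OF smooth_diff[OF fsm Asm]])
      fix \<alpha> :: "'d list" and x :: "real ^ 'd" assume \<alpha>: "length \<alpha> \<le> m" "norm x \<le> real m"
      have I1: "integrable lebesgue (\<lambda>\<eta>. a \<eta> * partials \<alpha> (wave \<eta>) x)"
      proof -
        have "integrable lebesgue (\<lambda>\<eta>. (freq \<alpha> \<eta> * a \<eta>) * wave x \<eta>)"
          by (intro integrable_mult_wave rapid_integrable partials_fourier(2) a)
        then show ?thesis by (simp add: partials_wave wave_def inner_commute mult_ac)
      qed
      have p1: "partials \<alpha> (fourier a) x = ?c *\<^sub>R (LINT \<eta>|lebesgue. a \<eta> * partials \<alpha> (wave \<eta>) x)"
        by (simp add: partials_fourier[OF a] fourier_wave partials_wave)
          (simp add: wave_def inner_commute mult_ac)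
      have p2: "partials \<alpha> ?A x = ?c *\<^sub>R (LINT \<eta>|lebesgue. a \<eta> * (if \<eta> \<in> X then partials \<alpha> (wave (round_freq n \<eta>)) x else 0))"
        unfolding FR(2)[of "\<lambda>p. partials \<alpha> (wave p) x"]
        by (subst partials_sum[OF P smooth_cmult[OF smooth_wave]])
          (simp only: partials_cmult[OF smooth_wave], simp only: scaleR_sum_right mult_scaleR_left)
      have pE: "partials \<alpha> (E \<eta>) x = partials \<alpha> (wave \<eta>) x - (if \<eta> \<in> X then partials \<alpha> (wave (round_freq n \<eta>)) x else 0)" for \<eta>
        by (simp add: Eeq partials_diff smooth_wave)
      have IE: "integrable lebesgue (\<lambda>\<eta>. a \<eta> * partials \<alpha> (E \<eta>) x)"
        unfolding pE right_diff_distrib by (intro Bochner_Integration.integrable_diff I1 FR)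
      have "partials \<alpha> (\<lambda>x. fourier a x - ?A x) x = partials \<alpha> (fourier a) x - partials \<alpha> ?A x"
        by (simp only: partials_diff[OF fsm Asm])
      also have "\<dots> = ?c *\<^sub>R (LINT \<eta>|lebesgue. a \<eta> * partials \<alpha> (E \<eta>) x)"
        unfolding p1 p2 pE right_diff_distrib
        by (simp only: Bochner_Integration.integral_diff[OF I1 FR(1)[of "\<lambda>p. partials \<alpha> (wave p) x"]] scaleR_diff_right)
      also have "norm \<dots> \<le> ?c * (L / n * J)"
        unfolding J_def by (intro norm_fourier_const_scaleR_le norm_integral_rapid_le[OF a Ele[OF \<alpha>] IE])
      finally show "norm (partials \<alpha> (\<lambda>x. fourier a x - ?A x) x) \<le> ?c * (L / n * J)" .
    qed
    have wA: "w ?A = ?c *\<^sub>R (LINT \<eta>|lebesgue. a \<eta> * (if \<eta> \<in> X then w (wave (round_freq n \<eta>)) else 0))"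
      unfolding FR(2)[of "\<lambda>p. w (wave p)"]
      by (subst compact_distribution_sum[OF w P smooth_wave]) (simp add: scaleR_sum_right)
    have wE: "w (E \<eta>) = w (wave \<eta>) - (if \<eta> \<in> X then w (wave (round_freq n \<eta>)) else 0)" for \<eta>
      by (simp add: Eeq compact_distribution_diff[OF w smooth_wave smooth_wave])
    have IwE: "integrable lebesgue (\<lambda>\<eta>. a \<eta> * w (E \<eta>))"
      unfolding wE right_diff_distrib by (intro Bochner_Integration.integrable_diff wI FR)
    \<comment> \<open>Comparison after applying w: here the error under the integral is
      \<open>w (E \<eta>)\<close>, and the same bound on the derivatives of \<open>E\<close>
      controls it.\<close>
    have "?c *\<^sub>R (LINT \<eta>|lebesgue. a \<eta> * w (wave \<eta>)) - w ?A = ?c *\<^sub>R (LINT \<eta>|lebesgue. a \<eta> * w (E \<eta>))"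
      unfolding wA wE right_diff_distrib
      by (simp only: Bochner_Integration.integral_diff[OF wI FR(1)[of "\<lambda>p. w (wave p)"]] scaleR_diff_right)
    also have "norm \<dots> \<le> ?c * (C * (L / n) * J)"
    proof -
      have "norm (w (E \<eta>)) \<le> C * (L / n) * (1 + norm \<eta>) ^ Suc m" for \<eta>
        using le[OF Esm Ele, of \<eta>] by (simp only: mult.assoc)
      from norm_integral_rapid_le[OF a this IwE] show ?thesis
        unfolding J_def by (rule norm_fourier_const_scaleR_le)
    qed
    finally have 2: "norm (?c *\<^sub>R (LINT \<eta>|lebesgue. a \<eta> * w (wave \<eta>)) - w ?A) \<le> ?c * (C * (L / n) * J)" .
    have "norm (w (fourier a) - ?c *\<^sub>R (LINT \<eta>|lebesgue. a \<eta> * w (wave \<eta>)))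
      \<le> norm (w (fourier a) - w ?A) + norm (?c *\<^sub>R (LINT \<eta>|lebesgue. a \<eta> * w (wave \<eta>)) - w ?A)"
      using norm_triangle_ineq4[of "w (fourier a) - w ?A" "?c *\<^sub>R (LINT \<eta>|lebesgue. a \<eta> * w (wave \<eta>)) - w ?A"] by simp
    also have "\<dots> \<le> C * (?c * (L / n * J)) + ?c * (C * (L / n) * J)"
      using 1 2 unfolding compact_distribution_diff[OF w fsm Asm] by (rule add_mono)
    also have "\<dots> = (2 * ?c * C * L * J) / n" by (simp add: field_simps)
    finally show ?thesis .
  qed
  have "norm (w (fourier a) - ?c *\<^sub>R (LINT \<eta>|lebesgue. a \<eta> * w (wave \<eta>))) \<le> 0"
  proof (rule LIMSEQ_le_const)
    show "(\<lambda>n. (2 * ?c * C * L * J) / real n) \<longlonglongrightarrow> 0" by (rule lim_const_over_n)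
    show "\<exists>N. \<forall>n\<ge>N. norm (w (fourier a) - ?c *\<^sub>R (LINT \<eta>|lebesgue. a \<eta> * w (wave \<eta>))) \<le> (2 * ?c * C * L * J) / real n"
      using main by (intro exI[of _ 1]) auto
  qed
  then have "w (fourier a) = ?c *\<^sub>R (LINT \<eta>|lebesgue. a \<eta> * w (wave \<eta>))" by simp
  then show ?thesis by (simp add: fourier_compact_wave)
qed

section \<open>Smooth cutoff functions\<close>

text \<open>A smooth function of one real variable is represented by the sequence of its derivatives.\<close>

definition derivs :: "(nat \<Rightarrow> real \<Rightarrow> real) \<Rightarrow> bool" where
  "derivs F \<longleftrightarrow> (\<forall>n t. (F n has_real_derivative F (Suc n) t) (at t))"

lemma derivsD: "derivs F \<Longrightarrow> (F n has_real_derivative F (Suc n) t) (at t)"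
  by (simp add: derivs_def)

lemma derivs_continuous: "derivs F \<Longrightarrow> continuous_on A (F n)"
  by (meson DERIV_isCont continuous_at_imp_continuous_on derivsD)

lemma derivs_affine:
  assumes "derivs F"
  shows "derivs (\<lambda>n t. c ^ n * F n (b + c * t))"
  unfolding derivs_def
proof (intro allI)
  fix n t
  have "((\<lambda>t. b + c * t) has_real_derivative c) (at t)" by (auto intro!: derivative_eq_intros)
  from DERIV_chain2[OF derivsD[OF assms] this, of n]
  have "((\<lambda>t. F n (b + c * t)) has_real_derivative F (Suc n) (b + c * t) * c) (at t)" .
  from DERIV_cmult[OF this, of "c ^ n"]
  show "((\<lambda>t. c ^ n * F n (b + c * t)) has_real_derivative c ^ Suc n * F (Suc n) (b + c * t)) (at t)"
    by (simp add: mult_ac)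
qed

lemma derivs_eq_0_on_open:
  assumes F: "derivs F" and U: "open U" and 0: "\<And>t. t \<in> U \<Longrightarrow> F 0 t = 0" and t: "t \<in> U"
  shows "F n t = 0"
  using t
proof (induction n arbitrary: t)
  case (Suc n)
  have "((\<lambda>t. 0) has_real_derivative F (Suc n) t) (at t)"
    by (rule has_field_derivative_transform_within_open[OF derivsD[OF F] U Suc.prems]) (rule Suc.IH)
  then show ?case using DERIV_unique[OF _ DERIV_const] by blast
qed (rule 0)

lemma continuous_antiderivative:
  fixes f :: "real \<Rightarrow> real"
  assumes "continuous_on UNIV f"
  shows "\<exists>\<Phi>. \<forall>t. (\<Phi> has_real_derivative f t) (at t)"
  using einterval_antiderivative[of "-\<infinity>" "\<infinity>" f] assms
  by (auto simp: has_real_derivative_iff_has_vector_derivative continuous_on_eq_continuous_at)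

text \<open>\<open>case_nat \<Phi> F\<close> is the derivative sequence that starts one step
  earlier, at the antiderivative. Differences of \<Phi> at t + b and t - b are integrals of
  \<open>F 0\<close> over intervals, so the lemma covers averages as well as convolution with the
  indicator of an interval.\<close>

lemma derivs_difference:
  assumes F: "derivs F" and \<Phi>: "\<And>t. (\<Phi> has_real_derivative F 0 t) (at t)"
  shows "derivs (\<lambda>n t. c * (case_nat \<Phi> F n (t + b) - case_nat \<Phi> F n (t - b)))"
  unfolding derivs_def
proof (intro allI)
  fix n t
  have H: "(case_nat \<Phi> F n has_real_derivative F n t) (at t)" for t
    by (cases n) (auto simp: \<Phi> derivsD[OF F])
  have "((\<lambda>t. case_nat \<Phi> F n (t + b)) has_real_derivative F n (t + b)) (at t)" for b
    using H[of "t + b"] by (simp add: DERIV_shift)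
  from this[of b] this[of "- b"]
  show "((\<lambda>t. c * (case_nat \<Phi> F n (t + b) - case_nat \<Phi> F n (t - b))) has_real_derivative
     c * (case_nat \<Phi> F (Suc n) (t + b) - case_nat \<Phi> F (Suc n) (t - b))) (at t)"
    by (intro DERIV_cmult DERIV_diff) auto
qed

text \<open>The witness is the average over intervals of length \<open>2 * \<epsilon>\<close>, a difference quotient of an
  antiderivative. By the mean value theorem averaging keeps bounds and moves supports by at most
  \<open>\<epsilon>\<close>, and each average pays for one derivative with a factor \<open>1 / \<epsilon>\<close>.\<close>

lemma averaging:
  assumes F: "derivs F" and \<epsilon>: "0 < \<epsilon>"
  shows "\<exists>G. derivs G \<and> (\<forall>n t. \<exists>s. \<bar>s - t\<bar> \<le> \<epsilon> \<and> G n t = F n s) \<and>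
     (\<forall>n t. \<exists>s s'. G (Suc n) t = (F n s - F n s') / (2 * \<epsilon>))"
proof -
  obtain \<Phi> where \<Phi>: "\<And>t. (\<Phi> has_real_derivative F 0 t) (at t)"
    using continuous_antiderivative[OF derivs_continuous[OF F]] by blast
  let ?H = "case_nat \<Phi> F"
  let ?G = "\<lambda>n t. 1 / (2 * \<epsilon>) * (?H n (t + \<epsilon>) - ?H n (t - \<epsilon>))"
  have "derivs ?G" by (rule derivs_difference[OF F \<Phi>])
  moreover have "\<exists>s. \<bar>s - t\<bar> \<le> \<epsilon> \<and> ?G n t = F n s" for n t
  proof -
    have H: "(?H n has_real_derivative F n t) (at t)" for t
      by (cases n) (auto simp: \<Phi> derivsD[OF F])
    have "t - \<epsilon> < t + \<epsilon>" using \<epsilon> by simp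
    from MVT2[OF this, of "?H n" "F n"] H obtain s where
      "t - \<epsilon> < s" "s < t + \<epsilon>" "?H n (t + \<epsilon>) - ?H n (t - \<epsilon>) = (t + \<epsilon> - (t - \<epsilon>)) * F n s" by blast
    with \<epsilon> show ?thesis by (intro exI[of _ s]) (auto simp: abs_le_iff)
  qed
  moreover have "\<exists>s s'. ?G (Suc n) t = (F n s - F n s') / (2 * \<epsilon>)" for n t
    by (intro exI[of _ "t + \<epsilon>"] exI[of _ "t - \<epsilon>"]) simp
  ultimately show ?thesis by (intro exI[of _ ?G] conjI allI)
qed

text \<open>A further average keeps the bounds already obtained, and it makes the derivative of
  order k + 1 a difference of two derivatives of order k divided by 2 \<epsilon>. Points move by at
  most \<epsilon> each time.\<close>

lemma averaging_iterate:
  assumes F: "derivs F" and \<epsilon>: "0 < \<epsilon>" and S: "\<And>t. \<bar>F 0 t\<bar> \<le> S"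
  shows "\<exists>G. derivs G \<and> (\<forall>n t. \<exists>s. \<bar>s - t\<bar> \<le> real k * \<epsilon> \<and> G n t = F n s) \<and>
     (\<forall>i\<le>k. \<forall>t. \<bar>G i t\<bar> \<le> S / \<epsilon> ^ i)"
proof (induction k)
  case 0
  show ?case using F S by (intro exI[of _ F]) auto
next
  case (Suc k)
  then obtain G where G: "derivs G" "\<And>n t. \<exists>s. \<bar>s - t\<bar> \<le> real k * \<epsilon> \<and> G n t = F n s"
    "\<And>i t. i \<le> k \<Longrightarrow> \<bar>G i t\<bar> \<le> S / \<epsilon> ^ i" by blast
  from averaging[OF G(1) \<epsilon>] obtain G' where G': "derivs G'"
    "\<And>n t. \<exists>s. \<bar>s - t\<bar> \<le> \<epsilon> \<and> G' n t = G n s"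
    "\<And>n t. \<exists>s s'. G' (Suc n) t = (G n s - G n s') / (2 * \<epsilon>)" by blast
  have "\<exists>s. \<bar>s - t\<bar> \<le> real (Suc k) * \<epsilon> \<and> G' n t = F n s" for n t
  proof -
    obtain s s' where "\<bar>s - t\<bar> \<le> \<epsilon>" "\<bar>s' - s\<bar> \<le> real k * \<epsilon>" "G' n t = G n s" "G n s = F n s'"
      using G(2) G'(2) by meson
    then show ?thesis by (intro exI[of _ s']) (auto simp: algebra_simps)
  qed
  moreover have "\<bar>G' i t\<bar> \<le> S / \<epsilon> ^ i" if "i \<le> Suc k" for i t
  proof (cases "i \<le> k")
    case True
    obtain s where "G' i t = G i s" using G'(2) by blast
    with G(3)[OF True] show ?thesis by simp
  next
    case False
    with that have i: "i = Suc k" by simp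
    obtain s s' where s: "G' i t = (G k s - G k s') / (2 * \<epsilon>)" using G'(3) i by blast
    have "\<bar>G k s - G k s'\<bar> \<le> 2 * (S / \<epsilon> ^ k)"
      using G(3)[of k s] G(3)[of k s'] abs_triangle_ineq4[of "G k s" "G k s'"] by simp
    then have "\<bar>G k s - G k s'\<bar> / (2 * \<epsilon>) \<le> 2 * (S / \<epsilon> ^ k) / (2 * \<epsilon>)"
      using \<epsilon> by (intro divide_right_mono) auto
    then show ?thesis using \<epsilon> by (simp add: s[unfolded i] i abs_mult mult_ac)
  qed
  ultimately show ?case using G'(1) by (intro exI[of _ G']) auto
qed

text \<open>With s = 1 / t one has d/dt = -s^2 d/ds, so differentiating p(s) exp(-s) with respect to
  t gives s^2 (p - p')(s) exp(-s).\<close>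

fun flat_poly :: "nat \<Rightarrow> real poly" where
  "flat_poly 0 = 1"
| "flat_poly (Suc n) = [:0, 0, 1:] * (flat_poly n - pderiv (flat_poly n))"

definition flat :: "nat \<Rightarrow> real \<Rightarrow> real" where
  "flat n t = (if 0 < t then poly (flat_poly n) (1 / t) * exp (- (1 / t)) else 0)"

lemma poly_times_exp_neg_tendsto_0: "((\<lambda>s. poly p s * exp (- s)) \<longlongrightarrow> (0::real)) at_top"
proof -
  have "((\<lambda>s. \<Sum>i\<le>degree p. coeff p i * (s ^ i / exp s)) \<longlongrightarrow> (\<Sum>i\<le>degree p. coeff p i * 0)) at_top"
    by (intro tendsto_intros tendsto_power_div_exp_0)
  then show ?thesis by (simp add: poly_altdef sum_distrib_left exp_minus divide_inverse mult_ac)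
qed

lemma derivs_flat: "derivs flat"
  unfolding derivs_def
proof (intro allI)
  fix n and t :: real
  consider "0 < t" | "t < 0" | "t = 0" by linarith
  then show "(flat n has_real_derivative flat (Suc n) t) (at t)"
  proof cases
    case 1
    have "((\<lambda>t. poly (flat_poly n) (1 / t) * exp (- (1 / t))) has_real_derivative flat (Suc n) t) (at t)"
      using 1 by (auto intro!: derivative_eq_intros DERIV_chain2[OF poly_DERIV]
          simp: flat_def power2_eq_square field_simps)
    then show ?thesis
      by (rule has_field_derivative_transform_within_open[of _ _ _ "{0<..}"]) (use 1 in \<open>auto simp: flat_def\<close>)
  next
    case 2
    have "((\<lambda>t. 0) has_real_derivative flat (Suc n) t) (at t)" using 2 by (simp add: flat_def)
    then show ?thesis
      by (rule has_field_derivative_transform_within_open[of _ _ _ "{..<0}"]) (use 2 in \<open>auto simp: flat_def\<close>)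
  next
    case 3
    have "((\<lambda>h. flat n h / h) \<longlongrightarrow> 0) (at_left 0)"
    proof (rule Lim_transform_eventually[OF tendsto_const])
      show "\<forall>\<^sub>F h in at_left 0. 0 = flat n h / h"
        by (auto simp: eventually_at_filter flat_def)
    qed
    moreover have "((\<lambda>h. flat n h / h) \<longlongrightarrow> 0) (at_right 0)"
    proof (rule Lim_transform_eventually)
      \<comment> \<open>Dividing by h multiplies the polynomial in 1 / h by its variable, hence
        \<open>pCons 0\<close>; the exponential still wins.\<close>
      show "((\<lambda>h. poly (pCons 0 (flat_poly n)) (inverse h) * exp (- inverse h)) \<longlongrightarrow> 0) (at_right 0)"
        by (rule filterlim_compose[OF poly_times_exp_neg_tendsto_0 filterlim_inverse_at_top_right])
      show "\<forall>\<^sub>F h in at_right 0. poly (pCons 0 (flat_poly n)) (inverse h) * exp (- inverse h) = flat n h / h"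
        by (auto simp: eventually_at_filter flat_def divide_inverse)
    qed
    ultimately have "((\<lambda>h. flat n h / h) \<longlongrightarrow> 0) (at 0)" by (simp add: filterlim_split_at)
    then show ?thesis using 3 by (simp add: has_field_derivative_iff flat_def)
  qed
qed

text \<open>Sums of products of derivatives of the two factors. The span is closed under
  differentiation, so iterating a choice of derivative yields a derivative sequence for the product
  without the binomial formula.\<close>

inductive_set leibniz_span :: "(nat \<Rightarrow> real \<Rightarrow> real) \<Rightarrow> (nat \<Rightarrow> real \<Rightarrow> real) \<Rightarrow> (real \<Rightarrow> real) set"
  for A B where
  prod: "(\<lambda>t. A j t * B k t) \<in> leibniz_span A B"
| add: "f \<in> leibniz_span A B \<Longrightarrow> g \<in> leibniz_span A B \<Longrightarrow> (\<lambda>t. f t + g t) \<in> leibniz_span A B"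

lemma derivs_mult:
  assumes A: "derivs A" and B: "derivs B"
  shows "\<exists>F. derivs F \<and> F 0 = (\<lambda>t. A 0 t * B 0 t)"
proof -
  have "\<exists>f'\<in>leibniz_span A B. \<forall>t. (f has_real_derivative f' t) (at t)" if "f \<in> leibniz_span A B" for f
    using that
  proof induction
    case (prod j k)
    show ?case
    proof (intro bexI allI)
      show "((\<lambda>t. A j t * B k t) has_real_derivative A (Suc j) t * B k t + A j t * B (Suc k) t) (at t)" for t
        using DERIV_mult[OF derivsD[OF A, of j t] derivsD[OF B, of k t]] by (simp add: mult_ac)
    qed (intro leibniz_span.intros)
  next
    case (add f g)
    then obtain f' g' where "f' \<in> leibniz_span A B" "\<And>t. (f has_real_derivative f' t) (at t)"
      "g' \<in> leibniz_span A B" "\<And>t. (g has_real_derivative g' t) (at t)" by blast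
    then show ?case
      by (intro bexI[of _ "\<lambda>t. f' t + g' t"] allI DERIV_add leibniz_span.add) auto
  qed
  then obtain D where D: "\<And>f. f \<in> leibniz_span A B \<Longrightarrow> D f \<in> leibniz_span A B"
    "\<And>f t. f \<in> leibniz_span A B \<Longrightarrow> (f has_real_derivative D f t) (at t)" by metis
  let ?F = "\<lambda>n. (D ^^ n) (\<lambda>t. A 0 t * B 0 t)"
  have "?F n \<in> leibniz_span A B" for n
    by (induction n) (auto intro: D leibniz_span.prod)
  then have "derivs ?F" by (simp add: derivs_def D)
  then show ?thesis by (intro exI[of _ ?F]) auto
qed

text \<open>The indicator of [-5/2, 5/2] is convolved with a normalised bump supported in [-1, 1]:
  the result is 1 at depth at least 1 inside the interval, which is |t| <= 3/2, and 0 beyond 5/2 + 1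
  = 7/2. Such a convolution is a difference of two values of an antiderivative of the bump.\<close>

lemma plateau_function:
  "\<exists>F B. derivs F \<and> (\<forall>t. \<bar>t\<bar> \<le> 3/2 \<longrightarrow> F 0 t = 1) \<and> (\<forall>n t. 7/2 < \<bar>t\<bar> \<longrightarrow> F n t = 0) \<and>
     (\<forall>t. 0 \<le> F 0 t \<and> F 0 t \<le> 1) \<and> (\<forall>n t. \<bar>F n t\<bar> \<le> B n)"
proof -
  \<comment> \<open>The product of \<open>flat 0\<close> at 1 + t and at 1 - t is positive exactly
    for |t| < 1; the powers of 1 and -1 are the form in which \<open>derivs_affine\<close> delivers
    the factors.\<close>
  obtain R where R: "derivs R" and "R 0 = (\<lambda>t. (1 ^ 0 * flat 0 (1 + 1 * t)) * ((-1) ^ 0 * flat 0 (1 + (-1) * t)))"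
    using derivs_mult[OF derivs_affine[OF derivs_flat, of 1 1] derivs_affine[OF derivs_flat, of "-1" 1]] by blast
  then have R0: "R 0 t = flat 0 (1 + t) * flat 0 (1 - t)" for t by simp
  have Rpos: "0 \<le> R 0 t" "\<bar>t\<bar> < 1 \<Longrightarrow> 0 < R 0 t" "1 \<le> \<bar>t\<bar> \<Longrightarrow> R 0 t = 0" for t
    by (auto simp: R0 flat_def)
  obtain \<Phi> where \<Phi>: "\<And>t. (\<Phi> has_real_derivative R 0 t) (at t)"
    using continuous_antiderivative[OF derivs_continuous[OF R]] by blast
  have mono: "\<Phi> s \<le> \<Phi> t" if "s \<le> t" for s t
    by (rule DERIV_nonneg_imp_nondecreasing[OF that]) (use \<Phi> Rpos(1) in blast)
  have right: "\<Phi> t = \<Phi> 1" if "1 \<le> t" for t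
  proof (cases "t = 1")
    case False
    with that have "1 < t" by simp
    from MVT2[OF this, of \<Phi> "R 0"] \<Phi> obtain z where "1 < z" "\<Phi> t - \<Phi> 1 = (t - 1) * R 0 z" by blast
    then show ?thesis using Rpos(3)[of z] by simp
  qed simp
  have left: "\<Phi> t = \<Phi> (-1)" if "t \<le> -1" for t
  proof (cases "t = -1")
    case False
    with that have "t < -1" by simp
    from MVT2[OF this, of \<Phi> "R 0"] \<Phi> obtain z where "z < -1" "\<Phi> (-1) - \<Phi> t = (-1 - t) * R 0 z" by blast
    then show ?thesis using Rpos(3)[of z] by simp
  qed simp
  \<comment> \<open>The integral of the bump, by which the plateau is normalised to height
    1.\<close>
  define I where "I = \<Phi> 1 - \<Phi> (-1)"
  have I: "0 < I"
  proof -
    have "(-1::real) < 1" by simp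
    from MVT2[OF this, of \<Phi> "R 0"] \<Phi> obtain z where "-1 < z" "z < 1" "\<Phi> 1 - \<Phi> (-1) = (1 - (-1)) * R 0 z" by blast
    then show ?thesis using Rpos(2)[of z] by (simp add: I_def)
  qed
  define F where "F = (\<lambda>n t. 1 / I * (case_nat \<Phi> R n (t + 5/2) - case_nat \<Phi> R n (t - 5/2)))"
  have F: "derivs F" unfolding F_def by (rule derivs_difference[OF R \<Phi>])
  have F0: "F 0 t = (\<Phi> (t + 5/2) - \<Phi> (t - 5/2)) / I" for t by (simp add: F_def)
  have one: "F 0 t = 1" if "\<bar>t\<bar> \<le> 3/2" for t
    using right[of "t + 5/2"] left[of "t - 5/2"] that I by (simp add: F0 I_def)
  have zero0: "F 0 t = 0" if "7/2 < \<bar>t\<bar>" for t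
  proof (cases "0 < t")
    case True
    then show ?thesis using right[of "t + 5/2"] right[of "t - 5/2"] that by (simp add: F0)
  next
    case False
    then show ?thesis using left[of "t + 5/2"] left[of "t - 5/2"] that by (simp add: F0)
  qed
  have zero: "F n t = 0" if "7/2 < \<bar>t\<bar>" for n t
    by (rule derivs_eq_0_on_open[OF F, of "{t. 7/2 < \<bar>t\<bar>}"])
      (use that zero0 in \<open>auto intro!: open_Collect_less continuous_intros\<close>)
  have range: "0 \<le> F 0 t \<and> F 0 t \<le> 1" for t
  proof -
    have "\<Phi> (t - 5/2) \<le> \<Phi> (t + 5/2)" by (rule mono) simp
    moreover have "\<Phi> (t + 5/2) \<le> \<Phi> 1" using right[of "t + 5/2"] mono[of "t + 5/2" 1] by linarith
    moreover have "\<Phi> (-1) \<le> \<Phi> (t - 5/2)" using left[of "t - 5/2"] mono[of "-1" "t - 5/2"] by linarith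
    ultimately show ?thesis using I by (simp add: F0 I_def field_simps)
  qed
  have "\<exists>b. \<forall>t. \<bar>F n t\<bar> \<le> b" for n
  proof -
    have "bounded (F n ` {-7/2..7/2})"
      by (intro compact_imp_bounded compact_continuous_image derivs_continuous F) auto
    then obtain b where b: "\<And>t. t \<in> {-7/2..7/2} \<Longrightarrow> \<bar>F n t\<bar> \<le> b"
      unfolding bounded_iff by (metis imageI real_norm_def)
    have "\<bar>F n t\<bar> \<le> max b 0" for t
    proof (cases "7/2 < \<bar>t\<bar>")
      case False
      then have "-7/2 \<le> t" "t \<le> 7/2" by linarith+
      then show ?thesis using b[of t] by (simp add: le_max_iff_disj)
    qed (simp add: zero)
    then show ?thesis by blast
  qed
  then obtain B where "\<And>n t. \<bar>F n t\<bar> \<le> B n" by metis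
  with F one zero range show ?thesis by (intro exI[of _ F] exI[of _ B]) auto
qed

text \<open>The plateau scaled by \<delta> is averaged N times with \<epsilon> = \<delta> / N. The
  total displacement is \<delta>, whence the radii 3/2 - 1 = 1/2 and 7/2 + 1 = 9/2 in units of
  \<delta>. The bounds \<open>B n\<close> are inherited from the plateau and independent of N, while
  N / \<delta> is the price 1 / \<epsilon> of one derivative.\<close>

lemma hoermander_cutoff_real:
  assumes \<delta>: "0 < \<delta>"
  shows "\<exists>B. \<forall>N\<ge>1. \<exists>G. derivs G \<and> (\<forall>t. \<bar>t\<bar> \<le> \<delta> / 2 \<longrightarrow> G 0 t = 1) \<and> (\<forall>n t. 9/2 * \<delta> < \<bar>t\<bar> \<longrightarrow> G n t = 0) \<and>
     (\<forall>t. 0 \<le> G 0 t \<and> G 0 t \<le> 1) \<and> (\<forall>n t. \<bar>G n t\<bar> \<le> B n) \<and>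
     (\<forall>i\<le>N. \<forall>t. \<bar>G i t\<bar> \<le> (real N / \<delta>) ^ i)"
proof -
  obtain F B where F: "derivs F" "\<And>t. \<bar>t\<bar> \<le> 3/2 \<Longrightarrow> F 0 t = 1" "\<And>n t. 7/2 < \<bar>t\<bar> \<Longrightarrow> F n t = 0"
    "\<And>t. 0 \<le> F 0 t \<and> F 0 t \<le> 1" "\<And>n t. \<bar>F n t\<bar> \<le> B n"
    using plateau_function by blast
  let ?F = "\<lambda>n t. (1 / \<delta>) ^ n * F n (0 + 1 / \<delta> * t)"
  have dF: "derivs ?F" by (rule derivs_affine[OF F(1)])
  show ?thesis
  proof (intro exI[of _ "\<lambda>n. (1 / \<delta>) ^ n * B n"] allI impI)
    fix N :: nat assume N: "1 \<le> N"
    have \<epsilon>: "0 < \<delta> / N" using \<delta> N by simp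
    have "\<bar>?F 0 t\<bar> \<le> 1" for t using F(4) by simp
    from averaging_iterate[OF dF \<epsilon> this, of N] obtain G where G: "derivs G"
      "\<And>n t. \<exists>s. \<bar>s - t\<bar> \<le> real N * (\<delta> / N) \<and> G n t = ?F n s"
      "\<And>i t. i \<le> N \<Longrightarrow> \<bar>G i t\<bar> \<le> 1 / (\<delta> / N) ^ i" by blast
    have "real N * (\<delta> / N) = \<delta>" using N by simp
    with G(2) have near: "\<exists>s. \<bar>s - t\<bar> \<le> \<delta> \<and> G n t = ?F n s" for n t by metis
    show "\<exists>G. derivs G \<and> (\<forall>t. \<bar>t\<bar> \<le> \<delta> / 2 \<longrightarrow> G 0 t = 1) \<and> (\<forall>n t. 9/2 * \<delta> < \<bar>t\<bar> \<longrightarrow> G n t = 0) \<and>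
     (\<forall>t. 0 \<le> G 0 t \<and> G 0 t \<le> 1) \<and> (\<forall>n t. \<bar>G n t\<bar> \<le> (1 / \<delta>) ^ n * B n) \<and>
     (\<forall>i\<le>N. \<forall>t. \<bar>G i t\<bar> \<le> (real N / \<delta>) ^ i)"
    proof (intro exI[of _ G] conjI allI impI G(1))
      show "G 0 t = 1" if "\<bar>t\<bar> \<le> \<delta> / 2" for t
      proof -
        obtain s where s: "\<bar>s - t\<bar> \<le> \<delta>" "G 0 t = ?F 0 s" using near by blast
        have "\<bar>s\<bar> \<le> 3/2 * \<delta>" using s(1) that by linarith
        then have "\<bar>1 / \<delta> * s\<bar> \<le> 3/2" using \<delta> by (simp add: abs_mult field_simps)
        then show ?thesis using F(2) s(2) by simp
      qed
      show "G n t = 0" if "9/2 * \<delta> < \<bar>t\<bar>" for n t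
      proof -
        obtain s where s: "\<bar>s - t\<bar> \<le> \<delta>" "G n t = ?F n s" using near by blast
        have "7/2 * \<delta> < \<bar>s\<bar>" using s(1) that by linarith
        then have "7/2 < \<bar>1 / \<delta> * s\<bar>" using \<delta> by (simp add: abs_mult field_simps)
        then show ?thesis using F(3) s(2) by simp
      qed
      show "0 \<le> G 0 t" "G 0 t \<le> 1" for t using near[of t 0] F(4) by auto
      show "\<bar>G n t\<bar> \<le> (1 / \<delta>) ^ n * B n" for n t
      proof -
        obtain s where "G n t = ?F n s" using near by blast
        then show ?thesis using F(5) \<delta> by (simp add: abs_mult mult_left_mono)
      qed
      show "\<bar>G i t\<bar> \<le> (real N / \<delta>) ^ i" if "i \<le> N" for i t
        using G(3)[OF that] by (simp add: power_divide)
    qed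
  qed
qed

text \<open>The argument \<open>k\<close> records how often each coordinate has been differentiated,
  so that the family over all \<open>k\<close> is closed under \<open>partial\<close>.\<close>

definition tensor :: "(nat \<Rightarrow> real \<Rightarrow> real) \<Rightarrow> real ^ 'd::finite \<Rightarrow> ('d \<Rightarrow> nat) \<Rightarrow> 'd fn" where
  "tensor G x0 k x = (\<Prod>i\<in>UNIV. complex_of_real (G (k i) (x $ i - x0 $ i)))"

lemma tensor_partial:
  fixes x0 :: "real ^ 'd::finite"
  assumes G: "derivs G"
  shows "tensor G x0 k differentiable (at x)"
    and "partial j (tensor G x0 k) x = tensor G x0 (k(j := Suc (k j))) x"
proof -
  let ?D = "\<lambda>h. \<Sum>i\<in>UNIV. complex_of_real (G (Suc (k i)) (x $ i - x0 $ i) * h $ i) *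
     (\<Prod>j\<in>UNIV - {i}. complex_of_real (G (k j) (x $ j - x0 $ j)))"
  have D: "(tensor G x0 k has_derivative ?D) (at x)"
    unfolding tensor_def[abs_def]
  proof (rule has_derivative_prod)
    fix i
    have "((\<lambda>x :: real ^ 'd. x $ i - x0 $ i) has_derivative (\<lambda>h. h $ i)) (at x)"
      by (auto intro!: derivative_eq_intros bounded_linear.has_derivative[OF bounded_linear_vec_nth])
    from has_derivative_of_real[OF has_derivative_compose[OF this derivsD[OF G, unfolded has_field_derivative_def]]]
    show "((\<lambda>x. complex_of_real (G (k i) (x $ i - x0 $ i))) has_derivative
      (\<lambda>h. complex_of_real (G (Suc (k i)) (x $ i - x0 $ i) * h $ i))) (at x)" .
  qed
  then show "tensor G x0 k differentiable (at x)" by (rule differentiableI)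
  have "partial j (tensor G x0 k) x = ?D (axis j 1)" by (rule partial_eqI[OF D])
  also have "\<dots> = (\<Sum>i\<in>UNIV. if i = j then complex_of_real (G (Suc (k j)) (x $ j - x0 $ j)) *
     (\<Prod>i\<in>UNIV - {j}. complex_of_real (G (k i) (x $ i - x0 $ i))) else 0)"
    by (rule sum.cong) (auto simp: axis_def)
  also have "\<dots> = complex_of_real (G (Suc (k j)) (x $ j - x0 $ j)) *
     (\<Prod>i\<in>UNIV - {j}. complex_of_real (G (k i) (x $ i - x0 $ i)))" by simp
  also have "\<dots> = tensor G x0 (k(j := Suc (k j))) x"
    unfolding tensor_def by (subst prod.remove[of _ j]) (auto intro!: prod.cong)
  finally show "partial j (tensor G x0 k) x = tensor G x0 (k(j := Suc (k j))) x" .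
qed

lemma tensor_partial_fn: "derivs G \<Longrightarrow> partial j (tensor G x0 k) = tensor G x0 (k(j := Suc (k j)))"
  by (rule ext) (rule tensor_partial(2))

lemma tensor_smooth: "derivs G \<Longrightarrow> tensor G x0 k \<in> smooth_fns"
  by (rule smooth_coinduct[where S = "range (tensor G x0)"])
    (auto simp: tensor_partial_fn tensor_partial(1))

lemma partials_tensor:
  assumes "derivs G"
  shows "partials \<alpha> (tensor G x0 (\<lambda>i. 0)) = tensor G x0 (count_list \<alpha>)"
proof (induction \<alpha>)
  case (Cons j \<alpha>)
  have "(count_list \<alpha>)(j := Suc (count_list \<alpha> j)) = count_list (j # \<alpha>)" by auto
  with Cons show ?case by (simp only: partials_Cons tensor_partial_fn[OF assms])
qed (simp add: fun_eq_iff)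

text \<open>A product of cutoffs in the single coordinates. In a repeated derivative in one
  direction the other factors remain undifferentiated and are at most 1, so the one-dimensional
  bound survives without loss. The norm is at most the sum of the coordinates, hence
  \<open>CARD('d)\<close> in the radius of the support.\<close>

lemma hoermander_cutoffs:
  fixes x0 :: "real ^ 'd::finite"
  assumes \<delta>: "0 < \<delta>"
  shows "\<exists>B. \<forall>N\<ge>1. \<exists>\<kappa>\<in>test_fns. (\<forall>x. norm (x - x0) \<le> \<delta> / 2 \<longrightarrow> \<kappa> x = 1) \<and>
     (\<forall>x. \<kappa> x \<noteq> 0 \<longrightarrow> norm (x - x0) \<le> 9/2 * \<delta> * CARD('d)) \<and>
     (\<forall>x. \<exists>r. 0 \<le> r \<and> r \<le> 1 \<and> \<kappa> x = complex_of_real r) \<and>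
     (\<forall>\<alpha> x. norm (partials \<alpha> \<kappa> x) \<le> B \<alpha>) \<and>
     (\<forall>i. \<forall>j\<le>N. \<forall>x. norm (partials (replicate j i) \<kappa> x) \<le> (real N / \<delta>) ^ j)"
proof -
  obtain B where B: "\<And>N. 1 \<le> N \<Longrightarrow> \<exists>G. derivs G \<and> (\<forall>t. \<bar>t\<bar> \<le> \<delta> / 2 \<longrightarrow> G 0 t = 1) \<and>
     (\<forall>n t. 9/2 * \<delta> < \<bar>t\<bar> \<longrightarrow> G n t = 0) \<and> (\<forall>t. 0 \<le> G 0 t \<and> G 0 t \<le> 1) \<and> (\<forall>n t. \<bar>G n t\<bar> \<le> B n) \<and>
     (\<forall>i\<le>N. \<forall>t. \<bar>G i t\<bar> \<le> (real N / \<delta>) ^ i)"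
    using hoermander_cutoff_real[OF \<delta>] by blast
  show ?thesis
  proof (intro exI[of _ "\<lambda>\<alpha>. \<Prod>i\<in>UNIV. B (count_list \<alpha> i)"] allI impI)
    fix N :: nat assume "1 \<le> N"
    from B[OF this] obtain G where G: "derivs G" "\<And>t. \<bar>t\<bar> \<le> \<delta> / 2 \<Longrightarrow> G 0 t = 1" "\<And>n t. 9/2 * \<delta> < \<bar>t\<bar> \<Longrightarrow> G n t = 0"
      "\<And>t. 0 \<le> G 0 t" "\<And>t. G 0 t \<le> 1" "\<And>n t. \<bar>G n t\<bar> \<le> B n"
      "\<And>i t. i \<le> N \<Longrightarrow> \<bar>G i t\<bar> \<le> (real N / \<delta>) ^ i" by blast
    let ?\<kappa> = "tensor G x0 (\<lambda>i. 0)"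
    have norm_partials: "norm (partials \<alpha> ?\<kappa> x) = (\<Prod>i\<in>UNIV. \<bar>G (count_list \<alpha> i) (x $ i - x0 $ i)\<bar>)" for \<alpha> x
      by (simp add: partials_tensor[OF G(1)] tensor_def flip: prod_norm)
    have supp: "norm (x - x0) \<le> 9/2 * \<delta> * CARD('d)" if "?\<kappa> x \<noteq> 0" for x
    proof -
      have "\<bar>(x - x0) $ i\<bar> \<le> 9/2 * \<delta>" for i
      proof (rule ccontr)
        assume "\<not> \<bar>(x - x0) $ i\<bar> \<le> 9/2 * \<delta>"
        then have "G 0 (x $ i - x0 $ i) = 0" using G(3)[of "x $ i - x0 $ i" 0] by simp
        with that show False by (auto simp: tensor_def)
      qed
      then have "(\<Sum>i\<in>UNIV. \<bar>(x - x0) $ i\<bar>) \<le> (\<Sum>i\<in>(UNIV :: 'd set). 9/2 * \<delta>)" by (intro sum_mono)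
      with norm_le_l1_cart[of "x - x0"] show ?thesis by (simp add: mult_ac)
    qed
    show "\<exists>\<kappa>\<in>test_fns. (\<forall>x. norm (x - x0) \<le> \<delta> / 2 \<longrightarrow> \<kappa> x = 1) \<and>
     (\<forall>x. \<kappa> x \<noteq> 0 \<longrightarrow> norm (x - x0) \<le> 9/2 * \<delta> * CARD('d)) \<and>
     (\<forall>x. \<exists>r. 0 \<le> r \<and> r \<le> 1 \<and> \<kappa> x = complex_of_real r) \<and>
     (\<forall>\<alpha> x. norm (partials \<alpha> \<kappa> x) \<le> (\<Prod>i\<in>UNIV. B (count_list \<alpha> i))) \<and>
     (\<forall>i. \<forall>j\<le>N. \<forall>x. norm (partials (replicate j i) \<kappa> x) \<le> (real N / \<delta>) ^ j)"
    proof (intro bexI[of _ ?\<kappa>] conjI allI impI supp)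
      show "?\<kappa> \<in> test_fns"
        by (rule test_fnsI[OF tensor_smooth[OF G(1)], of "cball x0 (9/2 * \<delta> * CARD('d))"])
          (auto dest!: supp simp: dist_norm norm_minus_commute)
      show "?\<kappa> x = 1" if "norm (x - x0) \<le> \<delta> / 2" for x
      proof -
        have "G 0 (x $ i - x0 $ i) = 1" for i
          using component_le_norm_cart[of "x - x0" i] that by (intro G(2)) simp
        then show ?thesis by (simp add: tensor_def)
      qed
      show "\<exists>r. 0 \<le> r \<and> r \<le> 1 \<and> ?\<kappa> x = complex_of_real r" for x
        by (intro exI[of _ "\<Prod>i\<in>UNIV. G 0 (x $ i - x0 $ i)"])
          (auto simp: tensor_def intro!: prod_nonneg prod_le_1 G)
      show "norm (partials \<alpha> ?\<kappa> x) \<le> (\<Prod>i\<in>UNIV. B (count_list \<alpha> i))" for \<alpha> x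
        unfolding norm_partials by (intro prod_mono) (auto intro: G)
      show "norm (partials (replicate j i) ?\<kappa> x) \<le> (real N / \<delta>) ^ j" if j: "j \<le> N" for i j x
      proof -
        have c: "count_list (replicate j i) l = (if l = i then j else 0)" for l
          by (induction j) auto
        have "norm (partials (replicate j i) ?\<kappa> x)
          \<le> (\<Prod>l\<in>UNIV. if l = i then (real N / \<delta>) ^ j else 1)"
          unfolding norm_partials c by (intro prod_mono) (use G j in auto)
        then show ?thesis by simp
      qed
    qed
  qed
qed

section \<open>Translation invariant BF-spaces\<close>

lemma one_plus_norm_pos: "0 < (1 + norm x) ^ k"
  by (simp add: add_pos_nonneg)

lemma real_polynomial_function_bound:
  assumes "real_polynomial_function p"
  shows "\<exists>C k. 0 \<le> C \<and> (\<forall>x. \<bar>p x\<bar> \<le> C * (1 + norm x) ^ k)"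
  using assms
proof induction
  case (linear f)
  then obtain K where K: "0 < K" "\<And>x. norm (f x) \<le> norm x * K" using bounded_linear.pos_bounded by blast
  have "\<bar>f x\<bar> \<le> K * (1 + norm x) ^ 1" for x
    using K(2)[of x] K(1) by (simp add: algebra_simps) 
  with K(1) show ?case by (intro exI[of _ K] exI[of _ 1]) auto
next
  case (const c)
  show ?case by (intro exI[of _ "\<bar>c\<bar>"] exI[of _ 0]) auto
next
  case (add f g)
  then obtain C k D l where C: "0 \<le> C" "\<And>x. \<bar>f x\<bar> \<le> C * (1 + norm x) ^ k"
    and D: "0 \<le> D" "\<And>x. \<bar>g x\<bar> \<le> D * (1 + norm x) ^ l" by blast
  have "\<bar>f x + g x\<bar> \<le> (C + D) * (1 + norm x) ^ (k + l)" for x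
  proof -
    have "\<bar>f x + g x\<bar> \<le> C * (1 + norm x) ^ k + D * (1 + norm x) ^ l"
      using C(2)[of x] D(2)[of x] by linarith
    also have "\<dots> \<le> C * (1 + norm x) ^ (k + l) + D * (1 + norm x) ^ (k + l)"
      using C(1) D(1) by (intro add_mono mult_left_mono power_increasing) auto
    finally show ?thesis by (simp add: algebra_simps)
  qed
  then show ?case using C(1) D(1) by (intro exI[of _ "C + D"] exI[of _ "k + l"]) auto
next
  case (mult f g)
  then obtain C k D l where C: "0 \<le> C" "\<And>x. \<bar>f x\<bar> \<le> C * (1 + norm x) ^ k"
    and D: "0 \<le> D" "\<And>x. \<bar>g x\<bar> \<le> D * (1 + norm x) ^ l" by blast
  have "\<bar>f x * g x\<bar> \<le> (C * D) * (1 + norm x) ^ (k + l)" for x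
    using mult_mono[OF C(2)[of x] D(2)[of x]] C(1) by (simp add: abs_mult power_add mult_ac)
  then show ?case using C(1) D(1) by (intro exI[of _ "C * D"] exI[of _ "k + l"]) auto
qed

text \<open>Moderateness with base point 0 compares v with a multiple of the polynomial.\<close>

lemma poly_moderate_weight_bound:
  assumes "v \<in> poly_moderate_weights"
  shows "\<exists>C k. 0 \<le> C \<and> (\<forall>x. v x \<le> C * (1 + norm x) ^ k)"
proof -
  obtain p C where p: "real_polynomial_function p" and v: "weight v" and C: "\<And>x y. v (x + y) \<le> C * v x * p y"
    using assms by (auto simp: poly_moderate_weights_def moderate_def)
  obtain D k where D: "0 \<le> D" "\<And>x. \<bar>p x\<bar> \<le> D * (1 + norm x) ^ k"
    using real_polynomial_function_bound[OF p] by blast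
  have "v x \<le> (\<bar>C * v 0\<bar> * D) * (1 + norm x) ^ k" for x
  proof -
    have "v x \<le> (C * v 0) * p x" using C[of 0 x] by simp
    also have "\<dots> \<le> \<bar>C * v 0\<bar> * \<bar>p x\<bar>" using abs_ge_self[of "(C * v 0) * p x"] by (simp add: abs_mult)
    also have "\<dots> \<le> \<bar>C * v 0\<bar> * (D * (1 + norm x) ^ k)" by (intro mult_left_mono D) auto
    finally show ?thesis by (simp add: mult_ac)
  qed
  with D(1) show ?thesis by (intro exI[of _ "\<bar>C * v 0\<bar> * D"] exI[of _ k]) auto
qed

section \<open>Local integrability, and convolution of decaying weights with a bump\<close>

lemma integrable_imp_locally_integrable:
  "integrable lebesgue h \<Longrightarrow> locally_integrable h"
  unfolding locally_integrable_def set_integrable_def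
  by (auto intro!: integrable_mult_indicator lmeasurable_compact[THEN fmeasurableD])

lemma locally_integrable_bound:
  assumes g: "locally_integrable g" and f: "f \<in> borel_measurable lebesgue" and le: "\<And>x. norm (f x) \<le> C * norm (g x)"
  shows "locally_integrable f"
  unfolding locally_integrable_def
proof (intro conjI f allI impI)
  fix K :: "(real ^ 'a) set" assume K: "compact K"
  then have "set_integrable lebesgue K (\<lambda>x. of_real C * g x)"
    using g by (auto simp: locally_integrable_def)
  then show "set_integrable lebesgue K f"
    unfolding set_integrable_def
  proof (rule Bochner_Integration.integrable_bound)
    show "(\<lambda>x. indicat_real K x *\<^sub>R f x) \<in> borel_measurable lebesgue"
      using K f by (intro borel_measurable_scaleR borel_measurable_indicator lmeasurable_compact[THEN fmeasurableD])
    show "AE x in lebesgue. norm (indicat_real K x *\<^sub>R f x) \<le> norm (indicat_real K x *\<^sub>R (of_real C * g x))"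
    proof (intro AE_I2)
      fix x
      have "norm (f x) \<le> \<bar>C\<bar> * norm (g x)"
        using order_trans[OF le mult_right_mono[OF abs_ge_self norm_ge_zero]] .
      then show "norm (indicat_real K x *\<^sub>R f x) \<le> norm (indicat_real K x *\<^sub>R (of_real C * g x))"
        by (simp add: norm_mult mult_left_mono)
    qed
  qed
qed

text \<open>Prepares the exchange of integrals for the completed measure, elements of a BF-space
  being only Lebesgue measurable.\<close>

lemma sigma_finite_lebesgue: "sigma_finite_measure (lebesgue :: 'a::euclidean_space measure)"
proof
  show "\<exists>A :: 'a set set. countable A \<and> A \<subseteq> sets lebesgue \<and> \<Union>A = space lebesgue \<and> (\<forall>a\<in>A. emeasure lebesgue a \<noteq> \<infinity>)"
  proof (intro exI[of _ "range (\<lambda>n. cball (0::'a) (real n))"] conjI ballI)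
    show "\<Union>(range (\<lambda>n. cball (0::'a) (real n))) = space lebesgue"
      using real_arch_simple by auto
    show "emeasure lebesgue a \<noteq> \<infinity>" if "a \<in> range (\<lambda>n. cball (0::'a) (real n))" for a
      using that lmeasurable_cball[THEN fmeasurableD2] by fastforce
  qed auto
qed

lemma bump_function:
  "\<exists>\<kappa>\<in>test_fns. \<exists>r :: real ^ 'd::finite \<Rightarrow> real. \<exists>B. \<kappa> = (\<lambda>x. complex_of_real (r x)) \<and> (\<forall>x. 0 \<le> r x \<and> r x \<le> 1) \<and>
     (\<forall>x. norm x \<le> 1 \<longrightarrow> r x = 1) \<and> (\<forall>\<alpha> x. norm (partials \<alpha> \<kappa> x) \<le> B \<alpha>)"
proof -
  \<comment> \<open>With \<delta> = 2 the plateau, of radius \<delta> / 2, is the unit ball; any one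
    member of the family of cutoffs serves.\<close>
  have "(0::real) < 2" by simp
  from hoermander_cutoffs[OF this, of "0 :: real ^ 'd"] obtain B and \<kappa> :: "'d fn" where \<kappa>: "\<kappa> \<in> test_fns"
    "\<And>x. norm (x - 0) \<le> 2 / 2 \<Longrightarrow> \<kappa> x = 1" "\<And>x. \<exists>r. 0 \<le> r \<and> r \<le> 1 \<and> \<kappa> x = complex_of_real r"
    "\<And>\<alpha> x. norm (partials \<alpha> \<kappa> x) \<le> B \<alpha>" by (metis order_refl)
  from \<kappa>(3) obtain r where r: "\<And>x. 0 \<le> r x \<and> r x \<le> 1 \<and> \<kappa> x = complex_of_real (r x)" by metis
  then have "r x = 1" if "norm x \<le> 1" for x using \<kappa>(2)[of x] that by simp
  with \<kappa> r show ?thesis by (intro bexI[of _ \<kappa>] exI[of _ r] exI[of _ B]) auto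
qed

lemma decay_le_shift:
  fixes x y :: "'a::real_normed_vector"
  assumes "norm (x - y) \<le> 1"
  shows "1 / 2 ^ n / (1 + norm x) ^ n \<le> 1 / (1 + norm y) ^ n"
proof -
  have "norm y \<le> norm x + norm (x - y)" using norm_triangle_sub[of y x] by (simp add: norm_minus_commute)
  then have "1 + norm y \<le> 2 + 2 * norm x" using assms norm_ge_zero[of x] by linarith
  then have "1 + norm y \<le> 2 * (1 + norm x)" by simp
  then have "(1 + norm y) ^ n \<le> (2 * (1 + norm x)) ^ n" by (intro power_mono) auto
  then have "1 / (2 * (1 + norm x)) ^ n \<le> 1 / (1 + norm y) ^ n"
    using one_plus_norm_pos[of y n] one_plus_norm_pos[of x n]
    by (intro divide_left_mono mult_pos_pos) (auto simp only: power_mult_distrib zero_less_mult_iff zero_less_power zero_less_numeral)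
  then show ?thesis by (simp only: power_mult_distrib divide_divide_eq_left)
qed

text \<open>On the unit ball around x the bump is 1 and the weight at y is at least 2^(-n) times the
  weight at x; \<mu> is the volume of the unit ball. Convolution with a bump thus does not improve
  the order of decay.\<close>

lemma convolve_decay_ge:
  fixes r :: "real ^ 'd::finite \<Rightarrow> real"
  assumes r: "r \<in> borel_measurable borel" "\<And>x. 0 \<le> r x \<and> r x \<le> 1" "\<And>x. norm x \<le> 1 \<Longrightarrow> r x = 1"
    and n: "2 * CARD('d) \<le> n"
  shows "integrable lebesgue (\<lambda>y. 1 / (1 + norm y) ^ n * r (x - y))"
    and "\<exists>c>0. \<forall>x. c / (1 + norm x) ^ n \<le> (LINT y|lebesgue. 1 / (1 + norm y) ^ n * r (x - y))"
proof -
  have I: "integrable lebesgue (\<lambda>y. 1 / (1 + norm y) ^ n * r (x - y))" for x :: "real ^ 'd"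
  proof (rule Bochner_Integration.integrable_bound[OF integrable_decay[OF n]])
    show "(\<lambda>y. 1 / (1 + norm y) ^ n * r (x - y)) \<in> borel_measurable lebesgue"
      by (intro borel_imp_lebesgue borel_measurable_times measurable_compose[OF _ r(1)]) simp_all
    show "AE y in lebesgue. norm (1 / (1 + norm y) ^ n * r (x - y)) \<le> norm (1 / (1 + norm y) ^ n)"
      using r(2) by (auto simp: norm_mult mult_left_le divide_right_mono)
  qed
  then show "integrable lebesgue (\<lambda>y. 1 / (1 + norm y) ^ n * r (x - y))" .
  define \<mu> where "\<mu> = measure lebesgue (cball (0 :: real ^ 'd) 1)"
  have \<mu>: "0 < \<mu>" unfolding \<mu>_def by (simp add: content_cball_pos measure_completion)
  have "(\<mu> / 2 ^ n) / (1 + norm x) ^ n \<le> (LINT y|lebesgue. 1 / (1 + norm y) ^ n * r (x - y))" for x :: "real ^ 'd"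
  proof -
    have ms: "measure lebesgue (cball x 1) = \<mu>"
    proof -
      have "cball x 1 = (+) x ` cball 0 1" by (simp add: cball_translation)
      then show ?thesis by (simp only: measure_translation \<mu>_def)
    qed
    have "(\<mu> / 2 ^ n) / (1 + norm x) ^ n = (LINT y|lebesgue. indicator (cball x 1) y *\<^sub>R (1 / 2 ^ n / (1 + norm x) ^ n))"
      by (simp add: ms)
    also have "\<dots> \<le> (LINT y|lebesgue. 1 / (1 + norm y) ^ n * r (x - y))"
    proof (rule integral_mono[OF _ I])
      show "integrable lebesgue (\<lambda>y. indicator (cball x 1) y *\<^sub>R (1 / 2 ^ n / (1 + norm x) ^ n))"
        using emeasure_lborel_cball_finite[of x 1]
        by (intro integrable_scaleR_left) (simp add: integrable_indicator_iff)
      fix y :: "real ^ 'd"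
      show "indicator (cball x 1) y *\<^sub>R (1 / 2 ^ n / (1 + norm x) ^ n) \<le> 1 / (1 + norm y) ^ n * r (x - y)"
      proof (cases "y \<in> cball x 1")
        case True
        then have "norm (x - y) \<le> 1" by (simp add: dist_norm)
        with decay_le_shift[OF this, of n] r(3)[OF this] show ?thesis by (simp add: indicator_simps(1)[OF True])
      next
        case False
        then show ?thesis using r(2)[of "x - y"] one_plus_norm_pos[of y n] by simp
      qed
    qed
    finally show ?thesis .
  qed
  then show "\<exists>c>0. \<forall>x. c / (1 + norm x) ^ n \<le> (LINT y|lebesgue. 1 / (1 + norm y) ^ n * r (x - y))"
    using \<mu> by (intro exI[of _ "\<mu> / 2 ^ n"]) auto
qed

section \<open>Consequences of the axioms of a BF-space\<close>

lemma BF_space_cmult: "translation_invariant_BF_space v B nrm \<Longrightarrow> f \<in> B \<Longrightarrow> (\<lambda>x. c * f x) \<in> B"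
  by (simp add: translation_invariant_BF_space_def banach_function_space_def)

lemma BF_space_add: "translation_invariant_BF_space v B nrm \<Longrightarrow> f \<in> B \<Longrightarrow> g \<in> B \<Longrightarrow> (\<lambda>x. f x + g x) \<in> B"
  by (simp add: translation_invariant_BF_space_def banach_function_space_def)

lemma BF_space_nonneg: "translation_invariant_BF_space v B nrm \<Longrightarrow> f \<in> B \<Longrightarrow> 0 \<le> nrm f"
  by (simp add: translation_invariant_BF_space_def banach_function_space_def)

lemma BF_space_measurable: "translation_invariant_BF_space v B nrm \<Longrightarrow> f \<in> B \<Longrightarrow> f \<in> borel_measurable lebesgue"
  by (auto simp: translation_invariant_BF_space_def banach_function_space_def)

lemma BF_space_tempered:
  "translation_invariant_BF_space v B nrm \<Longrightarrow> f \<in> B \<Longrightarrow> \<exists>u. tempered_distribution u \<and> is_function u f"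
  by (auto simp: translation_invariant_BF_space_def embeds_tempered_def)

lemma BF_space_locally_integrable: "translation_invariant_BF_space v B nrm \<Longrightarrow> f \<in> B \<Longrightarrow> locally_integrable f"
  using BF_space_tempered by (fastforce simp: is_function_def)

text \<open>Solidity with a constant. The axiom presupposes local integrability of both functions;
  here that of f follows from the domination.\<close>

lemma BF_space_solid:
  assumes "translation_invariant_BF_space v B nrm" "g \<in> B" "f \<in> borel_measurable lebesgue" "\<And>x. norm (f x) \<le> C * norm (g x)"
  shows "f \<in> B"
proof -
  have g: "(\<lambda>x. of_real C * g x) \<in> B" by (rule BF_space_cmult[OF assms(1,2)])
  have lf: "locally_integrable f"
    by (rule locally_integrable_bound[OF BF_space_locally_integrable[OF assms(1,2)] assms(3,4)])
  have "AE x in lebesgue. norm (f x) \<le> norm (of_real C * g x)"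
  proof (intro AE_I2)
    fix x
    have "norm (f x) \<le> \<bar>C\<bar> * norm (g x)"
      using order_trans[OF assms(4) mult_right_mono[OF abs_ge_self norm_ge_zero]] .
    then show "norm (f x) \<le> norm (of_real C * g x)" by (simp add: norm_mult)
  qed
  with g lf BF_space_locally_integrable[OF assms(1) g] assms(1) show ?thesis
    unfolding translation_invariant_BF_space_def by blast
qed

lemma BF_space_translate:
  assumes "translation_invariant_BF_space v B nrm"
  shows "\<exists>C. \<forall>x. \<forall>f\<in>B. (\<lambda>y. f (y - x)) \<in> B \<and> nrm (\<lambda>y. f (y - x)) \<le> C * v x * nrm f"
  using assms unfolding translation_invariant_BF_space_def by blast

lemma BF_space_convolve:
  "translation_invariant_BF_space v B nrm \<Longrightarrow> f \<in> B \<Longrightarrow> \<phi> \<in> weighted_L1 v \<Longrightarrow> convolve \<phi> f \<in> B"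
  unfolding translation_invariant_BF_space_def by blast

lemma BF_space_weight:
  assumes "translation_invariant_BF_space v B nrm"
  shows "\<exists>C k. 0 \<le> C \<and> (\<forall>x. v x \<le> C * (1 + norm x) ^ k)" "v \<in> borel_measurable lebesgue" "0 < v x" "v (- x) = v x"
  using assms poly_moderate_weight_bound
  by (auto simp: translation_invariant_BF_space_def submultiplicative_weight_def moderate_def weight_def)

text \<open>Continuity of the embedding into the strong dual, tested on the bounded set consisting
  of \<phi> alone.\<close>

lemma BF_space_pairing_bound:
  assumes "translation_invariant_BF_space v B nrm" and \<phi>: "\<phi> \<in> test_fns"
  shows "\<exists>C. \<forall>f\<in>B. norm (LINT x|lebesgue. f x * \<phi> x) \<le> C * nrm f"
proof -
  have "bounded_schwartz {\<phi>}" using test_schwartz[OF \<phi>] by (auto simp: bounded_schwartz_def)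
  moreover have "embeds_tempered B nrm"
    using assms(1) by (auto simp: translation_invariant_BF_space_def)
  ultimately obtain C where C: "\<And>f u. f \<in> B \<Longrightarrow> tempered_distribution u \<Longrightarrow> is_function u f \<Longrightarrow> norm (u \<phi>) \<le> C * nrm f"
    unfolding embeds_tempered_def by (metis insertI1)
  have "norm (LINT x|lebesgue. f x * \<phi> x) \<le> C * nrm f" if f: "f \<in> B" for f
  proof -
    obtain u where u: "tempered_distribution u" "is_function u f"
      using BF_space_tempered[OF assms(1) f] by blast
    have "u \<phi> = (LINT x|lebesgue. f x * \<phi> x)" using u(2) \<phi> by (simp add: is_function_def)
    with C[OF f u] show ?thesis by simp
  qed
  then show ?thesis by blast
qed

lemma weighted_L1_decay:
  fixes v :: "real ^ 'd::finite \<Rightarrow> real"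
  assumes v: "v \<in> borel_measurable lebesgue" "\<And>x. 0 < v x" "0 \<le> C" "\<And>x. v x \<le> C * (1 + norm x) ^ k"
    and h: "h \<in> borel_measurable lebesgue" "\<And>x. norm (h x) \<le> K / (1 + norm x) ^ (k + 2 * CARD('d))"
  shows "h \<in> weighted_L1 v"
proof -
  have "integrable lebesgue h" by (rule integrable_decayI[OF h]) simp
  moreover have "integrable lebesgue (\<lambda>x. h x * complex_of_real (v x))"
  proof (rule integrable_decayI[where k = "2 * CARD('d)" and C = "K * C"])
    show "(\<lambda>x. h x * complex_of_real (v x)) \<in> borel_measurable lebesgue" using h(1) v(1) by measurable
    fix x
    have "norm (h x * complex_of_real (v x)) = norm (h x) * v x" using v(2)[of x] by (simp add: norm_mult)
    also have "\<dots> \<le> K / (1 + norm x) ^ (k + 2 * CARD('d)) * (C * (1 + norm x) ^ k)"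
      using v(2)[of x] by (intro mult_mono h v order_trans[OF norm_ge_zero h(2)]) auto
    also have "\<dots> = K * C / (1 + norm x) ^ (2 * CARD('d))"
      using one_plus_norm_pos[of x k] by (simp add: power_add field_simps)
    finally show "norm (h x * complex_of_real (v x)) \<le> K * C / (1 + norm x) ^ (2 * CARD('d))" .
  qed simp
  ultimately show ?thesis by (simp add: weighted_L1_def integrable_imp_locally_integrable)
qed

text \<open>Solidity requires a member of B that decays no faster than the given order. Convolving
  the decaying weight, which lies in the weighted L^1 space, with a bump in B provides one.\<close>

lemma BF_space_decay_mem:
  fixes B :: "'d::finite fn set"
  assumes BF: "translation_invariant_BF_space v B nrm"
  shows "\<exists>n. \<forall>f\<in>borel_measurable lebesgue. \<forall>K. (\<forall>x. norm (f x) \<le> K / (1 + norm x) ^ n) \<longrightarrow> f \<in> B"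
proof -
  obtain C k where C: "0 \<le> C" "\<And>x. v x \<le> C * (1 + norm x) ^ k" using BF_space_weight(1)[OF BF] by blast
  \<comment> \<open>The k powers outweigh the growth of v, the remaining ones leave an integrable
    function.\<close>
  define n where "n = k + 2 * CARD('d)"
  obtain \<kappa> r where \<kappa>: "\<kappa> \<in> test_fns" "\<kappa> = (\<lambda>x :: real ^ 'd. complex_of_real (r x))" and r: "\<And>x. 0 \<le> r x \<and> r x \<le> 1"
     "\<And>x. norm x \<le> 1 \<Longrightarrow> r x = 1"
    using bump_function by blast
  have "(\<lambda>x. Re (\<kappa> x)) \<in> borel_measurable borel"
    using smooth_borel[OF test_smooth[OF \<kappa>(1)]] by measurable
  then have rm: "r \<in> borel_measurable borel" by (simp add: \<kappa>(2))
  let ?h = "\<lambda>x :: real ^ 'd. complex_of_real (1 / (1 + norm x) ^ n)"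
  have hL: "?h \<in> weighted_L1 v"
  proof (rule weighted_L1_decay[OF BF_space_weight(2,3)[OF BF] C, where K = 1])
    show "?h \<in> borel_measurable lebesgue" by (intro borel_imp_lebesgue) simp
    show "norm (?h x) \<le> 1 / (1 + norm x) ^ (k + 2 * CARD('d))" for x
      by (simp only: norm_of_real) (simp add: n_def abs_of_pos one_plus_norm_pos)
  qed
  have "\<kappa> \<in> B"
    using BF test_schwartz[OF \<kappa>(1)] unfolding translation_invariant_BF_space_def schwartz_embeds_def by blast
  then have conv: "convolve ?h \<kappa> \<in> B" by (rule BF_space_convolve[OF BF _ hL])
  have "2 * CARD('d) \<le> n" by (simp add: n_def)
  from convolve_decay_ge(2)[OF rm r this] obtain c where c: "0 < c"
    "\<And>x. c / (1 + norm x) ^ n \<le> (LINT y|lebesgue. 1 / (1 + norm y) ^ n * r (x - y))" by blast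
  have convolve_ge: "c / (1 + norm x) ^ n \<le> norm (convolve ?h \<kappa> x)" for x
  proof -
    have eq: "convolve ?h \<kappa> x = complex_of_real (LINT y|lebesgue. 1 / (1 + norm y) ^ n * r (x - y))"
      unfolding convolve_def \<kappa>(2) integral_complex_of_real[symmetric] of_real_mult ..
    show ?thesis unfolding eq norm_of_real by (rule order_trans[OF c(2) abs_ge_self])
  qed
  have "f \<in> B" if f: "f \<in> borel_measurable lebesgue" and K: "\<And>x. norm (f x) \<le> K / (1 + norm x) ^ n" for f K
  proof (rule BF_space_solid[OF BF conv f, where C = "K / c"])
    fix x :: "real ^ 'd"
    have "0 \<le> K / (1 + norm x) ^ n" using order_trans[OF norm_ge_zero K] .
    then have "0 \<le> K" using one_plus_norm_pos[of x n] by (simp add: zero_le_divide_iff not_less)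
    then have "K / c * (c / (1 + norm x) ^ n) \<le> K / c * norm (convolve ?h \<kappa> x)"
      using c(1) by (intro mult_left_mono convolve_ge) auto
    with K[of x] c(1) show "norm (f x) \<le> K / c * norm (convolve ?h \<kappa> x)" by simp
  qed
  then show ?thesis by blast
qed

text \<open>Testing translates of |b| with a bump shows that the mass of b near y is at most a
  multiple of v(y), hence of polynomial growth. This is integrated against a decaying weight; after
  exchanging the integrals, the lower bound for the convolution of weight and bump gives the
  claim.\<close>

lemma BF_space_integrable_decay:
  fixes B :: "'d::finite fn set"
  assumes BF: "translation_invariant_BF_space v B nrm" and b: "b \<in> B"
  shows "\<exists>n. integrable lebesgue (\<lambda>x. norm (b x) * (1 / (1 + norm x) ^ n))"
proof -
  obtain C k where C: "0 \<le> C" "\<And>x. v x \<le> C * (1 + norm x) ^ k" using BF_space_weight(1)[OF BF] by blast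
  define n where "n = k + 2 * CARD('d)"
  obtain \<kappa> r where \<kappa>: "\<kappa> \<in> test_fns" "\<kappa> = (\<lambda>x :: real ^ 'd. complex_of_real (r x))" and r: "\<And>x. 0 \<le> r x \<and> r x \<le> 1"
     "\<And>x. norm x \<le> 1 \<Longrightarrow> r x = 1"
    using bump_function by blast
  have "(\<lambda>x. Re (\<kappa> x)) \<in> borel_measurable borel"
    using smooth_borel[OF test_smooth[OF \<kappa>(1)]] by measurable
  then have rm: "r \<in> borel_measurable borel" by (simp add: \<kappa>(2))
  have bm: "b \<in> borel_measurable lebesgue" by (rule BF_space_measurable[OF BF b])
  have nbm: "(\<lambda>x. norm (b x)) \<in> borel_measurable lebesgue" using bm by measurable
  \<comment> \<open>Passing to the modulus, which solidity allows, turns the bound for a pairing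
    into a bound for the integral of |b|.\<close>
  define b' where "b' x = complex_of_real (norm (b x))" for x
  have b'm: "b' \<in> borel_measurable lebesgue" unfolding b'_def using bm by measurable
  have b': "b' \<in> B"
    by (rule BF_space_solid[OF BF b b'm, where C = 1]) (simp add: b'_def)
  have b'l: "locally_integrable b'" by (rule BF_space_locally_integrable[OF BF b'])
  obtain D where D: "\<And>x f. f \<in> B \<Longrightarrow> (\<lambda>y. f (y - x)) \<in> B \<and> nrm (\<lambda>y. f (y - x)) \<le> D * v x * nrm f"
    using BF_space_translate[OF BF] by blast
  obtain E where E: "\<And>f. f \<in> B \<Longrightarrow> norm (LINT x|lebesgue. f x * \<kappa> x) \<le> E * nrm f"
    using BF_space_pairing_bound[OF BF \<kappa>(1)] by blast
  define L where "L = \<bar>E\<bar> * (\<bar>D\<bar> * nrm b')"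
  have L0: "0 \<le> L" using BF_space_nonneg[OF BF b'] by (simp add: L_def)
  have loc: "integrable lebesgue (\<lambda>x. norm (b x) * r (x - y))"
    "(LINT x|lebesgue. norm (b x) * r (x - y)) \<le> L * v y" for y
  proof -
    let ?f = "\<lambda>x. norm (b x) * r (x - y)"
    have fm: "?f \<in> borel_measurable lebesgue"
      by (intro borel_measurable_times nbm borel_imp_lebesgue[OF measurable_compose[OF _ rm]]) simp
    have shift: "(\<lambda>x. ?f (y + 1 *\<^sub>R x)) = (\<lambda>x. norm (b (x - (- y))) * r x)" by (simp add: add.commute)
    let ?g = "\<lambda>x. b' (x - (- y))"
    have g: "?g \<in> B" "nrm ?g \<le> D * v (- y) * nrm b'" using D[OF b'] by blast+
    have "compact (supp \<kappa>)" using \<kappa>(1) by (simp add: test_fns_def)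
    then have "set_integrable lebesgue (supp \<kappa>) ?g"
      using BF_space_locally_integrable[OF BF g(1)] by (auto simp: locally_integrable_def)
    then have I: "integrable lebesgue (\<lambda>x. norm (b (x - (- y))) * r x)"
      unfolding set_integrable_def
    proof (rule Bochner_Integration.integrable_bound)
      show "(\<lambda>x. norm (b (x - (- y))) * r x) \<in> borel_measurable lebesgue"
        using borel_measurable_lebesgue_affine[OF fm, of 1 y] unfolding shift by simp
      show "AE x in lebesgue. norm (norm (b (x - (- y))) * r x) \<le> norm (indicat_real (supp \<kappa>) x *\<^sub>R ?g x)"
      proof (intro AE_I2)
        fix x
        show "norm (norm (b (x - (- y))) * r x) \<le> norm (indicat_real (supp \<kappa>) x *\<^sub>R ?g x)"
        proof (cases "x \<in> supp \<kappa>")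
          case True
          then show ?thesis using r(1)[of x] by (simp add: b'_def mult_left_le)
        next
          case False
          then have "r x = 0" using in_supp[of \<kappa> x] by (auto simp: \<kappa>(2))
          then show ?thesis by simp
        qed
      qed
    qed
    then show "integrable lebesgue ?f"
      using integrable_lebesgue_affine[OF fm, of 1 y] unfolding shift by simp
    have "complex_of_real (LINT x|lebesgue. ?f x) = complex_of_real (LINT x|lebesgue. norm (b (x - (- y))) * r x)"
      using integral_lebesgue_affine[OF fm, of 1 y] unfolding shift by simp
    also have "\<dots> = (LINT x|lebesgue. ?g x * \<kappa> x)"
      unfolding integral_complex_of_real[symmetric] of_real_mult b'_def \<kappa>(2) ..
    finally have eq: "complex_of_real (LINT x|lebesgue. ?f x) = (LINT x|lebesgue. ?g x * \<kappa> x)" .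
    have "\<bar>LINT x|lebesgue. ?f x\<bar> = norm (LINT x|lebesgue. ?g x * \<kappa> x)"
      unfolding eq[symmetric] norm_of_real ..
    also have "\<dots> \<le> \<bar>E\<bar> * nrm ?g"
      using order_trans[OF E[OF g(1)] mult_right_mono[OF abs_ge_self BF_space_nonneg[OF BF g(1)]]] .
    also have "\<dots> \<le> \<bar>E\<bar> * (\<bar>D\<bar> * v y * nrm b')"
    proof (intro mult_left_mono)
      have "D * v (- y) * nrm b' \<le> \<bar>D\<bar> * v y * nrm b'"
        using BF_space_weight(3,4)[OF BF] BF_space_nonneg[OF BF b'] by (simp add: mult_right_mono less_imp_le)
      with g(2) show "nrm ?g \<le> \<bar>D\<bar> * v y * nrm b'" by simp
    qed simp
    also have "\<dots> = L * v y" by (simp add: L_def mult_ac)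
    finally show "(LINT x|lebesgue. ?f x) \<le> L * v y" by simp
  qed
  let ?h = "\<lambda>y :: real ^ 'd. 1 / (1 + norm y) ^ n"
  have hpos: "0 < ?h y" for y by (simp add: one_plus_norm_pos)
  have n2: "2 * CARD('d) \<le> n" by (simp add: n_def)
  obtain c where c: "0 < c" "\<And>x. c / (1 + norm x) ^ n \<le> (LINT y|lebesgue. ?h y * r (x - y))"
    using convolve_decay_ge(2)[OF rm r n2] by blast
  interpret L: sigma_finite_measure "lebesgue :: (real ^ 'd) measure" by (rule sigma_finite_lebesgue)
  interpret pair_sigma_finite "lebesgue :: (real ^ 'd) measure" "lebesgue :: (real ^ 'd) measure" ..
  \<comment> \<open>With nonnegative extended integrals the order can be exchanged before anything
    is known to be finite.\<close>
  let ?F = "\<lambda>x y. ennreal (norm (b x) * (?h y * r (x - y)))"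
  have "(\<integral>\<^sup>+x. ennreal (norm (b x) * (c / (1 + norm x) ^ n)) \<partial>lebesgue)
     \<le> (\<integral>\<^sup>+x. (\<integral>\<^sup>+y. ?F x y \<partial>lebesgue) \<partial>lebesgue)"
  proof (rule nn_integral_mono)
    fix x :: "real ^ 'd"
    have "(\<integral>\<^sup>+y. ?F x y \<partial>lebesgue) = ennreal (LINT y|lebesgue. norm (b x) * (?h y * r (x - y)))"
    proof (rule nn_integral_eq_integral)
      show "integrable lebesgue (\<lambda>y. norm (b x) * (?h y * r (x - y)))"
        by (intro integrable_mult_right convolve_decay_ge(1)[OF rm r n2])
    qed (use r hpos[THEN less_imp_le] in \<open>auto intro!: mult_nonneg_nonneg\<close>)
    also have "\<dots> = ennreal (norm (b x) * (LINT y|lebesgue. ?h y * r (x - y)))"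
      by (simp only: integral_mult_right_zero)
    finally show "ennreal (norm (b x) * (c / (1 + norm x) ^ n)) \<le> (\<integral>\<^sup>+y. ?F x y \<partial>lebesgue)"
      using c(2)[of x] by (simp only: ennreal_leI mult_left_mono norm_ge_zero)
  qed
  also have "\<dots> = (\<integral>\<^sup>+y. (\<integral>\<^sup>+x. ?F x y \<partial>lebesgue) \<partial>lebesgue)"
  proof (rule Fubini'[symmetric])
    have fst: "fst \<in> (lebesgue \<Otimes>\<^sub>M lebesgue) \<rightarrow>\<^sub>M (borel :: (real ^ 'd) measure)"
      and snd: "snd \<in> (lebesgue \<Otimes>\<^sub>M lebesgue) \<rightarrow>\<^sub>M (borel :: (real ^ 'd) measure)"
      using measurable_compose[OF measurable_fst id_borel_measurable_lebesgue]
        measurable_compose[OF measurable_snd id_borel_measurable_lebesgue] by (simp_all add: id_def)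
    have "(\<lambda>p. norm (b (fst p)) * (?h (snd p) * r (fst p - snd p)))
       \<in> borel_measurable (lebesgue \<Otimes>\<^sub>M lebesgue)"
    proof (intro borel_measurable_times)
      show "(\<lambda>p. norm (b (fst p))) \<in> borel_measurable (lebesgue \<Otimes>\<^sub>M lebesgue)"
        by (rule measurable_compose[OF measurable_fst nbm])
      show "(\<lambda>p. ?h (snd p)) \<in> borel_measurable (lebesgue \<Otimes>\<^sub>M (lebesgue :: (real ^ 'd) measure))"
        by (rule measurable_compose[OF snd]) simp
      show "(\<lambda>p. r (fst p - snd p)) \<in> borel_measurable (lebesgue \<Otimes>\<^sub>M lebesgue)"
        by (intro measurable_compose[OF _ rm] borel_measurable_diff fst snd)
    qed
    then show "case_prod ?F \<in> borel_measurable (lebesgue \<Otimes>\<^sub>M lebesgue)"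
      unfolding case_prod_beta' by (rule measurable_compose[OF _ measurable_ennreal])
  qed
  also have "\<dots> \<le> (\<integral>\<^sup>+y. ennreal (L * C / (1 + norm y) ^ (2 * CARD('d))) \<partial>(lebesgue :: (real ^ 'd) measure))"
  proof (rule nn_integral_mono)
    fix y :: "real ^ 'd"
    have eq: "norm (b x) * (?h y * r (x - y)) = ?h y * (norm (b x) * r (x - y))" for x by simp
    have "(\<integral>\<^sup>+x. ?F x y \<partial>lebesgue) = ennreal (LINT x|lebesgue. ?h y * (norm (b x) * r (x - y)))"
      unfolding eq
    proof (rule nn_integral_eq_integral)
      show "integrable lebesgue (\<lambda>x. ?h y * (norm (b x) * r (x - y)))"
        by (intro integrable_mult_right loc)
    qed (use r hpos[THEN less_imp_le] in \<open>auto intro!: mult_nonneg_nonneg\<close>)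
    also have "\<dots> = ennreal (?h y * (LINT x|lebesgue. norm (b x) * r (x - y)))"
      by (simp only: integral_mult_right_zero)
    also have "\<dots> \<le> ennreal (?h y * (L * (C * (1 + norm y) ^ k)))"
      using hpos[of y] L0 by (intro ennreal_leI mult_left_mono order_trans[OF loc(2)] C) auto
    also have "?h y * (L * (C * (1 + norm y) ^ k)) = L * C / (1 + norm y) ^ (2 * CARD('d))"
      using one_plus_norm_pos[of y k] by (simp add: n_def power_add)
    finally show "(\<integral>\<^sup>+x. ?F x y \<partial>lebesgue) \<le> ennreal (L * C / (1 + norm y) ^ (2 * CARD('d)))" .
  qed
  also have "\<dots> < \<infinity>"
  proof -
    have "integrable lebesgue (\<lambda>y :: real ^ 'd. L * C / (1 + norm y) ^ (2 * CARD('d)))"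
      using integrable_mult_right[OF integrable_decay[where 'd = 'd, OF order_refl], of "L * C"] by simp
    then have "(\<integral>\<^sup>+y. ennreal (norm (L * C / (1 + norm y) ^ (2 * CARD('d)))) \<partial>(lebesgue :: (real ^ 'd) measure)) < \<infinity>"
      unfolding integrable_iff_bounded by (rule conjunct2)
    moreover have "\<bar>L * C\<bar> = L * C" using L0 C(1) by simp
    ultimately show ?thesis by simp
  qed
  finally have fin: "(\<integral>\<^sup>+x. ennreal (norm (b x) * (c / (1 + norm x) ^ n)) \<partial>lebesgue) < \<infinity>" .
  have "integrable lebesgue (\<lambda>x. norm (b x) * (c / (1 + norm x) ^ n))"
  proof (rule integrableI_bounded)
    show "(\<lambda>x. norm (b x) * (c / (1 + norm x) ^ n)) \<in> borel_measurable lebesgue"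
      by (intro borel_measurable_times nbm borel_imp_lebesgue) simp
    have eq: "norm (norm (b x) * (c / (1 + norm x) ^ n)) = norm (b x) * (c / (1 + norm x) ^ n)" for x
      using c(1) one_plus_norm_pos[of x n] by (simp add: abs_of_nonneg)
    show "(\<integral>\<^sup>+x. ennreal (norm (norm (b x) * (c / (1 + norm x) ^ n))) \<partial>lebesgue) < \<infinity>"
      unfolding eq by (rule fin)
  qed
  from integrable_mult_right[OF this, of "1 / c"] c(1) show ?thesis
    by (intro exI[of _ n]) (simp add: mult_ac)
qed

section \<open>Distributions given by elements of a BF-space\<close>

lemma linear_functional_on_add:
  "linear_functional_on V u \<Longrightarrow> \<phi> \<in> V \<Longrightarrow> \<psi> \<in> V \<Longrightarrow> u (\<lambda>x. \<phi> x + \<psi> x) = u \<phi> + u \<psi>"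
  by (simp add: linear_functional_on_def)

lemma linear_functional_on_cmult:
  "linear_functional_on V u \<Longrightarrow> \<phi> \<in> V \<Longrightarrow> u (\<lambda>x. c * \<phi> x) = c * u \<phi>"
  by (simp add: linear_functional_on_def)

lemma linear_functional_on_diff:
  assumes L: "linear_functional_on V u" and "\<phi> \<in> V" "\<psi> \<in> V" "(\<lambda>x. - 1 * \<psi> x) \<in> V"
  shows "u (\<lambda>x. \<phi> x - \<psi> x) = u \<phi> - u \<psi>"
  using linear_functional_on_add[OF L assms(2,4)] linear_functional_on_cmult[OF L assms(3), of "- 1"] by simp

lemma schwartz_cmult: "\<phi> \<in> schwartz_fns \<Longrightarrow> (\<lambda>x. c * \<phi> x) \<in> schwartz_fns"
proof (rule schwartzI)
  assume \<phi>: "\<phi> \<in> schwartz_fns"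
  then show "(\<lambda>x. c * \<phi> x) \<in> smooth_fns" by (intro smooth_cmult schwartz_smooth)
  fix \<alpha> k
  obtain C where C: "\<And>x. (1 + norm x) ^ k * norm (partials \<alpha> \<phi> x) \<le> C" using schwartz_bound[OF \<phi>] by blast
  have "(1 + norm x) ^ k * norm (partials \<alpha> (\<lambda>x. c * \<phi> x) x) \<le> norm c * C" for x
    using mult_left_mono[OF C[of x], of "norm c"]
    by (simp add: partials_cmult[OF schwartz_smooth[OF \<phi>]] norm_mult mult_ac)
  then show "\<exists>C. \<forall>x. (1 + norm x) ^ k * norm (partials \<alpha> (\<lambda>x. c * \<phi> x) x) \<le> C" by blast
qed

lemma schwartz_reflect: "\<phi> \<in> schwartz_fns \<Longrightarrow> (\<lambda>x. \<phi> (- x)) \<in> schwartz_fns"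
proof (rule schwartzI)
  assume \<phi>: "\<phi> \<in> schwartz_fns"
  show "(\<lambda>x. \<phi> (- x)) \<in> smooth_fns" using smooth_scale[OF schwartz_smooth[OF \<phi>], of "-1"] by simp
  fix \<alpha> k
  obtain C where C: "\<And>x. (1 + norm x) ^ k * norm (partials \<alpha> \<phi> x) \<le> C" using schwartz_bound[OF \<phi>] by blast
  have "(1 + norm x) ^ k * norm (partials \<alpha> (\<lambda>x. \<phi> (- x)) x) \<le> C" for x
    using C[of "- x"] partials_scale[OF schwartz_smooth[OF \<phi>], of \<alpha> "-1"] by simp
  then show "\<exists>C. \<forall>x. (1 + norm x) ^ k * norm (partials \<alpha> (\<lambda>x. \<phi> (- x)) x) \<le> C" by blast
qed

lemma schwartz_diff:
  assumes \<phi>: "\<phi> \<in> schwartz_fns" and \<psi>: "\<psi> \<in> schwartz_fns"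
  shows "(\<lambda>x. \<phi> x - \<psi> x) \<in> schwartz_fns"
proof (rule schwartzI)
  show "(\<lambda>x. \<phi> x - \<psi> x) \<in> smooth_fns" by (intro smooth_diff schwartz_smooth assms)
  fix \<alpha> k
  obtain C1 C2 where C: "\<And>x. (1 + norm x) ^ k * norm (partials \<alpha> \<phi> x) \<le> C1"
    "\<And>x. (1 + norm x) ^ k * norm (partials \<alpha> \<psi> x) \<le> C2"
    using schwartz_bound[OF \<phi>, of k \<alpha>] schwartz_bound[OF \<psi>, of k \<alpha>] by blast
  have "(1 + norm x) ^ k * norm (partials \<alpha> (\<lambda>x. \<phi> x - \<psi> x) x) \<le> C1 + C2" for x
  proof -
    have "(1 + norm x) ^ k * norm (partials \<alpha> (\<lambda>x. \<phi> x - \<psi> x) x)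
      \<le> (1 + norm x) ^ k * (norm (partials \<alpha> \<phi> x) + norm (partials \<alpha> \<psi> x))"
      unfolding partials_diff[OF schwartz_smooth[OF \<phi>] schwartz_smooth[OF \<psi>]]
      by (intro mult_left_mono norm_triangle_ineq4) auto
    with C[of x] show ?thesis by (simp add: distrib_left)
  qed
  then show "\<exists>C. \<forall>x. (1 + norm x) ^ k * norm (partials \<alpha> (\<lambda>x. \<phi> x - \<psi> x) x) \<le> C" by blast
qed

text \<open>The error of cutting off at distance \<open>N\<close> is supported in \<open>norm x \<ge> N\<close>, where one power of
  decay is gained.\<close>

lemma schwartz_cutoff:
  fixes \<phi> :: "'d::finite fn"
  assumes \<phi>: "\<phi> \<in> schwartz_fns"
  shows "\<exists>\<theta> :: nat \<Rightarrow> 'd fn. (\<forall>N. \<theta> N \<in> test_fns) \<and> (\<forall>N x. norm (\<theta> N x) \<le> norm (\<phi> x)) \<and>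
     (\<forall>x. (\<lambda>N. \<theta> N x) \<longlonglongrightarrow> \<phi> x) \<and> (\<forall>m. (\<lambda>N. schwartz_seminorm m (\<lambda>x. \<theta> N x - \<phi> x)) \<longlonglongrightarrow> 0)"
proof -
  obtain \<kappa> r B where \<kappa>: "\<kappa> \<in> test_fns" "\<kappa> = (\<lambda>x :: real ^ 'd. complex_of_real (r x))" and r: "\<And>x. 0 \<le> r x \<and> r x \<le> 1"
     "\<And>x. norm x \<le> 1 \<Longrightarrow> r x = 1" and B: "\<And>\<alpha> x. norm (partials \<alpha> \<kappa> x) \<le> B \<alpha>"
    using bump_function by blast
  define c where "c N = 1 / real (Suc N)" for N
  have c: "0 < c N" "c N \<le> 1" for N by (auto simp: c_def)
  define \<theta> where "\<theta> N x = \<phi> x * \<kappa> (c N *\<^sub>R x)" for N x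
  \<comment> \<open>The error of the cutoff is \<open>\<phi> x * \<mu> (c N *\<^sub>R x)\<close>, a
    product to which the Leibniz estimate applies.\<close>
  define \<mu> where "\<mu> x = \<kappa> x - 1" for x
  have \<mu>sm: "\<mu> \<in> smooth_fns" unfolding \<mu>_def[abs_def] by (intro smooth_diff test_smooth \<kappa> smooth_const)
  have \<mu>B: "norm (partials \<alpha> \<mu> x) \<le> B \<alpha> + 1" for \<alpha> x
  proof -
    have "partials \<alpha> \<mu> x = partials \<alpha> \<kappa> x - partials \<alpha> (\<lambda>x. 1) x"
      unfolding \<mu>_def[abs_def] by (simp add: partials_diff[OF test_smooth[OF \<kappa>(1)] smooth_const])
    moreover have "norm (partials \<alpha> (\<lambda>x. 1) x) \<le> 1" by (cases "\<alpha> = []") (auto simp: partials_const)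
    ultimately show ?thesis
      using norm_triangle_ineq4[of "partials \<alpha> \<kappa> x" "partials \<alpha> (\<lambda>x. 1) x"] B[of \<alpha> x] by simp
  qed
  have test: "\<theta> N \<in> test_fns" for N
  proof (rule test_fnsI)
    show "\<theta> N \<in> smooth_fns"
      unfolding \<theta>_def[abs_def] by (intro smooth_mult smooth_scale schwartz_smooth \<phi> test_smooth \<kappa>)
    show "compact ((\<lambda>x. (1 / c N) *\<^sub>R x) ` supp \<kappa>)"
      using \<kappa>(1) by (intro compact_scaling) (simp add: test_fns_def)
    fix x assume "\<theta> N x \<noteq> 0"
    then have "c N *\<^sub>R x \<in> supp \<kappa>" by (intro in_supp) (auto simp: \<theta>_def)
    then show "x \<in> (\<lambda>x. (1 / c N) *\<^sub>R x) ` supp \<kappa>"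
      using c(1)[of N] by (intro image_eqI[of _ _ "c N *\<^sub>R x"]) auto
  qed
  have le: "norm (\<theta> N x) \<le> norm (\<phi> x)" for N x
    using r(1)[of "c N *\<^sub>R x"] by (simp add: \<theta>_def \<kappa>(2) norm_mult mult_left_le)
  have lim: "(\<lambda>N. \<theta> N x) \<longlonglongrightarrow> \<phi> x" for x
  proof (rule tendsto_eventually)
    show "\<forall>\<^sub>F N in sequentially. \<theta> N x = \<phi> x"
      using eventually_ge_at_top[of "nat \<lceil>norm x\<rceil>"]
    proof eventually_elim
      case (elim N)
      then have "norm x \<le> real (Suc N)" by linarith
      then have "norm (c N *\<^sub>R x) \<le> 1" by (simp add: c_def field_simps)
      then show ?case using r(2) by (simp add: \<theta>_def \<kappa>(2))
    qed
  qed
  have sem: "(\<lambda>N. schwartz_seminorm m (\<lambda>x. \<theta> N x - \<phi> x)) \<longlonglongrightarrow> 0" for m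
  proof -
    let ?L = "{\<alpha> :: 'd list. length \<alpha> \<le> m}" and ?S = "schwartz_seminorm (Suc m) \<phi>"
    define \<Lambda> where "\<Lambda> = (\<Sum>\<beta>\<in>?L. B \<beta> + 1)"
    have B0: "0 \<le> B \<beta>" for \<beta> using order_trans[OF norm_ge_zero B] .
    have \<Lambda>: "B \<beta> + 1 \<le> \<Lambda>" if "\<beta> \<in> ?L" for \<beta>
      unfolding \<Lambda>_def using that B0 by (intro member_le_sum[where f = "\<lambda>\<beta>. B \<beta> + 1"] finite_lists_le) (auto intro: add_nonneg_nonneg)
    have \<Lambda>0: "0 \<le> \<Lambda>" using \<Lambda>[of "[]"] B0[of "[]"] by simp
    have S0: "0 \<le> ?S" by (rule schwartz_seminorm_nonneg[OF \<phi>])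
    have eq: "(\<lambda>x. \<theta> N x - \<phi> x) = (\<lambda>x. \<phi> x * \<mu> (c N *\<^sub>R x))" for N
      by (simp add: \<theta>_def \<mu>_def algebra_simps)
    have bound: "(1 + norm x) ^ m * norm (partials \<alpha> (\<lambda>x. \<theta> N x - \<phi> x) x) \<le> 2 ^ m * ?S * \<Lambda> * c N"
      if \<alpha>: "length \<alpha> \<le> m" for \<alpha> x N
    proof (cases "norm x < real (Suc N)")
      case True
      have "partials \<alpha> (\<lambda>x. \<theta> N x - \<phi> x) x = partials \<alpha> (\<lambda>x. 0) x"
      proof (rule partials_eq_on_open[of "ball 0 (real (Suc N))"])
        show "\<theta> N y - \<phi> y = 0" if "y \<in> ball 0 (real (Suc N))" for y
        proof -
          have "norm (c N *\<^sub>R y) \<le> 1" using that by (simp add: c_def field_simps)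
          then show ?thesis using r(2) by (simp add: \<theta>_def \<kappa>(2))
        qed
      qed (use True in auto)
      also have "\<dots> = 0" by (cases "\<alpha> = []") (auto simp: partials_const)
      finally show ?thesis using S0 \<Lambda>0 c(1)[of N] by simp
    next
      case False
      have pos: "0 < (1 + norm x) ^ Suc m" by (rule one_plus_norm_pos)
      have "norm (partials \<alpha> (\<lambda>x. \<phi> x * \<mu> (c N *\<^sub>R x)) x) \<le> 2 ^ length \<alpha> * (?S / (1 + norm x) ^ Suc m * \<Lambda>)"
      proof (intro norm_partials_mult_le schwartz_smooth[OF \<phi>] smooth_scale[OF \<mu>sm])
        fix \<beta> :: "'d list" assume \<beta>: "length \<beta> \<le> length \<alpha>"
        show "norm (partials \<beta> \<phi> x) \<le> ?S / (1 + norm x) ^ Suc m"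
          using le_schwartz_seminorm[OF \<phi>, of \<beta> "Suc m" "Suc m" x] \<beta> \<alpha> pos
          by (subst pos_le_divide_eq) (auto simp: mult_ac)
        have "norm (partials \<beta> (\<lambda>x. \<mu> (c N *\<^sub>R x)) x) = c N ^ length \<beta> * norm (partials \<beta> \<mu> (c N *\<^sub>R x))"
          using c(1)[of N] by (simp add: partials_scale[OF \<mu>sm] abs_of_pos)
        also have "\<dots> \<le> 1 * (B \<beta> + 1)"
          using c[of N] by (intro mult_mono \<mu>B power_le_one) auto
        also have "\<dots> \<le> \<Lambda>" using \<Lambda>[of \<beta>] \<alpha> \<beta> by simp
        finally show "norm (partials \<beta> (\<lambda>x. \<mu> (c N *\<^sub>R x)) x) \<le> \<Lambda>" .
      qed
      also have "\<dots> \<le> 2 ^ m * (?S / (1 + norm x) ^ Suc m * \<Lambda>)"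
        using \<alpha> S0 \<Lambda>0 pos by (intro mult_right_mono power_increasing) auto
      finally have "(1 + norm x) ^ m * norm (partials \<alpha> (\<lambda>x. \<phi> x * \<mu> (c N *\<^sub>R x)) x)
          \<le> (1 + norm x) ^ m * (2 ^ m * (?S / (1 + norm x) ^ Suc m * \<Lambda>))"
        by (intro mult_left_mono) auto
      also have "\<dots> = 2 ^ m * ?S * \<Lambda> * (1 / (1 + norm x))"
      proof -
        have "t ^ m * (2 ^ m * (?S / t ^ Suc m * \<Lambda>)) = 2 ^ m * ?S * \<Lambda> * (1 / t)" if "0 < t" for t :: real
          using that by simp
        then show ?thesis by (simp add: add_pos_nonneg)
      qed
      also have "\<dots> \<le> 2 ^ m * ?S * \<Lambda> * c N"
        using False S0 \<Lambda>0 by (intro mult_left_mono) (auto simp: c_def frac_le)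
      finally show ?thesis unfolding eq .
    qed
    have "schwartz_seminorm m (\<lambda>x. \<theta> N x - \<phi> x) \<le> card ?L * (2 ^ m * ?S * \<Lambda> * c N)" for N
      by (rule schwartz_seminorm_le[OF bound])
    moreover have "0 \<le> schwartz_seminorm m (\<lambda>x. \<theta> N x - \<phi> x)" for N
      by (intro schwartz_seminorm_nonneg schwartz_diff test_schwartz test \<phi>)
    moreover have "(\<lambda>N. card ?L * (2 ^ m * ?S * \<Lambda> * c N)) \<longlonglongrightarrow> card ?L * (2 ^ m * ?S * \<Lambda> * 0)"
      unfolding c_def by (intro tendsto_intros LIMSEQ_inverse_real_of_nat[unfolded inverse_eq_divide])
    ultimately show ?thesis
      using tendsto_sandwich[of "\<lambda>_. 0" "\<lambda>N. schwartz_seminorm m (\<lambda>x. \<theta> N x - \<phi> x)" sequentially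
          "\<lambda>N. card ?L * (2 ^ m * ?S * \<Lambda> * c N)" 0] by simp
  qed
  show ?thesis using test le lim sem by (intro exI[of _ \<theta>]) auto
qed

text \<open>\<open>is_function\<close> speaks of test functions only. Both sides converge along
  cutoffs of \<phi>: the left by the seminorm estimate, the right by dominated convergence, for
  which the integrability of b against a decaying weight supplies the majorant.\<close>

lemma tempered_function_schwartz:
  fixes b :: "'d::finite fn"
  assumes u: "tempered_distribution u" "is_function u b"
    and b: "integrable lebesgue (\<lambda>x. norm (b x) * (1 / (1 + norm x) ^ n))" and \<phi>: "\<phi> \<in> schwartz_fns"
  shows "u \<phi> = (LINT x|lebesgue. b x * \<phi> x)"
proof -
  obtain \<theta> where \<theta>: "\<And>N. \<theta> N \<in> test_fns" "\<And>N x. norm (\<theta> N x) \<le> norm (\<phi> x)"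
     "\<And>x. (\<lambda>N. \<theta> N x) \<longlonglongrightarrow> \<phi> x" "\<And>m. (\<lambda>N. schwartz_seminorm m (\<lambda>x. \<theta> N x - \<phi> x)) \<longlonglongrightarrow> 0"
    using schwartz_cutoff[OF \<phi>] by blast
  obtain C m where C: "\<And>\<phi>. \<phi> \<in> schwartz_fns \<Longrightarrow> norm (u \<phi>) \<le> C * schwartz_seminorm m \<phi>"
    using u(1) by (auto simp: tempered_distribution_def)
  have S: "\<theta> N \<in> schwartz_fns" for N by (rule test_schwartz[OF \<theta>(1)])
  have Sd: "(\<lambda>x. \<theta> N x - \<phi> x) \<in> schwartz_fns" for N
    by (intro schwartz_diff S \<phi>)
  have diff: "u (\<lambda>x. \<theta> N x - \<phi> x) = u (\<theta> N) - u \<phi>" for N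
    using u(1) by (intro linear_functional_on_diff[of schwartz_fns] S \<phi> schwartz_cmult)
      (simp add: tempered_distribution_def)
  have "(\<lambda>N. u (\<theta> N) - u \<phi>) \<longlonglongrightarrow> 0"
  proof (rule Lim_null_comparison)
    show "(\<lambda>N. C * schwartz_seminorm m (\<lambda>x. \<theta> N x - \<phi> x)) \<longlonglongrightarrow> 0"
      using tendsto_mult_right_zero[OF \<theta>(4)] by simp
    show "\<forall>\<^sub>F N in sequentially. norm (u (\<theta> N) - u \<phi>) \<le> C * schwartz_seminorm m (\<lambda>x. \<theta> N x - \<phi> x)"
      using C[OF Sd] by (simp add: diff)
  qed
  then have 1: "(\<lambda>N. u (\<theta> N)) \<longlonglongrightarrow> u \<phi>" by (rule LIM_zero_cancel)
  have bm: "b \<in> borel_measurable lebesgue" using u(2) by (simp add: is_function_def locally_integrable_def)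
  have \<phi>m: "\<phi> \<in> borel_measurable lebesgue" "\<theta> N \<in> borel_measurable lebesgue" for N
    by (intro rapid_measurable schwartz_rapid \<phi> S)+
  obtain K where K: "\<And>x. (1 + norm x) ^ n * norm (\<phi> x) \<le> K" using schwartz_bound[OF \<phi>, of n "[]"] by auto
  have 2: "(\<lambda>N. LINT x|lebesgue. b x * \<theta> N x) \<longlonglongrightarrow> (LINT x|lebesgue. b x * \<phi> x)"
  proof (rule integral_dominated_convergence[where w = "\<lambda>x. K * (norm (b x) * (1 / (1 + norm x) ^ n))"])
    show "AE x in lebesgue. norm (b x * \<theta> N x) \<le> K * (norm (b x) * (1 / (1 + norm x) ^ n))" for N
    proof (intro AE_I2)
      fix x
      have "norm (\<phi> x) \<le> K * (1 / (1 + norm x) ^ n)"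
        using K[of x] one_plus_norm_pos[of x n] by (simp add: field_simps)
      then have "norm (\<theta> N x) \<le> K * (1 / (1 + norm x) ^ n)" using \<theta>(2)[of N x] by linarith
      from mult_left_mono[OF this, of "norm (b x)"]
      show "norm (b x * \<theta> N x) \<le> K * (norm (b x) * (1 / (1 + norm x) ^ n))" by (simp add: norm_mult mult_ac)
    qed
    show "AE x in lebesgue. (\<lambda>N. b x * \<theta> N x) \<longlonglongrightarrow> b x * \<phi> x"
      by (intro AE_I2 tendsto_intros \<theta>)
    show "integrable lebesgue (\<lambda>x. K * (norm (b x) * (1 / (1 + norm x) ^ n)))"
      by (rule integrable_mult_right[OF b])
  qed (use bm \<phi>m in \<open>auto intro!: borel_measurable_times\<close>)
  have "u (\<theta> N) = (LINT x|lebesgue. b x * \<theta> N x)" for N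
    using u(2) \<theta>(1) by (simp add: is_function_def)
  with 1 2 show ?thesis using LIMSEQ_unique by auto
qed

section \<open>Localised plane waves as Fourier transforms\<close>

lemma fourier_reflect:
  fixes a :: "'d::finite fn"
  assumes "a \<in> borel_measurable lebesgue"
  shows "fourier (\<lambda>\<eta>. a (- \<eta>)) x = fourier a (- x)"
proof -
  have "(LINT \<eta>|lebesgue. a \<eta> * wave (- x) \<eta>) = (LINT \<eta>|lebesgue. a (0 - \<eta>) * wave (- x) (0 - \<eta>))"
    by (rule integral_lebesgue_reflect[symmetric]) (intro borel_measurable_times assms wave_measurable)
  then show ?thesis by (simp add: fourier_wave) (simp add: wave_def)
qed

lemma fourier_inversion_reflect:
  assumes "\<phi> \<in> schwartz_fns"
  shows "fourier (\<lambda>\<eta>. fourier \<phi> (- \<eta>)) = \<phi>"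
  using fourier_inversion[OF assms]
  by (auto simp: fourier_reflect rapid_measurable schwartz_rapid schwartz_fourier assms)

lemma fourier_mult_wave: "fourier (\<lambda>x. \<phi> x * wave \<xi> x) \<eta> = fourier \<phi> (\<xi> + \<eta>)"
proof -
  have "wave \<xi> x * wave \<eta> x = wave (\<xi> + \<eta>) x" for x
    by (simp add: wave_def inner_add_right algebra_simps flip: exp_add)
  then show ?thesis by (simp add: fourier_wave mult.assoc)
qed

text \<open>Inversion applied to \<phi> times a plane wave, whose transform is a translate of
  \<open>fourier \<phi>\<close>. A functional evaluated at such a product thereby becomes a
  convolution on the frequency side.\<close>

lemma mult_wave_eq_fourier:
  assumes "\<phi> \<in> schwartz_fns"
  shows "(\<lambda>x. \<phi> x * wave \<xi> x) = fourier (\<lambda>\<eta>. fourier \<phi> (\<xi> - \<eta>))"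
    and "(\<lambda>\<eta>. fourier \<phi> (\<xi> - \<eta>)) \<in> schwartz_fns"
  using fourier_inversion_reflect[OF schwartz_mult_wave[OF assms, of \<xi>]]
    schwartz_reflect[OF schwartz_fourier[OF schwartz_mult_wave[OF assms, of \<xi>]]]
  by (simp_all add: fourier_mult_wave)

lemma fourier_add:
  fixes \<phi> \<psi> :: "'d::finite fn"
  assumes "\<phi> \<in> schwartz_fns" "\<psi> \<in> schwartz_fns"
  shows "fourier (\<lambda>x. \<phi> x + \<psi> x) = (\<lambda>\<xi>. fourier \<phi> \<xi> + fourier \<psi> \<xi>)"
proof
  fix \<xi>
  have I: "integrable lebesgue (\<lambda>x. \<phi> x * wave \<xi> x)" "integrable lebesgue (\<lambda>x. \<psi> x * wave \<xi> x)"
    by (intro integrable_mult_wave rapid_integrable schwartz_rapid assms)+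
  show "fourier (\<lambda>x. \<phi> x + \<psi> x) \<xi> = fourier \<phi> \<xi> + fourier \<psi> \<xi>"
    by (simp add: fourier_wave distrib_right scaleR_add_right Bochner_Integration.integral_add[OF I])
qed

lemma fourier_cmult: "fourier (\<lambda>x. c * \<phi> x) = (\<lambda>\<xi>. c * fourier \<phi> \<xi>)"
proof
  fix \<xi>
  have "(LINT x|lebesgue. c * \<phi> x * wave \<xi> x) = c * (LINT x|lebesgue. \<phi> x * wave \<xi> x)"
    unfolding mult.assoc by (rule integral_mult_right_zero)
  then show "fourier (\<lambda>x. c * \<phi> x) \<xi> = c * fourier \<phi> \<xi>" by (simp add: fourier_wave)
qed

lemma tempered_fourier:
  fixes g :: "'d::finite functional"
  assumes g: "tempered_distribution g"
  shows "tempered_distribution (fourier_tempered g)"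
proof -
  obtain C m where C: "\<And>\<phi>. \<phi> \<in> schwartz_fns \<Longrightarrow> norm (g \<phi>) \<le> C * schwartz_seminorm m \<phi>"
    using g by (auto simp: tempered_distribution_def)
  obtain D k where D: "\<And>\<phi> :: 'd fn. \<phi> \<in> schwartz_fns \<Longrightarrow> schwartz_seminorm m (fourier \<phi>) \<le> D * schwartz_seminorm k \<phi>"
    using fourier_seminorm by blast
  have "norm (g (fourier \<phi>)) \<le> (\<bar>C\<bar> * D) * schwartz_seminorm k \<phi>" if \<phi>: "\<phi> \<in> schwartz_fns" for \<phi>
  proof -
    have "norm (g (fourier \<phi>)) \<le> \<bar>C\<bar> * schwartz_seminorm m (fourier \<phi>)"
      using order_trans[OF C[OF schwartz_fourier[OF \<phi>]]
        mult_right_mono[OF abs_ge_self schwartz_seminorm_nonneg[OF schwartz_fourier[OF \<phi>]]]] .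
    also have "\<dots> \<le> \<bar>C\<bar> * (D * schwartz_seminorm k \<phi>)" by (intro mult_left_mono D \<phi>) auto
    finally show ?thesis by (simp add: mult_ac)
  qed
  moreover have "linear_functional_on schwartz_fns g" using g by (simp add: tempered_distribution_def)
  ultimately show ?thesis
    unfolding tempered_distribution_def fourier_tempered_def linear_functional_on_def
    by (auto simp: fourier_add fourier_cmult schwartz_fourier)
qed

text \<open>Up to \<open>fourier_const\<close>, the left side is the Fourier transform of \<phi> g,
  so multiplication by \<phi> acts on b as convolution with \<open>fourier \<phi>\<close>. This
  convolution is again in B once \<open>fourier \<phi>\<close> is known to be in the weighted L^1
  space.\<close>

lemma fourier_BF_mult_wave:
  fixes B :: "'d::finite fn set"
  assumes BF: "translation_invariant_BF_space v B nrm" and g: "tempered_distribution g"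
    and b: "b \<in> B" "is_function (fourier_tempered g) b" and \<phi>: "\<phi> \<in> test_fns"
  shows "g (\<lambda>x. \<phi> x * wave \<xi> x) = convolve (fourier \<phi>) b \<xi>"
proof -
  have S: "\<phi> \<in> schwartz_fns" by (rule test_schwartz[OF \<phi>])
  obtain n where n: "integrable lebesgue (\<lambda>x. norm (b x) * (1 / (1 + norm x) ^ n))"
    using BF_space_integrable_decay[OF BF b(1)] by blast
  have "g (\<lambda>x. \<phi> x * wave \<xi> x) = fourier_tempered g (\<lambda>\<eta>. fourier \<phi> (\<xi> - \<eta>))"
    by (simp add: fourier_tempered_def mult_wave_eq_fourier(1)[OF S])
  also have "\<dots> = (LINT \<eta>|lebesgue. b \<eta> * fourier \<phi> (\<xi> - \<eta>))"
    by (rule tempered_function_schwartz[OF tempered_fourier[OF g] b(2) n mult_wave_eq_fourier(2)[OF S]])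
  also have "\<dots> = (LINT \<eta>|lebesgue. b (\<xi> - \<eta>) * fourier \<phi> (\<xi> - (\<xi> - \<eta>)))"
    by (rule integral_lebesgue_reflect[symmetric])
      (intro borel_measurable_times BF_space_measurable[OF BF b(1)] rapid_measurable schwartz_rapid mult_wave_eq_fourier(2) S)
  also have "\<dots> = convolve (fourier \<phi>) b \<xi>" by (simp add: convolve_def mult.commute)
  finally show ?thesis .
qed

lemma compact_distribution_mult_wave:
  fixes w :: "'d::finite functional"
  assumes w: "compact_distribution w" and \<phi>: "\<phi> \<in> test_fns"
  shows "w (\<lambda>x. \<phi> x * wave \<xi> x) = (LINT \<eta>|lebesgue. fourier \<phi> (\<xi> - \<eta>) * fourier_compact w \<eta>)"
  unfolding mult_wave_eq_fourier(1)[OF test_schwartz[OF \<phi>]]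
  by (intro compact_distribution_fourier w schwartz_rapid mult_wave_eq_fourier(2) test_schwartz \<phi>)

section \<open>Localisation of distributions\<close>

text \<open>The constants depend on \<kappa> only through \<open>K\<close> and the bounds
  \<open>B\<close>; this uniformity is what makes the distributions cut off by a whole sequence
  bounded in the dual of the smooth functions.\<close>

lemma mult_distribution_uniform_bound:
  fixes u :: "'d::finite functional"
  assumes u: "distribution u" and K: "compact K"
    and X: "\<And>\<kappa>. \<kappa> \<in> X \<Longrightarrow> \<kappa> \<in> test_fns" "\<And>\<kappa>. \<kappa> \<in> X \<Longrightarrow> supp \<kappa> \<subseteq> K"
    and B: "\<And>\<kappa> \<alpha> x. \<kappa> \<in> X \<Longrightarrow> norm (partials \<alpha> \<kappa> x) \<le> B \<alpha>"
  shows "\<exists>C m. 0 \<le> C \<and> (\<forall>\<kappa>\<in>X. \<forall>\<psi>\<in>smooth_fns. norm (mult_distribution \<kappa> u \<psi>) \<le> C * smooth_seminorm m \<psi>)"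
proof -
  obtain C m0 where C: "\<And>\<phi>. \<phi> \<in> test_fns \<Longrightarrow> supp \<phi> \<subseteq> K \<Longrightarrow> norm (u \<phi>) \<le> C * test_seminorm m0 \<phi>"
    using u K unfolding distribution_def by meson
  obtain R where R: "\<And>x. x \<in> K \<Longrightarrow> norm x \<le> R"
    using compact_imp_bounded[OF K] unfolding bounded_iff by blast
  \<comment> \<open>\<open>smooth_seminorm m\<close> looks only at the ball of radius m, so m must
    reach beyond \<open>K\<close> and not merely bound the order.\<close>
  define m where "m = max m0 (nat \<lceil>R\<rceil>)"
  let ?L = "{\<alpha> :: 'd list. length \<alpha> \<le> m0}"
  define \<Lambda> where "\<Lambda> = (\<Sum>\<beta>\<in>?L. \<bar>B \<beta>\<bar>)"
  have \<Lambda>0: "0 \<le> \<Lambda>" unfolding \<Lambda>_def by (intro sum_nonneg) auto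
  have \<Lambda>: "\<bar>B \<beta>\<bar> \<le> \<Lambda>" if "length \<beta> \<le> m0" for \<beta>
    unfolding \<Lambda>_def using that by (intro member_le_sum[where f = "\<lambda>\<beta>. \<bar>B \<beta>\<bar>"] finite_lists_le) auto
  have "norm (u (\<lambda>x. \<kappa> x * \<psi> x)) \<le> (\<bar>C\<bar> * (card ?L * (2 ^ m0 * \<Lambda>))) * smooth_seminorm m \<psi>"
    if \<kappa>: "\<kappa> \<in> X" and \<psi>: "\<psi> \<in> smooth_fns" for \<kappa> \<psi>
  proof -
    let ?S = "smooth_seminorm m \<psi>"
    have S0: "0 \<le> ?S" using order_trans[OF norm_ge_zero le_smooth_seminorm[OF \<psi>, of 0 m "[]"]] by simp
    have t: "(\<lambda>x. \<kappa> x * \<psi> x) \<in> test_fns" by (intro test_mult X \<kappa> \<psi>)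
    have "norm (partials \<alpha> (\<lambda>x. \<kappa> x * \<psi> x) x) \<le> 2 ^ m0 * (\<Lambda> * ?S)" if \<alpha>: "length \<alpha> \<le> m0" for \<alpha> x
    proof (cases "x \<in> supp \<kappa>")
      case True
      then have "norm x \<le> real m" 
      proof -
        assume "x \<in> supp \<kappa>"
        then have "norm x \<le> R" using X(2)[OF \<kappa>] R by blast
        also have "R \<le> real (nat \<lceil>R\<rceil>)" by linarith
        also have "\<dots> \<le> real m" by (simp add: m_def)
        finally show ?thesis .
      qed
      have "norm (partials \<alpha> (\<lambda>x. \<kappa> x * \<psi> x) x) \<le> 2 ^ length \<alpha> * (\<Lambda> * ?S)"
      proof (rule norm_partials_mult_le[OF test_smooth[OF X(1)[OF \<kappa>]] \<psi>])
        fix \<beta> :: "'d list" assume \<beta>: "length \<beta> \<le> length \<alpha>"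
        show "norm (partials \<beta> \<kappa> x) \<le> \<Lambda>"
          using order_trans[OF B[OF \<kappa>, of \<beta> x] order_trans[OF abs_ge_self \<Lambda>[of \<beta>]]] \<alpha> \<beta> by simp
        show "norm (partials \<beta> \<psi> x) \<le> ?S"
          using \<alpha> \<beta> by (intro le_smooth_seminorm \<psi> \<open>norm x \<le> real m\<close>) (simp add: m_def)
      qed
      also have "\<dots> \<le> 2 ^ m0 * (\<Lambda> * ?S)"
        using \<alpha> \<Lambda>0 S0 by (intro mult_right_mono power_increasing) auto
      finally show ?thesis .
    next
      case False
      then have "x \<notin> supp (\<lambda>x. \<kappa> x * \<psi> x)" using supp_mult_subset[of \<kappa> \<psi>] by blast
      then show ?thesis using \<Lambda>0 S0 by (simp add: partials_outside_supp)
    qed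
    then have "test_seminorm m0 (\<lambda>x. \<kappa> x * \<psi> x) \<le> card ?L * (2 ^ m0 * (\<Lambda> * ?S))"
      by (rule test_seminorm_le)
    moreover have "0 \<le> test_seminorm m0 (\<lambda>x. \<kappa> x * \<psi> x)"
      using order_trans[OF norm_ge_zero le_test_seminorm[OF t, of "[]" m0 0]] by simp
    moreover have "supp (\<lambda>x. \<kappa> x * \<psi> x) \<subseteq> K" using supp_mult_subset[of \<kappa> \<psi>] X(2)[OF \<kappa>] by blast
    then have "norm (u (\<lambda>x. \<kappa> x * \<psi> x)) \<le> C * test_seminorm m0 (\<lambda>x. \<kappa> x * \<psi> x)" by (rule C[OF t])
    ultimately have "norm (u (\<lambda>x. \<kappa> x * \<psi> x)) \<le> \<bar>C\<bar> * (card ?L * (2 ^ m0 * (\<Lambda> * ?S)))"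
      by (meson abs_ge_self abs_ge_zero mult_left_mono mult_right_mono order_trans)
    then show ?thesis by (simp add: mult_ac)
  qed
  then show ?thesis using \<Lambda>0 unfolding mult_distribution_def
    by (intro exI[of _ "\<bar>C\<bar> * (card ?L * (2 ^ m0 * \<Lambda>))"] exI[of _ m]) auto
qed

lemma mult_distribution_compact:
  fixes u :: "'d::finite functional"
  assumes u: "distribution u" and \<kappa>: "\<kappa> \<in> test_fns"
  shows "compact_distribution (mult_distribution \<kappa> u)"
proof -
  have L: "linear_functional_on test_fns u" using u by (simp add: distribution_def)
  have "\<exists>B. \<forall>\<alpha> x. norm (partials \<alpha> \<kappa> x) \<le> B \<alpha>"
  proof -
    have "\<exists>C. \<forall>x. norm (partials \<alpha> \<kappa> x) \<le> C" for \<alpha> using test_bound[OF \<kappa>, of 0 \<alpha>] by auto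
    then show ?thesis by metis
  qed
  then obtain B where "\<And>\<alpha> x. norm (partials \<alpha> \<kappa> x) \<le> B \<alpha>" by blast
  then have "\<exists>C m. 0 \<le> C \<and> (\<forall>\<kappa>\<in>{\<kappa>}. \<forall>\<psi>\<in>smooth_fns. norm (mult_distribution \<kappa> u \<psi>) \<le> C * smooth_seminorm m \<psi>)"
    using \<kappa> by (intro mult_distribution_uniform_bound[OF u, of "supp \<kappa>"]) (auto simp: test_fns_def)
  moreover have "linear_functional_on smooth_fns (mult_distribution \<kappa> u)"
    unfolding linear_functional_on_def mult_distribution_def
  proof (intro conjI ballI allI)
    fix \<phi> \<psi> :: "'d fn" assume "\<phi> \<in> smooth_fns" "\<psi> \<in> smooth_fns"
    then show "u (\<lambda>x. \<kappa> x * (\<phi> x + \<psi> x)) = u (\<lambda>x. \<kappa> x * \<phi> x) + u (\<lambda>x. \<kappa> x * \<psi> x)"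
      using linear_functional_on_add[OF L test_mult[OF \<kappa>, of \<phi>] test_mult[OF \<kappa>, of \<psi>]]
      by (simp add: distrib_left)
  next
    fix c and \<phi> :: "'d fn" assume "\<phi> \<in> smooth_fns"
    then show "u (\<lambda>x. \<kappa> x * (c * \<phi> x)) = c * u (\<lambda>x. \<kappa> x * \<phi> x)"
      using linear_functional_on_cmult[OF L test_mult[OF \<kappa>, of \<phi>], of c] by (simp add: mult.left_commute)
  qed
  ultimately show ?thesis by (auto simp: compact_distribution_def)
qed

lemma test_seminorm_mono:
  fixes \<phi> :: "'d::finite fn"
  assumes "\<phi> \<in> test_fns" "m \<le> n"
  shows "test_seminorm m \<phi> \<le> card {\<alpha> :: 'd list. length \<alpha> \<le> m} * test_seminorm n \<phi>"
  by (rule test_seminorm_le) (use assms in \<open>auto intro: le_test_seminorm\<close>)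

lemma test_seminorm_nonneg: "\<phi> \<in> test_fns \<Longrightarrow> 0 \<le> test_seminorm m \<phi>"
  using order_trans[OF norm_ge_zero le_test_seminorm[of \<phi> "[]" m 0]] by simp

lemma linear_functional_on_subset: "linear_functional_on V u \<Longrightarrow> W \<subseteq> V \<Longrightarrow> linear_functional_on W u"
  unfolding linear_functional_on_def by blast

lemma tempered_imp_distribution:
  fixes u :: "'d::finite functional"
  assumes "tempered_distribution u"
  shows "distribution u"
  unfolding distribution_def
proof (intro conjI allI impI)
  show "linear_functional_on test_fns u"
    by (rule linear_functional_on_subset[of schwartz_fns])
      (use assms test_schwartz in \<open>auto simp: tempered_distribution_def\<close>)
  obtain C m where C: "\<And>\<phi>. \<phi> \<in> schwartz_fns \<Longrightarrow> norm (u \<phi>) \<le> C * schwartz_seminorm m \<phi>"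
    using assms by (auto simp: tempered_distribution_def)
  fix K :: "(real ^ 'd) set" assume K: "compact K"
  obtain R where R: "\<And>x. x \<in> K \<Longrightarrow> norm x \<le> R"
    using compact_imp_bounded[OF K] unfolding bounded_iff by blast
  let ?L = "{\<alpha> :: 'd list. length \<alpha> \<le> m}"
  have "norm (u \<phi>) \<le> (\<bar>C\<bar> * (card ?L * (1 + \<bar>R\<bar>) ^ m)) * test_seminorm m \<phi>"
    if \<phi>: "\<phi> \<in> test_fns" "supp \<phi> \<subseteq> K" for \<phi>
  proof -
    have "schwartz_seminorm m \<phi> \<le> card ?L * ((1 + \<bar>R\<bar>) ^ m * test_seminorm m \<phi>)"
    proof (rule schwartz_seminorm_le)
      fix \<alpha> :: "'d list" and x assume \<alpha>: "length \<alpha> \<le> m"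
      show "(1 + norm x) ^ m * norm (partials \<alpha> \<phi> x) \<le> (1 + \<bar>R\<bar>) ^ m * test_seminorm m \<phi>"
      proof (cases "x \<in> supp \<phi>")
        case True
        then have "norm x \<le> \<bar>R\<bar>" using R[of x] \<phi>(2) by fastforce
        then show ?thesis by (intro mult_mono power_mono le_test_seminorm \<phi> \<alpha>) auto
      next
        case False
        then show ?thesis using test_seminorm_nonneg[OF \<phi>(1)] by (simp add: partials_outside_supp)
      qed
    qed
    then have "\<bar>C\<bar> * schwartz_seminorm m \<phi> \<le> \<bar>C\<bar> * (card ?L * ((1 + \<bar>R\<bar>) ^ m * test_seminorm m \<phi>))"
      by (intro mult_left_mono) auto
    moreover have "norm (u \<phi>) \<le> \<bar>C\<bar> * schwartz_seminorm m \<phi>"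
      using order_trans[OF C mult_right_mono[OF abs_ge_self schwartz_seminorm_nonneg]] test_schwartz[OF \<phi>(1)] by blast
    ultimately show ?thesis by (simp add: mult_ac)
  qed
  then show "\<exists>C m. \<forall>\<phi>\<in>test_fns. supp \<phi> \<subseteq> K \<longrightarrow> norm (u \<phi>) \<le> C * test_seminorm m \<phi>" by blast
qed

lemma distribution_diff:
  fixes f g :: "'d::finite functional"
  assumes f: "distribution f" and g: "distribution g"
  shows "distribution (\<lambda>\<phi>. f \<phi> - g \<phi>)"
  unfolding distribution_def
proof (intro conjI allI impI)
  show "linear_functional_on test_fns (\<lambda>\<phi>. f \<phi> - g \<phi>)"
    using f g by (simp add: distribution_def linear_functional_on_def algebra_simps)
  fix K :: "(real ^ 'd) set" assume K: "compact K"
  obtain C m where C: "\<And>\<phi>. \<phi> \<in> test_fns \<Longrightarrow> supp \<phi> \<subseteq> K \<Longrightarrow> norm (f \<phi>) \<le> C * test_seminorm m \<phi>"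
    using f K unfolding distribution_def by meson
  obtain D n where D: "\<And>\<phi>. \<phi> \<in> test_fns \<Longrightarrow> supp \<phi> \<subseteq> K \<Longrightarrow> norm (g \<phi>) \<le> D * test_seminorm n \<phi>"
    using g K unfolding distribution_def by meson
  let ?k = "\<lambda>m. real (card {\<alpha> :: 'd list. length \<alpha> \<le> m})"
  have "norm (f \<phi> - g \<phi>) \<le> (\<bar>C\<bar> * ?k m + \<bar>D\<bar> * ?k n) * test_seminorm (max m n) \<phi>"
    if \<phi>: "\<phi> \<in> test_fns" "supp \<phi> \<subseteq> K" for \<phi>
  proof -
    have "norm (f \<phi>) \<le> \<bar>C\<bar> * (?k m * test_seminorm (max m n) \<phi>)"
      by (rule order_trans[OF order_trans[OF C[OF \<phi>] mult_right_mono[OF abs_ge_self test_seminorm_nonneg[OF \<phi>(1)]]]])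
        (intro mult_left_mono test_seminorm_mono \<phi>; simp)
    moreover have "norm (g \<phi>) \<le> \<bar>D\<bar> * (?k n * test_seminorm (max m n) \<phi>)"
      by (rule order_trans[OF order_trans[OF D[OF \<phi>] mult_right_mono[OF abs_ge_self test_seminorm_nonneg[OF \<phi>(1)]]]])
        (intro mult_left_mono test_seminorm_mono \<phi>; simp)
    ultimately show ?thesis using norm_triangle_ineq4[of "f \<phi>" "g \<phi>"] by (simp add: algebra_simps)
  qed
  then show "\<exists>C m. \<forall>\<phi>\<in>test_fns. supp \<phi> \<subseteq> K \<longrightarrow> norm (f \<phi> - g \<phi>) \<le> C * test_seminorm m \<phi>" by blast
qed

lemma fourier_compact_mult:
  "fourier_compact (mult_distribution \<phi> u) \<xi> = fourier_const TYPE('d) *\<^sub>R u (\<lambda>x. \<phi> x * wave \<xi> x)"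
  for u :: "'d::finite functional"
  by (simp add: fourier_compact_wave mult_distribution_def)

section \<open>Cones\<close>

text \<open>Both cones are invariant under dilation, so unit vectors decide: the directions of the
  smaller cone fill a small cap around that of \<xi>0, well inside \<Gamma>.\<close>

lemma cone_separation:
  fixes \<xi>0 :: "real ^ 'd::finite"
  assumes \<Gamma>: "open_conic_nbhd \<xi>0 \<Gamma>"
  shows "\<exists>\<Gamma>' \<epsilon>. open_conic_nbhd \<xi>0 \<Gamma>' \<and> 0 < \<epsilon> \<and> \<epsilon> \<le> 1/2 \<and>
    (\<forall>\<xi>\<in>\<Gamma>'. \<forall>\<eta>. \<eta> \<notin> \<Gamma> \<longrightarrow> \<epsilon> * norm \<xi> \<le> norm (\<xi> - \<eta>))"
proof -
  have 0: "\<xi>0 \<noteq> 0" and op: "open \<Gamma>" and cone: "\<And>\<xi> t. \<xi> \<in> \<Gamma> \<Longrightarrow> 0 < t \<Longrightarrow> t *\<^sub>R \<xi> \<in> \<Gamma>" and in\<Gamma>: "\<xi>0 \<in> \<Gamma>"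
    using \<Gamma> by (auto simp: open_conic_nbhd_def)
  have "sgn \<xi>0 \<in> \<Gamma>" unfolding sgn_div_norm using 0 by (intro cone in\<Gamma>) simp
  then obtain e where e: "0 < e" "ball (sgn \<xi>0) e \<subseteq> \<Gamma>" using op open_contains_ball by blast
  \<comment> \<open>Two errors of size \<epsilon> add up in the triangle inequality, hence e / 2.
    The cap 1 / 2 will give norm \<eta> >= norm \<xi> / 2 whenever \<eta> is nearer to \<xi> than
    \<epsilon> norm \<xi>.\<close>
  define \<epsilon> where "\<epsilon> = min (e / 2) (1 / 2)"
  have \<epsilon>: "0 < \<epsilon>" "\<epsilon> \<le> 1/2" "2 * \<epsilon> \<le> e" using e by (auto simp: \<epsilon>_def)
  define \<Gamma>' where "\<Gamma>' = (- {0}) \<inter> sgn -` ball (sgn \<xi>0) \<epsilon>"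
  have "open \<Gamma>'"
    unfolding \<Gamma>'_def by (intro continuous_open_preimage continuous_on_sgn continuous_on_id) auto
  moreover have "t *\<^sub>R \<xi> \<in> \<Gamma>'" if "\<xi> \<in> \<Gamma>'" "0 < t" for \<xi> t
    using that by (auto simp: \<Gamma>'_def sgn_scaleR)
  ultimately have 1: "open_conic_nbhd \<xi>0 \<Gamma>'"
    using 0 \<epsilon>(1) by (auto simp: open_conic_nbhd_def \<Gamma>'_def)
  have 2: "\<epsilon> * norm \<xi> \<le> norm (\<xi> - \<eta>)" if \<xi>: "\<xi> \<in> \<Gamma>'" and \<eta>: "\<eta> \<notin> \<Gamma>" for \<xi> \<eta>
  proof (rule ccontr)
    assume "\<not> \<epsilon> * norm \<xi> \<le> norm (\<xi> - \<eta>)"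
    then have lt: "norm (\<xi> - \<eta>) < \<epsilon> * norm \<xi>" by simp
    have n: "0 < norm \<xi>" using \<xi> by (simp add: \<Gamma>'_def)
    have "norm (sgn \<xi> - \<eta> /\<^sub>R norm \<xi>) = norm (\<xi> - \<eta>) / norm \<xi>"
      by (simp add: sgn_div_norm divide_inverse flip: scaleR_diff_right)
    also have "\<dots> < \<epsilon>" using lt n by (simp add: divide_less_eq)
    finally have "norm (sgn \<xi> - \<eta> /\<^sub>R norm \<xi>) < \<epsilon>" .
    moreover have "norm (sgn \<xi>0 - sgn \<xi>) < \<epsilon>" using \<xi> by (simp add: \<Gamma>'_def dist_norm)
    ultimately have "norm (sgn \<xi>0 - \<eta> /\<^sub>R norm \<xi>) < e"
      using norm_triangle_ineq[of "sgn \<xi>0 - sgn \<xi>" "sgn \<xi> - \<eta> /\<^sub>R norm \<xi>"] \<epsilon>(3) by simp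
    then have "\<eta> /\<^sub>R norm \<xi> \<in> \<Gamma>" using e(2) by (auto simp: dist_norm)
    from cone[OF this n] n have "\<eta> \<in> \<Gamma>" by simp
    with \<eta> show False by blast
  qed
  show ?thesis using 1 2 \<epsilon> by blast
qed

section \<open>Decay of a localised Fourier transform in a smaller cone\<close>

lemma norm_integral_le:
  fixes f :: "'a \<Rightarrow> complex"
  assumes g: "integrable M g" and f: "f \<in> borel_measurable M" and le: "\<And>x. norm (f x) \<le> g x"
  shows "norm (LINT x|M. f x) \<le> (LINT x|M. g x)"
proof -
  have "integrable M f"
    by (rule Bochner_Integration.integrable_bound[OF g f]) (use le abs_ge_self order_trans in \<open>auto intro!: AE_I2, blast\<close>)
  then show ?thesis
    by (intro order_trans[OF integral_norm_bound integral_mono[OF integrable_norm g le]])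
qed

text \<open>Once \<eta> is far from \<xi> relative to the size of \<xi>, the distance controls both
  points, so that powers of 1 + norm \<xi> and 1 + norm \<eta> are paid for by decay in \<xi> -
  \<eta>.\<close>

lemma separated_norm_le:
  fixes \<xi> \<eta> :: "'a::real_normed_vector"
  assumes \<epsilon>: "0 < \<epsilon>" "\<epsilon> \<le> 1/2" and le: "\<epsilon> * norm \<xi> \<le> norm (\<xi> - \<eta>)"
  shows "1 + norm \<xi> \<le> (2 / \<epsilon>) * (1 + norm (\<xi> - \<eta>))"
    and "1 + norm \<eta> \<le> (2 / \<epsilon>) * (1 + norm (\<xi> - \<eta>))"
proof -
  let ?t = "norm (\<xi> - \<eta>)"
  have 1: "\<epsilon> * (1 + norm \<xi>) \<le> 1 + ?t" using \<epsilon> le by (simp add: distrib_left)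
  have "norm \<eta> \<le> norm \<xi> + ?t" using norm_triangle_sub[of \<eta> \<xi>] by (simp add: norm_minus_commute)
  then have "\<epsilon> * (1 + norm \<eta>) \<le> \<epsilon> * (1 + norm \<xi>) + \<epsilon> * ?t" using \<epsilon> by (simp add: flip: distrib_left)
  also have "\<epsilon> * ?t \<le> 1 * ?t" using \<epsilon> by (intro mult_right_mono) auto
  finally have 2: "\<epsilon> * (1 + norm \<eta>) \<le> 2 * (1 + ?t)" using 1 by simp
  show "1 + norm \<eta> \<le> (2 / \<epsilon>) * (1 + ?t)" using 2 \<epsilon> by (simp add: field_simps)
  have "\<epsilon> * (1 + norm \<xi>) \<le> 2 * (1 + ?t)" by (rule order_trans[OF 1]) simp
  then show "1 + norm \<xi> \<le> (2 / \<epsilon>) * (1 + ?t)" using \<epsilon> by (simp add: field_simps)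
qed

text \<open>The convolution is split at norm (\<xi> - \<eta>) = \<epsilon> norm \<xi>. Farther away
  the rapid decay of \<open>fourier \<phi>\<close> beats the polynomial growth of the transform of
  w; nearer, \<eta> lies in \<Gamma> and is at least half as large as \<xi>, so the assumed decay
  applies.\<close>

lemma localised_fourier_decay:
  fixes w :: "'d::finite functional"
  assumes w: "compact_distribution w" and \<phi>: "\<phi> \<in> test_fns"
    and \<epsilon>: "0 < \<epsilon>" "\<epsilon> \<le> 1/2"
    and sep: "\<And>\<xi> \<eta>. \<xi> \<in> \<Gamma>' \<Longrightarrow> \<eta> \<notin> \<Gamma> \<Longrightarrow> \<epsilon> * norm \<xi> \<le> norm (\<xi> - \<eta>)"
    and decay: "\<And>\<eta>. \<eta> \<in> \<Gamma> \<Longrightarrow> norm (fourier_compact w \<eta>) \<le> C / norm \<eta> ^ n"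
    and \<Gamma>: "0 \<notin> \<Gamma>"
  shows "\<exists>K. \<forall>\<xi>\<in>\<Gamma>'. norm (w (\<lambda>x. \<phi> x * wave \<xi> x)) \<le> K / (1 + norm \<xi>) ^ n"
proof -
  let ?d = "2 * CARD('d)"
  obtain D M where D: "0 \<le> D" "\<And>\<eta>. norm (fourier_compact w \<eta>) \<le> D * (1 + norm \<eta>) ^ M"
    using fourier_compact_bound[OF w] by blast
  have A: "\<exists>A\<ge>0. \<forall>\<zeta>. norm (fourier \<phi> \<zeta>) \<le> A / (1 + norm \<zeta>) ^ j" for j
  proof -
    obtain A where A: "\<And>\<zeta>. (1 + norm \<zeta>) ^ j * norm (fourier \<phi> \<zeta>) \<le> A"
      using schwartz_bound[OF schwartz_fourier[OF test_schwartz[OF \<phi>]], of j "[]"] by auto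
    have "0 \<le> A" using order_trans[OF _ A[of 0]] by simp
    moreover have "norm (fourier \<phi> \<zeta>) \<le> A / (1 + norm \<zeta>) ^ j" for \<zeta>
      using A[of \<zeta>] one_plus_norm_pos[of \<zeta> j] by (simp add: pos_le_divide_eq mult.commute)
    ultimately show ?thesis by blast
  qed
  \<comment> \<open>The n powers give the decay in \<xi>, M powers compensate the growth of the
    transform of w, and \<open>?d\<close> powers give integrability in \<eta>.\<close>
  define j where "j = n + (M + ?d)"
  obtain A1 where A1: "0 \<le> A1" "\<And>\<zeta>. norm (fourier \<phi> \<zeta>) \<le> A1 / (1 + norm \<zeta>) ^ j" using A by blast
  obtain A2 where A2: "0 \<le> A2" "\<And>\<zeta>. norm (fourier \<phi> \<zeta>) \<le> A2 / (1 + norm \<zeta>) ^ ?d" using A by blast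
  \<comment> \<open>The first term serves norm \<xi> >= 1, where 1 + norm \<xi> <= 4 norm \<eta>.
    The second serves small \<xi>, where the assumed bound may blow up near the origin and
    polynomial growth with 1 + norm \<eta> <= 3 and 1 + norm \<xi> <= 2 is used instead.\<close>
  define C2 where "C2 = \<bar>C\<bar> * 4 ^ n + D * 3 ^ M * 2 ^ n"
  have C2: "0 \<le> C2" using D(1) by (simp add: C2_def)
  define K1 where "K1 = A1 * D * (2 / \<epsilon>) ^ j"
  define K2 where "K2 = A2 * C2"
  have K: "0 \<le> K1" "0 \<le> K2" using A1(1) A2(1) D(1) C2 \<epsilon> by (auto simp: K1_def K2_def)
  \<comment> \<open>Each region is bounded by the same sum of two integrable functions, which spares
    a splitting of the domain of integration.\<close>
  have bound: "norm (fourier \<phi> (\<xi> - \<eta>) * fourier_compact w \<eta>)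
      \<le> (K1 + K2) / (1 + norm \<xi>) ^ n * (1 / (1 + norm \<eta>) ^ ?d + 1 / (1 + norm (\<xi> - \<eta>)) ^ ?d)" if \<xi>: "\<xi> \<in> \<Gamma>'" for \<xi> \<eta>
  proof -
    let ?t = "norm (\<xi> - \<eta>)"
    have px: "0 < (1 + norm \<xi>) ^ n" and pe: "0 < (1 + norm \<eta>) ^ k" and pt: "0 < (1 + ?t) ^ k" for k
      by (rule one_plus_norm_pos)+
    have "norm (fourier \<phi> (\<xi> - \<eta>) * fourier_compact w \<eta>)
      \<le> K1 / (1 + norm \<xi>) ^ n * (1 / (1 + norm \<eta>) ^ ?d) + K2 / (1 + norm \<xi>) ^ n * (1 / (1 + ?t) ^ ?d)"
    proof (cases "\<epsilon> * norm \<xi> \<le> ?t")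
      case True
      note s = separated_norm_le[OF \<epsilon> True]
      have "(1 + norm \<xi>) ^ n * (1 + norm \<eta>) ^ (M + ?d) \<le> ((2 / \<epsilon>) * (1 + ?t)) ^ n * ((2 / \<epsilon>) * (1 + ?t)) ^ (M + ?d)"
        using \<epsilon> by (intro mult_mono power_mono s) auto
      also have "\<dots> = (2 / \<epsilon>) ^ j * (1 + ?t) ^ j" by (simp only: j_def power_mult_distrib power_add mult_ac)
      finally have le: "(1 + norm \<xi>) ^ n * (1 + norm \<eta>) ^ (M + ?d) \<le> (2 / \<epsilon>) ^ j * (1 + ?t) ^ j" .
      have "norm (fourier \<phi> (\<xi> - \<eta>) * fourier_compact w \<eta>) \<le> A1 / (1 + ?t) ^ j * (D * (1 + norm \<eta>) ^ M)"
        unfolding norm_mult using A1 pt by (intro mult_mono D A1) auto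
      also have "\<dots> = A1 * D * (1 + norm \<eta>) ^ M * (1 / (1 + ?t) ^ j)" by simp
      also have "\<dots> \<le> A1 * D * (1 + norm \<eta>) ^ M * ((2 / \<epsilon>) ^ j / ((1 + norm \<xi>) ^ n * (1 + norm \<eta>) ^ (M + ?d)))"
      proof (intro mult_left_mono mult_nonneg_nonneg A1 D)
        have p: "0 < (1 + norm \<xi>) ^ n * (1 + norm \<eta>) ^ (M + ?d)" using px pe by simp
        show "1 / (1 + ?t) ^ j \<le> (2 / \<epsilon>) ^ j / ((1 + norm \<xi>) ^ n * (1 + norm \<eta>) ^ (M + ?d))"
        proof -
          have "1 / T \<le> E / P" if "P \<le> E * T" "0 < P" "0 < T" for E P T :: real
            using that by (simp add: field_simps)
          from this[OF le p pt] show ?thesis .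
        qed
      qed auto
      also have "\<dots> = K1 / (1 + norm \<xi>) ^ n * (1 / (1 + norm \<eta>) ^ ?d)"
        using pe[of M] by (simp add: K1_def power_add)
      also have "\<dots> \<le> K1 / (1 + norm \<xi>) ^ n * (1 / (1 + norm \<eta>) ^ ?d) + K2 / (1 + norm \<xi>) ^ n * (1 / (1 + ?t) ^ ?d)"
        using K px pt[of ?d] by simp
      finally show ?thesis .
    next
      case False
      then have \<eta>: "\<eta> \<in> \<Gamma>" using sep[OF \<xi>] by blast
      have tle: "?t \<le> norm \<xi> / 2" using False mult_right_mono[OF \<epsilon>(2), of "norm \<xi>"] by simp
      then have ge: "norm \<xi> / 2 \<le> norm \<eta>" using norm_triangle_sub[of \<xi> \<eta>] by simp
      have \<eta>0: "0 < norm \<eta>" using \<eta> \<Gamma> by auto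
      have "norm (fourier_compact w \<eta>) \<le> C2 / (1 + norm \<xi>) ^ n"
      proof (cases "1 \<le> norm \<xi>")
        case True
        have "(1 + norm \<xi>) ^ n \<le> (4 * norm \<eta>) ^ n" using ge True by (intro power_mono) auto
        then have "\<bar>C\<bar> * (1 + norm \<xi>) ^ n \<le> \<bar>C\<bar> * (4 ^ n * norm \<eta> ^ n)"
          by (intro mult_left_mono) (auto simp: power_mult_distrib)
        then have "\<bar>C\<bar> / norm \<eta> ^ n \<le> \<bar>C\<bar> * 4 ^ n / (1 + norm \<xi>) ^ n"
          using \<eta>0 px by (simp add: pos_divide_le_eq pos_le_divide_eq mult_ac)
        moreover have "C / norm \<eta> ^ n \<le> \<bar>C\<bar> / norm \<eta> ^ n" using \<eta>0 by (intro divide_right_mono) auto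
        moreover have "\<bar>C\<bar> * 4 ^ n / (1 + norm \<xi>) ^ n \<le> C2 / (1 + norm \<xi>) ^ n"
          using px D(1) by (intro divide_right_mono) (auto simp: C2_def)
        ultimately show ?thesis using decay[OF \<eta>] by linarith
      next
        case False
        have "norm \<eta> \<le> norm \<xi> + ?t" using norm_triangle_sub[of \<eta> \<xi>] by (simp add: norm_minus_commute)
        with False tle have "1 + norm \<eta> \<le> 3" by linarith
        then have "D * (1 + norm \<eta>) ^ M \<le> D * 3 ^ M" by (intro mult_left_mono power_mono D) auto
        also have "\<dots> \<le> D * 3 ^ M * 2 ^ n / (1 + norm \<xi>) ^ n"
        proof -
          have "(1 + norm \<xi>) ^ n \<le> 2 ^ n" using False by (intro power_mono) auto
          then have "D * 3 ^ M * (1 + norm \<xi>) ^ n \<le> D * 3 ^ M * 2 ^ n" using D(1) by (intro mult_left_mono) auto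
          then show ?thesis using px by (simp add: pos_le_divide_eq)
        qed
        also have "\<dots> \<le> C2 / (1 + norm \<xi>) ^ n"
          using px by (intro divide_right_mono) (auto simp: C2_def)
        finally show ?thesis using D(2)[of \<eta>] by linarith
      qed
      then have "norm (fourier \<phi> (\<xi> - \<eta>) * fourier_compact w \<eta>) \<le> A2 / (1 + ?t) ^ ?d * (C2 / (1 + norm \<xi>) ^ n)"
        unfolding norm_mult using A2 pt[of ?d] by (intro mult_mono) auto
      also have "\<dots> = K2 / (1 + norm \<xi>) ^ n * (1 / (1 + ?t) ^ ?d)" by (simp add: K2_def)
      also have "\<dots> \<le> K1 / (1 + norm \<xi>) ^ n * (1 / (1 + norm \<eta>) ^ ?d) + K2 / (1 + norm \<xi>) ^ n * (1 / (1 + ?t) ^ ?d)"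
        using K px pe[of ?d] by simp
      finally show ?thesis .
    qed
    also have "\<dots> \<le> (K1 + K2) / (1 + norm \<xi>) ^ n * (1 / (1 + norm \<eta>) ^ ?d)
        + (K1 + K2) / (1 + norm \<xi>) ^ n * (1 / (1 + ?t) ^ ?d)"
      using K px pe[of ?d] pt[of ?d] by (intro add_mono mult_right_mono divide_right_mono) auto
    finally show ?thesis by (simp only: distrib_left)
  qed
  let ?f1 = "\<lambda>\<eta> :: real ^ 'd. 1 / (1 + norm \<eta>) ^ ?d"
  let ?J = "integral\<^sup>L lebesgue ?f1"
  have f1: "integrable lebesgue ?f1" by (rule integrable_decay) simp
  have f2: "integrable lebesgue (\<lambda>\<eta>. ?f1 (\<xi> - \<eta>))" "(LINT \<eta>|lebesgue. ?f1 (\<xi> - \<eta>)) = ?J" for \<xi>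
    using integrable_lebesgue_affine[OF borel_measurable_integrable[OF f1], of "-1" \<xi>] f1
      integral_lebesgue_reflect[OF borel_measurable_integrable[OF f1], of \<xi>] by simp_all
  have "norm (w (\<lambda>x. \<phi> x * wave \<xi> x)) \<le> ((K1 + K2) * (2 * ?J)) / (1 + norm \<xi>) ^ n" if \<xi>: "\<xi> \<in> \<Gamma>'" for \<xi>
  proof -
    have m: "(\<lambda>\<eta>. fourier \<phi> (\<xi> - \<eta>) * fourier_compact w \<eta>) \<in> borel_measurable lebesgue"
      by (intro borel_measurable_times fourier_compact_measurable w rapid_measurable schwartz_rapid
          mult_wave_eq_fourier(2) test_schwartz \<phi>)
    have "norm (w (\<lambda>x. \<phi> x * wave \<xi> x)) \<le> (LINT \<eta>|lebesgue. (K1 + K2) / (1 + norm \<xi>) ^ n * (?f1 \<eta> + ?f1 (\<xi> - \<eta>)))"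
      unfolding compact_distribution_mult_wave[OF w \<phi>]
      by (rule norm_integral_le[OF _ m bound[OF \<xi>]]) (intro integrable_mult_right Bochner_Integration.integrable_add f1 f2)
    also have "\<dots> = (K1 + K2) / (1 + norm \<xi>) ^ n * (?J + ?J)"
      unfolding integral_mult_right_zero Bochner_Integration.integral_add[OF f1 f2(1)] f2(2) ..
    finally show ?thesis by simp
  qed
  then show ?thesis by blast
qed

section \<open>Comparison of the wave-front sets\<close>

lemma compact_imp_distribution:
  fixes w :: "'d::finite functional"
  assumes "compact_distribution w"
  shows "distribution w"
  unfolding distribution_def
proof (intro conjI allI impI)
  show "linear_functional_on test_fns w"
    by (rule linear_functional_on_subset[of smooth_fns])
      (use assms test_smooth in \<open>auto simp: compact_distribution_def\<close>)
  fix K :: "(real ^ 'd) set"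
  obtain C m where C: "0 \<le> C" "\<And>\<phi> K. \<phi> \<in> smooth_fns \<Longrightarrow>
    (\<And>\<alpha> x. length \<alpha> \<le> m \<Longrightarrow> norm x \<le> real m \<Longrightarrow> norm (partials \<alpha> \<phi> x) \<le> K) \<Longrightarrow> norm (w \<phi>) \<le> C * K"
    using compact_distribution_bound[OF assms] by blast
  have "norm (w \<phi>) \<le> C * test_seminorm m \<phi>" if "\<phi> \<in> test_fns" for \<phi>
    by (rule C(2)[OF test_smooth[OF that]]) (rule le_test_seminorm[OF that])
  then show "\<exists>C m. \<forall>\<phi>\<in>test_fns. supp \<phi> \<subseteq> K \<longrightarrow> norm (w \<phi>) \<le> C * test_seminorm m \<phi>" by blast
qed

lemma test_cutoff:
  fixes x0 :: "real ^ 'd::finite"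
  assumes U: "open U" "x0 \<in> U"
  shows "\<exists>\<phi>\<in>test_fns. supp \<phi> \<subseteq> U \<and> (\<exists>V. open V \<and> x0 \<in> V \<and> (\<forall>x\<in>V. \<phi> x = 1))"
proof -
  obtain r where r: "0 < r" "cball x0 r \<subseteq> U" using U open_contains_cball by blast
  \<comment> \<open>The cutoff is supported within distance \<open>9/2 * \<delta> * CARD('d)\<close>
    of x0, and 9/2 < 5.\<close>
  define \<delta> where "\<delta> = r / (5 * CARD('d))"
  have \<delta>: "0 < \<delta>" "9/2 * \<delta> * CARD('d) \<le> r" using r(1) by (auto simp: \<delta>_def)
  obtain \<phi> where \<phi>: "\<phi> \<in> test_fns" "\<And>x. norm (x - x0) \<le> \<delta> / 2 \<Longrightarrow> \<phi> x = 1"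
    "\<And>x. \<phi> x \<noteq> 0 \<Longrightarrow> norm (x - x0) \<le> 9/2 * \<delta> * CARD('d)"
    using hoermander_cutoffs[OF \<delta>(1), of x0] by (metis order_refl)
  have "supp \<phi> \<subseteq> cball x0 r"
    using \<phi>(3) \<delta>(2) by (intro supp_subset) (fastforce simp: dist_norm norm_minus_commute)+
  moreover have "\<forall>x\<in>ball x0 (\<delta> / 2). \<phi> x = 1"
    using \<phi>(2) by (simp add: dist_norm norm_minus_commute)
  ultimately show ?thesis
    using \<phi>(1) r(2) \<delta>(1) by (intro bexI[of _ \<phi>] conjI exI[of _ "ball x0 (\<delta> / 2)"]) auto
qed

text \<open>Decay of one fixed order n implies membership in B, so the analytic estimate is used for
  a single index only. On the support of \<phi> the distribution f is that member of the sequence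
  plus g, and g contributes a convolution that lies in B.\<close>

lemma WF_FB_subset_WF_A:
  fixes B :: "'d::finite fn set"
  assumes BF: "translation_invariant_BF_space v B nrm" and g: "g \<in> fourier_BF B"
    and \<xi>0: "\<xi>0 \<noteq> 0" and not_A: "(x0, \<xi>0) \<notin> WF_A (\<lambda>\<phi>. f \<phi> - g \<phi>)"
  shows "(x0, \<xi>0) \<notin> WF_FB B f"
proof -
  let ?c = "fourier_const TYPE('d)"
  obtain U \<Gamma> C w where U: "open U" "x0 \<in> U" and \<Gamma>: "open_conic_nbhd \<xi>0 \<Gamma>"
    and w: "bounded_compact_distributions (w ` {1..})"
    and W: "\<forall>N::nat\<ge>1. equal_on_open U (w N) (\<lambda>\<phi>. f \<phi> - g \<phi>) \<and>
      (\<forall>\<xi>\<in>\<Gamma>. norm (fourier_compact (w N) \<xi>) \<le> C * (C * (real N + 1) / norm \<xi>) ^ N)"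
    using not_A \<xi>0 unfolding WF_A_def by blast
  have wU: "equal_on_open U (w N) (\<lambda>\<phi>. f \<phi> - g \<phi>)" if "1 \<le> N" for N using W that by blast
  have w\<Gamma>: "norm (fourier_compact (w N) \<xi>) \<le> C * (C * (real N + 1) / norm \<xi>) ^ N"
    if "1 \<le> N" "\<xi> \<in> \<Gamma>" for N \<xi> using W that by blast
  obtain b where gt: "tempered_distribution g" and b: "b \<in> B" "is_function (fourier_tempered g) b"
    using g by (auto simp: fourier_BF_def)
  obtain n where n: "\<And>h K. h \<in> borel_measurable lebesgue \<Longrightarrow> (\<And>x. norm (h x) \<le> K / (1 + norm x) ^ n) \<Longrightarrow> h \<in> B"
    using BF_space_decay_mem[OF BF] by blast
  \<comment> \<open>The index must be at least n for the decay, and at least 1 because the sequence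
    starts there.\<close>
  define N where "N = max n 1"
  have N: "1 \<le> N" "n \<le> N" by (auto simp: N_def)
  have wN: "compact_distribution (w N)" using w N(1) by (auto simp: bounded_compact_distributions_def)
  obtain \<phi> V where \<phi>: "\<phi> \<in> test_fns" "supp \<phi> \<subseteq> U" and V: "open V" "x0 \<in> V" "\<forall>x\<in>V. \<phi> x = 1"
    using test_cutoff[OF U] by blast
  obtain \<Gamma>' \<epsilon> where \<Gamma>': "open_conic_nbhd \<xi>0 \<Gamma>'" and \<epsilon>: "0 < \<epsilon>" "\<epsilon> \<le> 1/2"
    and sep: "\<And>\<xi> \<eta>. \<xi> \<in> \<Gamma>' \<Longrightarrow> \<eta> \<notin> \<Gamma> \<Longrightarrow> \<epsilon> * norm \<xi> \<le> norm (\<xi> - \<eta>)"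
    using cone_separation[OF \<Gamma>] by blast
  have "\<exists>K. \<forall>\<xi>\<in>\<Gamma>'. norm (w N (\<lambda>x. \<phi> x * wave \<xi> x)) \<le> K / (1 + norm \<xi>) ^ N"
  proof (rule localised_fourier_decay[OF wN \<phi>(1) \<epsilon> sep])
    show "norm (fourier_compact (w N) \<eta>) \<le> (C * (C * (real N + 1)) ^ N) / norm \<eta> ^ N" if "\<eta> \<in> \<Gamma>" for \<eta>
      using w\<Gamma>[OF N(1) that] by (simp add: power_divide)
    show "0 \<notin> \<Gamma>" using \<Gamma> by (simp add: open_conic_nbhd_def)
  qed
  then obtain K where K: "\<And>\<xi>. \<xi> \<in> \<Gamma>' \<Longrightarrow> norm (w N (\<lambda>x. \<phi> x * wave \<xi> x)) \<le> K / (1 + norm \<xi>) ^ N" by blast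
  have \<Gamma>'m: "\<Gamma>' \<in> sets lebesgue" using \<Gamma>' by (auto simp: open_conic_nbhd_def intro: lebesgue_openin)
  have im: "(\<lambda>\<xi>. indicator \<Gamma>' \<xi> :: complex) \<in> borel_measurable lebesgue"
    by (rule borel_measurable_indicator[OF \<Gamma>'m])
  \<comment> \<open>Up to the positive factor \<open>?c\<close> this is the transform of a compactly
    supported distribution, hence continuous in \<xi>.\<close>
  have m1: "(\<lambda>\<xi>. w N (\<lambda>x. \<phi> x * wave \<xi> x)) \<in> borel_measurable lebesgue"
  proof -
    have "compact_distribution (mult_distribution \<phi> (w N))"
      by (rule mult_distribution_compact[OF compact_imp_distribution[OF wN] \<phi>(1)])
    from fourier_compact_measurable[OF this]
    have "(\<lambda>\<xi>. (1 / ?c) *\<^sub>R fourier_compact (mult_distribution \<phi> (w N)) \<xi>) \<in> borel_measurable lebesgue"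
      by (intro borel_measurable_scaleR borel_measurable_const)
    then show ?thesis using fourier_const_pos[where 'd = 'd] by (simp add: fourier_compact_mult)
  qed
  have B1: "(\<lambda>\<xi>. w N (\<lambda>x. \<phi> x * wave \<xi> x) * indicator \<Gamma>' \<xi>) \<in> B"
  proof (rule n)
    show "(\<lambda>\<xi>. w N (\<lambda>x. \<phi> x * wave \<xi> x) * indicator \<Gamma>' \<xi>) \<in> borel_measurable lebesgue"
      by (intro borel_measurable_times m1 im)
    fix \<xi> :: "real ^ 'd"
    have "K / (1 + norm \<xi>) ^ N \<le> \<bar>K\<bar> / (1 + norm \<xi>) ^ n"
      using N(2) by (intro frac_le one_plus_norm_pos power_increasing) auto
    then have "\<xi> \<in> \<Gamma>' \<Longrightarrow> norm (w N (\<lambda>x. \<phi> x * wave \<xi> x)) \<le> \<bar>K\<bar> / (1 + norm \<xi>) ^ n"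
      using K[of \<xi>] by linarith
    then show "norm (w N (\<lambda>x. \<phi> x * wave \<xi> x) * indicator \<Gamma>' \<xi>) \<le> \<bar>K\<bar> / (1 + norm \<xi>) ^ n"
      by (cases "\<xi> \<in> \<Gamma>'") (auto simp: indicator_def)
  qed
  have "fourier \<phi> \<in> weighted_L1 v"
  proof -
    obtain D k where D: "0 \<le> D" "\<And>x. v x \<le> D * (1 + norm x) ^ k" using BF_space_weight(1)[OF BF] by blast
    have S: "fourier \<phi> \<in> schwartz_fns" by (intro schwartz_fourier test_schwartz \<phi>)
    obtain A where A: "\<And>x. (1 + norm x) ^ (k + 2 * CARD('d)) * norm (fourier \<phi> x) \<le> A"
      using schwartz_bound[OF S, of "k + 2 * CARD('d)" "[]"] by auto
    show ?thesis
    proof (rule weighted_L1_decay[OF BF_space_weight(2,3)[OF BF] D])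
      show "fourier \<phi> \<in> borel_measurable lebesgue" by (intro rapid_measurable schwartz_rapid S)
      show "norm (fourier \<phi> x) \<le> A / (1 + norm x) ^ (k + 2 * CARD('d))" for x
        using A[of x] one_plus_norm_pos[of x "k + 2 * CARD('d)"] by (simp add: pos_le_divide_eq mult.commute)
    qed
  qed
  then have conv: "convolve (fourier \<phi>) b \<in> B" by (rule BF_space_convolve[OF BF b(1)])
  have B2: "(\<lambda>\<xi>. convolve (fourier \<phi>) b \<xi> * indicator \<Gamma>' \<xi>) \<in> B"
  proof (rule BF_space_solid[OF BF conv, where C = 1])
    show "(\<lambda>\<xi>. convolve (fourier \<phi>) b \<xi> * indicator \<Gamma>' \<xi>) \<in> borel_measurable lebesgue"
      by (intro borel_measurable_times im BF_space_measurable[OF BF conv])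
  qed (auto simp: indicator_def)
  have "fourier_compact (mult_distribution \<phi> f) \<xi> * indicator \<Gamma>' \<xi>
     = of_real ?c * (w N (\<lambda>x. \<phi> x * wave \<xi> x) * indicator \<Gamma>' \<xi> + convolve (fourier \<phi>) b \<xi> * indicator \<Gamma>' \<xi>)" for \<xi>
  proof -
    have t: "(\<lambda>x. \<phi> x * wave \<xi> x) \<in> test_fns" by (intro test_mult \<phi> smooth_wave)
    have "supp (\<lambda>x. \<phi> x * wave \<xi> x) \<subseteq> U" using supp_mult_subset[of \<phi> "wave \<xi>"] \<phi>(2) by blast
    then have "w N (\<lambda>x. \<phi> x * wave \<xi> x) = f (\<lambda>x. \<phi> x * wave \<xi> x) - g (\<lambda>x. \<phi> x * wave \<xi> x)"
      using wU[OF N(1)] t by (auto simp: equal_on_open_def)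
    moreover have "g (\<lambda>x. \<phi> x * wave \<xi> x) = convolve (fourier \<phi>) b \<xi>"
      by (rule fourier_BF_mult_wave[OF BF gt b \<phi>(1)])
    ultimately have "f (\<lambda>x. \<phi> x * wave \<xi> x) = w N (\<lambda>x. \<phi> x * wave \<xi> x) + convolve (fourier \<phi>) b \<xi>" by simp
    then show ?thesis by (simp add: fourier_compact_mult scaleR_conv_of_real algebra_simps)
  qed
  then have "(\<lambda>\<xi>. fourier_compact (mult_distribution \<phi> f) \<xi> * indicator \<Gamma>' \<xi>) \<in> B"
    using BF_space_cmult[OF BF BF_space_add[OF BF B1 B2], of "of_real ?c"] by presburger
  then show ?thesis using \<Gamma>' \<phi>(1) V by (auto simp: WF_FB_def)
qed

text \<open>Since \<open>n = N + k\<close> derivatives of the cutoff are controlled, \<open>k\<close> of them remain to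
  compensate polynomial growth; the resulting factor \<open>(N + 1) ^ k\<close> is at most \<open>(2 ^ k) ^ N\<close>.\<close>

lemma hoermander_cutoff_fourier:
  fixes x0 :: "real ^ 'd::finite"
  assumes \<delta>: "0 < \<delta>" and k: "1 \<le> k"
  shows "\<exists>A\<ge>0. \<forall>N. \<forall>\<kappa>\<in>test_fns. (\<forall>x. \<kappa> x \<noteq> 0 \<longrightarrow> norm (x - x0) \<le> r) \<longrightarrow>
     (\<forall>i. \<forall>j\<le>N + k. \<forall>x. norm (partials (replicate j i) \<kappa> x) \<le> (real (N + k) / \<delta>) ^ j) \<longrightarrow>
     (\<forall>\<zeta>. norm \<zeta> ^ N * (1 + norm \<zeta>) ^ k * norm (fourier \<kappa> \<zeta>) \<le> A * (A * (real N + 1)) ^ N)"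
proof -
  let ?c = "fourier_const TYPE('d)" and ?d = "real CARD('d)"
  define V where "V = ?c * measure lebesgue (cball x0 r)"
  have V: "0 \<le> V" using fourier_const_pos[where 'd = 'd] by (simp add: V_def)
  \<comment> \<open>The maximum with 1 ensures that \<open>Q * (N + k)\<close> is at least 1, so
    that the lower exponent N may be raised to N + k.\<close>
  define Q where "Q = max (?d / \<delta>) 1"
  have Q: "1 \<le> Q" "?d / \<delta> \<le> Q" by (auto simp: Q_def)
  define R where "R = Q * real (k + 1)"
  have R: "1 \<le> R" using mult_mono[OF Q(1), of 1 "real (k + 1)"] Q(1) by (simp add: R_def)
  \<comment> \<open>The same constant stands in front and in the base of the power, so
    \<open>A\<close> is the larger of the two that arise.\<close>
  define A where "A = max (2 ^ (k + 1) * V * R ^ k) (2 ^ k * R)"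
  have "0 \<le> 2 ^ k * R" using R by simp
  then have A0: "0 \<le> A" by (auto simp: A_def le_max_iff_disj)
  have "norm \<zeta> ^ N * (1 + norm \<zeta>) ^ k * norm (fourier \<kappa> \<zeta>) \<le> A * (A * (real N + 1)) ^ N"
    if \<kappa>: "\<kappa> \<in> test_fns" and supp: "\<And>x. \<kappa> x \<noteq> 0 \<Longrightarrow> norm (x - x0) \<le> r"
      and le: "\<And>i j x. j \<le> N + k \<Longrightarrow> norm (partials (replicate j i) \<kappa> x) \<le> (real (N + k) / \<delta>) ^ j" for N \<kappa> \<zeta>
  proof -
    let ?n = "N + k"
    have S: "\<kappa> \<in> schwartz_fns" by (rule test_schwartz[OF \<kappa>])
    have supp': "supp \<kappa> \<subseteq> cball x0 r"
      using supp by (intro supp_subset) (auto simp: dist_norm norm_minus_commute)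
    have fp: "fourier (partials (replicate j i) \<kappa>) \<zeta> = (\<i> * complex_of_real (\<zeta> $ i)) ^ j * fourier \<kappa> \<zeta>" for i j
      by (induction j) (auto simp: partials_Cons fourier_partial schwartz_partials S)
    have comp: "\<bar>\<zeta> $ i\<bar> ^ j * norm (fourier \<kappa> \<zeta>) \<le> V * (real ?n / \<delta>) ^ j" if j: "j \<le> ?n" for i j
    proof -
      have "\<bar>\<zeta> $ i\<bar> ^ j * norm (fourier \<kappa> \<zeta>) = norm (fourier (partials (replicate j i) \<kappa>) \<zeta>)"
        by (simp add: fp norm_mult norm_power)
      also have "\<dots> \<le> ?c * (LINT x|lebesgue. norm (partials (replicate j i) \<kappa> x))"
        by (rule norm_fourier_le)
      also have "(LINT x|lebesgue. norm (partials (replicate j i) \<kappa> x))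
          \<le> (LINT x|lebesgue. indicator (cball x0 r) x *\<^sub>R (real ?n / \<delta>) ^ j)"
      proof (rule integral_mono)
        show "integrable lebesgue (\<lambda>x. norm (partials (replicate j i) \<kappa> x))"
          by (intro integrable_norm rapid_integrable schwartz_rapid schwartz_partials S)
        show "integrable lebesgue (\<lambda>x. indicator (cball x0 r) x *\<^sub>R (real ?n / \<delta>) ^ j)"
          using emeasure_lborel_cball_finite[of x0 r]
          by (intro integrable_scaleR_left) (simp add: integrable_indicator_iff)
        show "norm (partials (replicate j i) \<kappa> x) \<le> indicator (cball x0 r) x *\<^sub>R (real ?n / \<delta>) ^ j" for x
        proof (cases "x \<in> cball x0 r")
          case True
          then show ?thesis using le[OF j] by (simp add: indicator_simps(1)[OF True])
        next
          case False
          then have "partials (replicate j i) \<kappa> x = 0" using supp' by (intro partials_outside_supp) blast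
          then show ?thesis by (simp add: indicator_simps(2)[OF False])
        qed
      qed
      also have "(LINT x|lebesgue. indicator (cball x0 r) x *\<^sub>R (real ?n / \<delta>) ^ j)
          = measure lebesgue (cball x0 r) * (real ?n / \<delta>) ^ j"
        by simp
      finally show ?thesis using fourier_const_pos[where 'd = 'd] by (simp add: V_def mult_left_mono mult.assoc)
    qed
    \<comment> \<open>A coordinate of maximal modulus is comparable to norm \<zeta>, so derivatives
      in a single direction are enough.\<close>
    obtain i where i: "\<And>l. \<bar>\<zeta> $ l\<bar> \<le> \<bar>\<zeta> $ i\<bar>"
    proof -
      have "Max (range (\<lambda>l. \<bar>\<zeta> $ l\<bar>)) \<in> range (\<lambda>l. \<bar>\<zeta> $ l\<bar>)" by (intro Max_in) auto
      then obtain i where "Max (range (\<lambda>l. \<bar>\<zeta> $ l\<bar>)) = \<bar>\<zeta> $ i\<bar>" by blast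
      then have "\<bar>\<zeta> $ l\<bar> \<le> \<bar>\<zeta> $ i\<bar>" for l using Max_ge[of "range (\<lambda>l. \<bar>\<zeta> $ l\<bar>)" "\<bar>\<zeta> $ l\<bar>"] by simp
      then show ?thesis using that by blast
    qed
    have nle: "norm \<zeta> \<le> ?d * \<bar>\<zeta> $ i\<bar>"
      using norm_le_l1_cart[of \<zeta>] sum_bounded_above[of UNIV "\<lambda>l. \<bar>\<zeta> $ l\<bar>" "\<bar>\<zeta> $ i\<bar>"] i by simp
    have pw: "norm \<zeta> ^ j * norm (fourier \<kappa> \<zeta>) \<le> V * (Q * ?n) ^ j" if j: "j \<le> ?n" for j
    proof -
      have "norm \<zeta> ^ j * norm (fourier \<kappa> \<zeta>) \<le> (?d * \<bar>\<zeta> $ i\<bar>) ^ j * norm (fourier \<kappa> \<zeta>)"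
        by (intro mult_right_mono power_mono nle) auto
      also have "\<dots> = ?d ^ j * (\<bar>\<zeta> $ i\<bar> ^ j * norm (fourier \<kappa> \<zeta>))" by (simp add: power_mult_distrib)
      also have "\<dots> \<le> ?d ^ j * (V * (real ?n / \<delta>) ^ j)" by (intro mult_left_mono comp j) auto
      also have "\<dots> = V * (?d / \<delta> * real ?n) ^ j" by (simp add: power_mult_distrib power_divide)
      also have "\<dots> \<le> V * (Q * ?n) ^ j"
        using V \<delta> by (intro mult_left_mono power_mono mult_right_mono Q) auto
      finally show ?thesis .
    qed
    have Qn: "1 \<le> Q * ?n" using mult_mono[OF Q(1), of 1 "real ?n"] k Q(1) by simp
    have "norm \<zeta> ^ N * (1 + norm \<zeta>) ^ k * norm (fourier \<kappa> \<zeta>)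
        \<le> norm \<zeta> ^ N * (2 ^ k * (1 + norm \<zeta> ^ k)) * norm (fourier \<kappa> \<zeta>)"
      by (intro mult_right_mono mult_left_mono one_plus_power_le) auto
    also have "\<dots> = 2 ^ k * (norm \<zeta> ^ N * norm (fourier \<kappa> \<zeta>) + norm \<zeta> ^ (N + k) * norm (fourier \<kappa> \<zeta>))"
      by (simp add: algebra_simps power_add)
    also have "\<dots> \<le> 2 ^ k * (V * (Q * ?n) ^ N + V * (Q * ?n) ^ (N + k))"
      by (intro mult_left_mono add_mono pw) auto
    also have "\<dots> \<le> 2 ^ k * (V * (Q * ?n) ^ (N + k) + V * (Q * ?n) ^ (N + k))"
      using V Qn by (intro mult_left_mono add_mono power_increasing) auto
    also have "\<dots> = 2 ^ (k + 1) * V * (Q * ?n) ^ (N + k)" by simp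
    also have "\<dots> \<le> 2 ^ (k + 1) * V * (R * (real N + 1)) ^ (N + k)"
    proof (intro mult_left_mono power_mono)
      have "real ?n \<le> real (k + 1) * (real N + 1)" by (simp add: algebra_simps)
      then have "Q * real ?n \<le> Q * (real (k + 1) * (real N + 1))" using Q by (intro mult_left_mono) auto
      then show "Q * real ?n \<le> R * (real N + 1)" by (simp only: R_def mult.assoc)
    qed (use V Qn in auto)
    also have "\<dots> = 2 ^ (k + 1) * V * R ^ k * (real N + 1) ^ k * (R * (real N + 1)) ^ N"
      by (simp add: power_add power_mult_distrib)
    also have "\<dots> \<le> 2 ^ (k + 1) * V * R ^ k * (2 ^ k) ^ N * (R * (real N + 1)) ^ N"
    proof (intro mult_right_mono mult_left_mono)
      have "real N + 1 \<le> 2 ^ N"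
      proof -
        have "N < 2 ^ N" by (rule less_exp)
        then have "Suc N \<le> 2 ^ N" by (rule Suc_leI)
        then have "real (Suc N) \<le> real (2 ^ N)" by (simp only: of_nat_le_iff)
        then show ?thesis by simp
      qed
      then have "(real N + 1) ^ k \<le> (2 ^ N) ^ k" by (intro power_mono) auto
      then show "(real N + 1) ^ k \<le> (2 ^ k) ^ N" by (simp only: power_mult[symmetric] mult.commute)
    qed (use V R in auto)
    also have "\<dots> = 2 ^ (k + 1) * V * R ^ k * (2 ^ k * R * (real N + 1)) ^ N"
      by (simp add: power_mult_distrib)
    also have "\<dots> \<le> A * (A * (real N + 1)) ^ N"
      using R V A0 by (intro mult_mono power_mono mult_right_mono) (auto simp: A_def)
    finally show ?thesis .
  qed
  then show ?thesis using A0 by blast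
qed

section \<open>Elements of the Fourier image of a BF-space, and the converse inclusion\<close>

lemma fourier_BF_zero:
  assumes BF: "translation_invariant_BF_space v B nrm"
  shows "(\<lambda>\<phi>. 0) \<in> fourier_BF B"
proof -
  have "(\<lambda>x. 0) \<in> B" using BF by (auto simp: translation_invariant_BF_space_def banach_function_space_def)
  moreover have "tempered_distribution (\<lambda>\<phi>. 0)"
    by (auto simp: tempered_distribution_def linear_functional_on_def intro: exI[of _ 0])
  moreover have "is_function (fourier_tempered (\<lambda>\<phi>. 0)) (\<lambda>x. 0)"
    by (simp add: is_function_def fourier_tempered_def locally_integrable_def set_integrable_def)
  ultimately show ?thesis by (auto simp: fourier_BF_def)
qed

text \<open>The functional is the inverse transform of h: by Fourier inversion its transform is
  given by h again. The polynomial bound on h makes the pairing with transforms of Schwartz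
  functions convergent and continuous.\<close>

lemma inverse_fourier_mem_fourier_BF:
  fixes B :: "'d::finite fn set"
  assumes BF: "translation_invariant_BF_space v B nrm" and h: "h \<in> B"
    and le: "\<And>\<eta>. norm (h \<eta>) \<le> D * (1 + norm \<eta>) ^ M"
  shows "(\<lambda>\<psi>. LINT \<eta>|lebesgue. h \<eta> * fourier \<psi> (- \<eta>)) \<in> fourier_BF B" (is "?g \<in> _")
proof -
  let ?d = "2 * CARD('d)"
  let ?J = "LINT \<eta>|lebesgue. 1 / (1 + norm (\<eta> :: real ^ 'd)) ^ ?d"
  have hm: "h \<in> borel_measurable lebesgue" by (rule BF_space_measurable[OF BF h])
  have D: "0 \<le> D" using order_trans[OF norm_ge_zero le[of 0]] by simp
  have I: "integrable lebesgue (\<lambda>\<eta>. h \<eta> * fourier \<psi> (- \<eta>))" if "\<psi> \<in> schwartz_fns" for \<psi>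
    using rapid_mult_integrable[OF schwartz_rapid[OF schwartz_reflect[OF schwartz_fourier[OF that]]] hm le]
    by (simp add: mult.commute)
  have lin: "linear_functional_on schwartz_fns ?g"
    unfolding linear_functional_on_def
  proof (intro conjI ballI allI)
    fix \<phi> \<psi> :: "'d fn" assume S: "\<phi> \<in> schwartz_fns" "\<psi> \<in> schwartz_fns"
    show "?g (\<lambda>x. \<phi> x + \<psi> x) = ?g \<phi> + ?g \<psi>"
      by (simp add: fourier_add[OF S] distrib_left Bochner_Integration.integral_add[OF I[OF S(1)] I[OF S(2)]])
  next
    fix c and \<phi> :: "'d fn"
    have "(LINT \<eta>|lebesgue. c * (h \<eta> * fourier \<phi> (- \<eta>))) = c * ?g \<phi>" by (rule integral_mult_right_zero)
    then show "?g (\<lambda>x. c * \<phi> x) = c * ?g \<phi>" by (simp add: fourier_cmult mult.left_commute)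
  qed
  obtain A where A: "0 \<le> A" "\<And>\<psi> \<eta>. \<psi> \<in> schwartz_fns \<Longrightarrow>
     (1 + norm \<eta>) ^ (M + ?d) * norm (fourier \<psi> (\<eta> :: real ^ 'd)) \<le> A * schwartz_seminorm (M + ?d + ?d) \<psi>"
    using fourier_decay by blast
  have "norm (?g \<psi>) \<le> (D * A * ?J) * schwartz_seminorm (M + ?d + ?d) \<psi>" if \<psi>: "\<psi> \<in> schwartz_fns" for \<psi>
  proof -
    let ?S = "schwartz_seminorm (M + ?d + ?d) \<psi>"
    have "norm (?g \<psi>) \<le> (D * (A * ?S)) * ?J"
    proof (rule integral_decay_le[OF borel_measurable_integrable[OF I[OF \<psi>]]])
      fix \<eta> :: "real ^ 'd"
      have p: "0 < (1 + norm \<eta>) ^ j" for j by (rule one_plus_norm_pos)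
      have "(1 + norm \<eta>) ^ ?d * norm (h \<eta> * fourier \<psi> (- \<eta>))
          \<le> (1 + norm \<eta>) ^ ?d * (D * (1 + norm \<eta>) ^ M * norm (fourier \<psi> (- \<eta>)))"
        unfolding norm_mult by (intro mult_left_mono mult_right_mono le) auto
      also have "\<dots> = D * ((1 + norm (- \<eta>)) ^ (M + ?d) * norm (fourier \<psi> (- \<eta>)))"
        by (simp add: power_add mult_ac)
      also have "\<dots> \<le> D * (A * ?S)" by (intro mult_left_mono A \<psi> D)
      finally show "norm (h \<eta> * fourier \<psi> (- \<eta>)) \<le> D * (A * ?S) / (1 + norm \<eta>) ^ ?d"
        using p[of ?d] by (simp add: pos_le_divide_eq mult.commute)
    qed simp
    then show ?thesis by (simp add: mult_ac)
  qed
  with lin have "tempered_distribution ?g" unfolding tempered_distribution_def by blast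
  moreover have "is_function (fourier_tempered ?g) h"
    unfolding is_function_def fourier_tempered_def
    using BF_space_locally_integrable[OF BF h] by (simp add: fourier_inversion test_schwartz)
  ultimately show ?thesis using h by (auto simp: fourier_BF_def)
qed

text \<open>Up to a constant, the transform of \<kappa> (f - g) at \<xi> is the integral of
  F(\<kappa>)(\<xi> - \<eta>) F(\<phi> f)(\<eta>) over the \<eta> outside \<Gamma>. There norm
  (\<xi> - \<eta>) >= \<epsilon> norm \<xi>, so N powers of the decay of F(\<kappa>) give the N-th
  power of 1 / norm \<xi>, and k further powers pay for growth and integrability in \<eta>.\<close>

lemma WF_A_subset_WF_FB:
  fixes B :: "'d::finite fn set"
  assumes BF: "translation_invariant_BF_space v B nrm" and f: "distribution f"
    and \<xi>0: "\<xi>0 \<noteq> 0" and not_FB: "(x0, \<xi>0) \<notin> WF_FB B f"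
  shows "\<exists>g\<in>fourier_BF B. (x0, \<xi>0) \<notin> WF_A (\<lambda>\<phi>. f \<phi> - g \<phi>)"
proof -
  let ?c = "fourier_const TYPE('d)"
  obtain \<Gamma> \<phi> U where \<Gamma>: "open_conic_nbhd \<xi>0 \<Gamma>" and \<phi>: "\<phi> \<in> test_fns"
    and U: "open U" "x0 \<in> U" "\<forall>x\<in>U. \<phi> x = 1"
    and hB: "(\<lambda>\<xi>. fourier_compact (mult_distribution \<phi> f) \<xi> * indicator \<Gamma> \<xi>) \<in> B"
    using not_FB \<xi>0 unfolding WF_FB_def by blast
  define W where "W = mult_distribution \<phi> f"
  have W: "compact_distribution W" unfolding W_def by (rule mult_distribution_compact[OF f \<phi>])
  define h where "h = (\<lambda>\<xi>. fourier_compact W \<xi> * indicator \<Gamma> \<xi>)"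
  have h: "h \<in> B" using hB by (simp add: h_def W_def)
  obtain D M where D: "0 \<le> D" "\<And>\<eta>. norm (fourier_compact W \<eta>) \<le> D * (1 + norm \<eta>) ^ M"
    using fourier_compact_bound[OF W] by blast
  have hD: "norm (h \<eta>) \<le> D * (1 + norm \<eta>) ^ M" for \<eta>
    using D(2)[of \<eta>] D(1) one_plus_norm_pos[of \<eta> M] by (auto simp: h_def indicator_def)
  define g where "g = (\<lambda>\<psi>. LINT \<eta>|lebesgue. h \<eta> * fourier \<psi> (- \<eta>))"
  have g: "g \<in> fourier_BF B" unfolding g_def by (rule inverse_fourier_mem_fourier_BF[OF BF h hD])
  define u where "u = (\<lambda>\<phi>. f \<phi> - g \<phi>)"
  have u: "distribution u"
    unfolding u_def using g by (intro distribution_diff f tempered_imp_distribution) (auto simp: fourier_BF_def)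
  obtain r where r: "0 < r" "cball x0 r \<subseteq> U" using U open_contains_cball by blast
  \<comment> \<open>All cutoffs are then supported in \<open>cball x0 r\<close>, where \<phi> is 1;
    again 9/2 < 5.\<close>
  define \<delta> where "\<delta> = r / (5 * CARD('d))"
  have \<delta>: "0 < \<delta>" "9/2 * \<delta> * CARD('d) \<le> r" using r(1) by (auto simp: \<delta>_def)
  \<comment> \<open>M powers against the growth of F(\<phi> f), and the remaining ones for
    integrability.\<close>
  define k where "k = M + 2 * CARD('d)"
  have k: "1 \<le> k" unfolding k_def by (simp add: Suc_leI)
  obtain Bd where Bd: "\<forall>N\<ge>1. \<exists>\<kappa>\<in>test_fns. (\<forall>x. norm (x - x0) \<le> \<delta> / 2 \<longrightarrow> \<kappa> x = 1) \<and>
     (\<forall>x. \<kappa> x \<noteq> 0 \<longrightarrow> norm (x - x0) \<le> 9/2 * \<delta> * CARD('d)) \<and>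
     (\<forall>x. \<exists>r. 0 \<le> r \<and> r \<le> 1 \<and> \<kappa> x = complex_of_real r) \<and>
     (\<forall>\<alpha> x. norm (partials \<alpha> \<kappa> x) \<le> Bd \<alpha>) \<and>
     (\<forall>i. \<forall>j\<le>N. \<forall>x. norm (partials (replicate j i) \<kappa> x) \<le> (real N / \<delta>) ^ j)"
    using hoermander_cutoffs[OF \<delta>(1), of x0] by blast
  have "\<exists>\<kappa>. \<forall>N\<in>{1..}. \<kappa> N \<in> test_fns \<and> (\<forall>x. norm (x - x0) \<le> \<delta> / 2 \<longrightarrow> \<kappa> N x = 1) \<and>
     (\<forall>x. \<kappa> N x \<noteq> 0 \<longrightarrow> norm (x - x0) \<le> 9/2 * \<delta> * CARD('d)) \<and>
     (\<forall>\<alpha> x. norm (partials \<alpha> (\<kappa> N) x) \<le> Bd \<alpha>) \<and>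
     (\<forall>i. \<forall>j\<le>N. \<forall>x. norm (partials (replicate j i) (\<kappa> N) x) \<le> (real N / \<delta>) ^ j)"
  proof (intro bchoice ballI)
    fix N :: nat assume "N \<in> {1..}"
    then have "1 \<le> N" by simp
    from Bd[rule_format, OF this]
    show "\<exists>\<kappa>. \<kappa> \<in> test_fns \<and> (\<forall>x. norm (x - x0) \<le> \<delta> / 2 \<longrightarrow> \<kappa> x = 1) \<and>
     (\<forall>x. \<kappa> x \<noteq> 0 \<longrightarrow> norm (x - x0) \<le> 9/2 * \<delta> * CARD('d)) \<and>
     (\<forall>\<alpha> x. norm (partials \<alpha> \<kappa> x) \<le> Bd \<alpha>) \<and>
     (\<forall>i. \<forall>j\<le>N. \<forall>x. norm (partials (replicate j i) \<kappa> x) \<le> (real N / \<delta>) ^ j)"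
      by (elim bexE conjE) (intro exI conjI)
  qed
  then obtain \<kappa> where all: "\<forall>N\<in>{1..}. \<kappa> N \<in> test_fns \<and> (\<forall>x. norm (x - x0) \<le> \<delta> / 2 \<longrightarrow> \<kappa> N x = 1) \<and>
     (\<forall>x. \<kappa> N x \<noteq> 0 \<longrightarrow> norm (x - x0) \<le> 9/2 * \<delta> * CARD('d)) \<and>
     (\<forall>\<alpha> x. norm (partials \<alpha> (\<kappa> N) x) \<le> Bd \<alpha>) \<and>
     (\<forall>i. \<forall>j\<le>N. \<forall>x. norm (partials (replicate j i) (\<kappa> N) x) \<le> (real N / \<delta>) ^ j)" ..
  have \<kappa>: "\<kappa> N \<in> test_fns" "norm (x - x0) \<le> \<delta> / 2 \<Longrightarrow> \<kappa> N x = 1"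
    "\<kappa> N x \<noteq> 0 \<Longrightarrow> norm (x - x0) \<le> 9/2 * \<delta> * CARD('d)"
    "norm (partials \<alpha> (\<kappa> N) x) \<le> Bd \<alpha>"
    "j \<le> N \<Longrightarrow> norm (partials (replicate j i) (\<kappa> N) x) \<le> (real N / \<delta>) ^ j"
    if "1 \<le> N" for N x \<alpha> i j
    using bspec[OF all, of N] that by simp_all
  have supp_r: "norm (x - x0) \<le> r" if "1 \<le> N" "\<kappa> N x \<noteq> 0" for N x
    using \<kappa>(3)[OF that] \<delta>(2) by linarith
  have supp\<kappa>: "supp (\<kappa> N) \<subseteq> cball x0 r" if "1 \<le> N" for N
    using supp_r[OF that] by (intro supp_subset) (auto simp: dist_norm norm_minus_commute)
  \<comment> \<open>At stage N the estimate uses N + k derivatives of the cutoff, hence the shifted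
    index.\<close>
  define w where "w N = mult_distribution (\<kappa> (N + k)) u" for N
  have Nk: "1 \<le> N + k" for N using k by simp
  have bounded: "bounded_compact_distributions (w ` {1..})"
    unfolding bounded_compact_distributions_def
  proof (intro conjI ballI allI impI)
    show "compact_distribution z" if "z \<in> w ` {1..}" for z
      using that mult_distribution_compact[OF u \<kappa>(1)[OF Nk]] by (auto simp: w_def)
    fix X :: "'d fn set" assume X: "bounded_smooth X"
    \<comment> \<open>The bounds \<open>Bd\<close> do not depend on N, so one estimate holds for the
      whole sequence of cutoffs.\<close>
    have "\<exists>C m. 0 \<le> C \<and> (\<forall>\<kappa>\<in>\<kappa> ` {1..}. \<forall>\<psi>\<in>smooth_fns. norm (mult_distribution \<kappa> u \<psi>) \<le> C * smooth_seminorm m \<psi>)"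
    proof (rule mult_distribution_uniform_bound[OF u compact_cball[of x0 r]])
      fix z \<alpha> x assume "z \<in> \<kappa> ` {1..}"
      then obtain N where N: "z = \<kappa> N" "1 \<le> N" by auto
      show "z \<in> test_fns" "supp z \<subseteq> cball x0 r" "norm (partials \<alpha> z x) \<le> Bd \<alpha>"
        unfolding N(1) by (intro \<kappa> supp\<kappa> N(2))+
    qed
    then obtain C m where C: "0 \<le> C" "\<And>N \<psi>. 1 \<le> N \<Longrightarrow> \<psi> \<in> smooth_fns \<Longrightarrow>
        norm (mult_distribution (\<kappa> N) u \<psi>) \<le> C * smooth_seminorm m \<psi>" by auto
    obtain c where c: "\<And>\<psi>. \<psi> \<in> X \<Longrightarrow> smooth_seminorm m \<psi> \<le> c" and Xs: "X \<subseteq> smooth_fns"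
      using X unfolding bounded_smooth_def by blast
    have "norm (w N \<psi>) \<le> C * c" if "\<psi> \<in> X" for N \<psi>
      unfolding w_def using Xs that by (intro order_trans[OF C(2)[OF Nk] mult_left_mono[OF c C(1)]]) auto
    then show "\<exists>c. \<forall>z\<in>w ` {1..}. \<forall>\<psi>\<in>X. norm (z \<psi>) \<le> c" by blast
  qed
  have equal: "equal_on_open (ball x0 (\<delta> / 2)) (w N) u" for N
    unfolding equal_on_open_def
  proof (intro ballI impI)
    fix \<psi> :: "'d fn" assume \<psi>: "supp \<psi> \<subseteq> ball x0 (\<delta> / 2)"
    have "\<kappa> (N + k) x * \<psi> x = \<psi> x" for x
    proof (cases "\<psi> x = 0")
      case False
      then have "x \<in> ball x0 (\<delta> / 2)" using in_supp[of \<psi> x] \<psi> by blast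
      then have "\<kappa> (N + k) x = 1" by (intro \<kappa>(2)[OF Nk]) (simp add: dist_norm norm_minus_commute)
      then show ?thesis by simp
    qed simp
    then have "(\<lambda>x. \<kappa> (N + k) x * \<psi> x) = \<psi>" by (rule ext)
    then show "w N \<psi> = u \<psi>" by (simp add: w_def mult_distribution_def)
  qed
  obtain \<Gamma>' \<epsilon> where \<Gamma>': "open_conic_nbhd \<xi>0 \<Gamma>'" and \<epsilon>: "0 < \<epsilon>" "\<epsilon> \<le> 1/2"
    and sep: "\<And>\<xi> \<eta>. \<xi> \<in> \<Gamma>' \<Longrightarrow> \<eta> \<notin> \<Gamma> \<Longrightarrow> \<epsilon> * norm \<xi> \<le> norm (\<xi> - \<eta>)"
    using cone_separation[OF \<Gamma>] by blast
  obtain A where A: "0 \<le> A" "\<And>N \<zeta>. norm \<zeta> ^ N * (1 + norm \<zeta>) ^ k * norm (fourier (\<kappa> (N + k)) \<zeta>) \<le> A * (A * (real N + 1)) ^ N"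
  proof -
    from hoermander_cutoff_fourier[OF \<delta>(1) k, of x0 r] obtain A where "0 \<le> A" and
      A: "\<And>N \<kappa> \<zeta>. \<kappa> \<in> test_fns \<Longrightarrow> (\<forall>x. \<kappa> x \<noteq> 0 \<longrightarrow> norm (x - x0) \<le> r) \<Longrightarrow>
       (\<forall>i. \<forall>j\<le>N + k. \<forall>x. norm (partials (replicate j i) \<kappa> x) \<le> (real (N + k) / \<delta>) ^ j) \<Longrightarrow>
       norm \<zeta> ^ N * (1 + norm \<zeta>) ^ k * norm (fourier \<kappa> \<zeta>) \<le> A * (A * (real N + 1)) ^ N"
      by blast
    then show thesis using \<kappa>(1,5)[OF Nk] supp_r[OF Nk] by (intro that[of A] A) auto
  qed
  let ?f1 = "\<lambda>\<eta> :: real ^ 'd. 1 / (1 + norm \<eta>) ^ (2 * CARD('d))"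
  let ?J = "integral\<^sup>L lebesgue ?f1"
  have f1: "integrable lebesgue ?f1" by (rule integrable_decay) simp
  have J: "0 \<le> ?J" by (intro integral_nonneg_AE) auto
  define E where "E = A * D * (2 / \<epsilon>) ^ k"
  have E: "0 \<le> E" using A D \<epsilon> by (simp add: E_def)
  \<comment> \<open>The definition of \<open>WF_A\<close> uses one constant both as prefactor and as
    base.\<close>
  define C where "C = max (?c * E * ?J) (A / \<epsilon>)"
  have C: "?c * E * ?J \<le> C" "A / \<epsilon> \<le> C" by (auto simp: C_def)
  have "0 \<le> A / \<epsilon>" using A(1) \<epsilon>(1) by simp
  with C have C: "?c * E * ?J \<le> C" "A / \<epsilon> \<le> C" "0 \<le> C" by auto
  have est: "norm (fourier_compact (w N) \<xi>) \<le> C * (C * (real N + 1) / norm \<xi>) ^ N" if \<xi>: "\<xi> \<in> \<Gamma>'" for N \<xi>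
  proof -
    let ?\<kappa> = "\<kappa> (N + k)"
    have \<xi>n: "0 < norm \<xi>" using \<Gamma>' \<xi> by (auto simp: open_conic_nbhd_def)
    have t: "?\<kappa> \<in> test_fns" by (rule \<kappa>(1)[OF Nk])
    have S: "?\<kappa> \<in> schwartz_fns" by (rule test_schwartz[OF t])
    have fm: "fourier_compact W \<in> borel_measurable lebesgue" by (rule fourier_compact_measurable[OF W])
    have hm: "h \<in> borel_measurable lebesgue" by (rule BF_space_measurable[OF BF h])
    have I1: "integrable lebesgue (\<lambda>\<eta>. fourier ?\<kappa> (\<xi> - \<eta>) * fourier_compact W \<eta>)"
      by (rule rapid_mult_integrable[OF schwartz_rapid[OF mult_wave_eq_fourier(2)[OF S]] fm D(2)])
    have I2: "integrable lebesgue (\<lambda>\<eta>. fourier ?\<kappa> (\<xi> - \<eta>) * h \<eta>)"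
      by (rule rapid_mult_integrable[OF schwartz_rapid[OF mult_wave_eq_fourier(2)[OF S]] hm hD])
    \<comment> \<open>On the support of the cutoff \<phi> is 1, so f may be replaced by the
      compactly supported \<phi> f, whose transform is at hand.\<close>
    have "f (\<lambda>x. ?\<kappa> x * wave \<xi> x) = W (\<lambda>x. ?\<kappa> x * wave \<xi> x)"
    proof -
      have "\<phi> x * (?\<kappa> x * wave \<xi> x) = ?\<kappa> x * wave \<xi> x" for x
      proof (cases "?\<kappa> x = 0")
        case False
        then have "x \<in> cball x0 r" using supp_r[OF Nk False] by (simp add: dist_norm norm_minus_commute)
        then have "\<phi> x = 1" using r(2) U(3) by blast
        then show ?thesis by simp
      qed simp
      then have "(\<lambda>x. \<phi> x * (?\<kappa> x * wave \<xi> x)) = (\<lambda>x. ?\<kappa> x * wave \<xi> x)" by (rule ext)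
      then show ?thesis by (simp only: W_def mult_distribution_def)
    qed
    also have "\<dots> = (LINT \<eta>|lebesgue. fourier ?\<kappa> (\<xi> - \<eta>) * fourier_compact W \<eta>)"
      by (rule compact_distribution_mult_wave[OF W t])
    finally have fe: "f (\<lambda>x. ?\<kappa> x * wave \<xi> x) = (LINT \<eta>|lebesgue. fourier ?\<kappa> (\<xi> - \<eta>) * fourier_compact W \<eta>)" .
    have ge: "g (\<lambda>x. ?\<kappa> x * wave \<xi> x) = (LINT \<eta>|lebesgue. fourier ?\<kappa> (\<xi> - \<eta>) * h \<eta>)"
      by (simp add: g_def fourier_mult_wave) (simp add: mult.commute)
    let ?q = "\<lambda>\<eta>. fourier ?\<kappa> (\<xi> - \<eta>) * fourier_compact W \<eta> - fourier ?\<kappa> (\<xi> - \<eta>) * h \<eta>"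
    have "u (\<lambda>x. ?\<kappa> x * wave \<xi> x) = (LINT \<eta>|lebesgue. ?q \<eta>)"
      unfolding u_def fe ge by (rule Bochner_Integration.integral_diff[OF I1 I2, symmetric])
    then have eq: "fourier_compact (w N) \<xi> = ?c *\<^sub>R (LINT \<eta>|lebesgue. ?q \<eta>)"
      by (simp add: w_def fourier_compact_mult)
    have "norm (LINT \<eta>|lebesgue. ?q \<eta>) \<le> (LINT \<eta>|lebesgue. (E * (A / \<epsilon> * (real N + 1) / norm \<xi>) ^ N) * ?f1 \<eta>)"
    proof (rule norm_integral_le)
      show "integrable lebesgue (\<lambda>\<eta>. (E * (A / \<epsilon> * (real N + 1) / norm \<xi>) ^ N) * ?f1 \<eta>)"
        by (rule integrable_mult_right[OF f1])
      show "?q \<in> borel_measurable lebesgue"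
        by (intro borel_measurable_integrable Bochner_Integration.integrable_diff I1 I2)
      fix \<eta> :: "real ^ 'd"
      have p: "0 < (1 + norm \<eta>) ^ j" for j by (rule one_plus_norm_pos)
      show "norm (?q \<eta>) \<le> (E * (A / \<epsilon> * (real N + 1) / norm \<xi>) ^ N) * ?f1 \<eta>"
      proof (cases "\<eta> \<in> \<Gamma>")
        case True
        then have "?q \<eta> = 0" by (simp add: h_def)
        moreover have "0 \<le> (E * (A / \<epsilon> * (real N + 1) / norm \<xi>) ^ N) * ?f1 \<eta>"
          using E A(1) \<epsilon>(1) p[of "2 * CARD('d)"]
          by (intro mult_nonneg_nonneg zero_le_power divide_nonneg_nonneg) auto
        ultimately show ?thesis by (simp only: norm_zero)
      next
        case False
        let ?t = "norm (\<xi> - \<eta>)"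
        have le: "\<epsilon> * norm \<xi> \<le> ?t" by (rule sep[OF \<xi> False])
        have "(1 + norm \<eta>) ^ k \<le> ((2 / \<epsilon>) * (1 + ?t)) ^ k"
          by (intro power_mono separated_norm_le(2)[OF \<epsilon> le]) auto
        then have k1: "(1 + norm \<eta>) ^ k \<le> (2 / \<epsilon>) ^ k * (1 + ?t) ^ k" by (simp only: power_mult_distrib)
        have k2: "(\<epsilon> * norm \<xi>) ^ N \<le> ?t ^ N" using \<epsilon> by (intro power_mono le) auto
        have "(\<epsilon> * norm \<xi>) ^ N * (1 + norm \<eta>) ^ k * norm (fourier ?\<kappa> (\<xi> - \<eta>))
            \<le> ?t ^ N * ((2 / \<epsilon>) ^ k * (1 + ?t) ^ k) * norm (fourier ?\<kappa> (\<xi> - \<eta>))"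
          using \<epsilon> by (intro mult_right_mono mult_mono k1 k2) auto
        also have "\<dots> = (2 / \<epsilon>) ^ k * (?t ^ N * (1 + ?t) ^ k * norm (fourier ?\<kappa> (\<xi> - \<eta>)))"
          by (simp only: mult_ac)
        also have "\<dots> \<le> (2 / \<epsilon>) ^ k * (A * (A * (real N + 1)) ^ N)"
          using \<epsilon> by (intro mult_left_mono A) auto
        finally have main: "(\<epsilon> * norm \<xi>) ^ N * (1 + norm \<eta>) ^ k * norm (fourier ?\<kappa> (\<xi> - \<eta>))
          \<le> (2 / \<epsilon>) ^ k * (A * (A * (real N + 1)) ^ N)" .
        have "norm (?q \<eta>) = norm (fourier ?\<kappa> (\<xi> - \<eta>)) * norm (fourier_compact W \<eta>)"
          using False by (simp add: h_def norm_mult)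
        also have "\<dots> \<le> norm (fourier ?\<kappa> (\<xi> - \<eta>)) * (D * (1 + norm \<eta>) ^ M)"
          by (intro mult_left_mono D) auto
        also have "\<dots> \<le> (E * (A / \<epsilon> * (real N + 1) / norm \<xi>) ^ N) * ?f1 \<eta>"
        proof -
          \<comment> \<open>Here \<open>x\<close> stands for the N-th power of \<epsilon> norm
            \<xi>, while \<open>a\<close> and \<open>a'\<close> are the powers M and
            \<open>2 * CARD('d)\<close> of 1 + norm \<eta>, whose product is the k-th power. The
            factor \<open>1 / a'\<close> remains as integrable weight.\<close>
          have arith: "F * (D * a) \<le> (A * D * b) * (y / x) * (1 / a')"
            if "x * (a * a') * F \<le> b * (A * y)" "0 < x" "0 < a" "0 < a'" for F a a' b x y :: real
          proof -
            have "(F * (D * a)) * (x * a') = D * (x * (a * a') * F)" by simp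
            also have "\<dots> \<le> D * (b * (A * y))" by (intro mult_left_mono that D)
            finally have "F * (D * a) \<le> D * (b * (A * y)) / (x * a')"
              using that by (simp add: pos_le_divide_eq)
            then show ?thesis by (simp add: mult_ac)
          qed
          have "(A / \<epsilon> * (real N + 1) / norm \<xi>) ^ N = (A * (real N + 1)) ^ N / (\<epsilon> * norm \<xi>) ^ N"
            by (simp add: power_divide power_mult_distrib)
          then show ?thesis
            unfolding E_def using main \<epsilon> \<xi>n p
            by (simp only:) (intro arith, simp_all add: k_def power_add mult_ac)
        qed
        finally show ?thesis .
      qed
    qed
    also have "\<dots> = E * (A / \<epsilon> * (real N + 1) / norm \<xi>) ^ N * ?J"
      by (rule integral_mult_right_zero)
    finally have "norm (fourier_compact (w N) \<xi>) \<le> ?c * (E * (A / \<epsilon> * (real N + 1) / norm \<xi>) ^ N * ?J)"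
      unfolding eq by (rule norm_fourier_const_scaleR_le)
    also have "\<dots> = (?c * E * ?J) * (A / \<epsilon> * (real N + 1) / norm \<xi>) ^ N" by simp
    also have "\<dots> \<le> C * (C * (real N + 1) / norm \<xi>) ^ N"
    proof (intro mult_mono power_mono divide_right_mono mult_right_mono)
      show "0 \<le> A / \<epsilon> * (real N + 1) / norm \<xi>" using A(1) \<epsilon>(1) by simp
      then show "0 \<le> (A / \<epsilon> * (real N + 1) / norm \<xi>) ^ N" by simp
    qed (use C in auto)
    finally show ?thesis .
  qed
  have "open (ball x0 (\<delta> / 2))" "x0 \<in> ball x0 (\<delta> / 2)" using \<delta>(1) by auto
  then have "(x0, \<xi>0) \<notin> WF_A u"
    unfolding WF_A_def using \<Gamma>' bounded equal est by blast
  then show ?thesis using g unfolding u_def by blast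
qed

theorem proposition7p2:
  fixes v :: "real ^ 'd::finite \<Rightarrow> real"
    and B :: "(real ^ 'd \<Rightarrow> complex) set"
    and nrm :: "(real ^ 'd \<Rightarrow> complex) \<Rightarrow> real"
    and f :: "(real ^ 'd \<Rightarrow> complex) \<Rightarrow> complex"
  assumes "translation_invariant_BF_space v B nrm"
    and "distribution f"
  shows "WF_FB B f = (\<Inter>g\<in>fourier_BF B. WF_A (\<lambda>\<phi>. f \<phi> - g \<phi>))"
proof (intro set_eqI iffI)
  fix p assume "p \<in> WF_FB B f"
  moreover obtain x0 \<xi>0 where p: "p = (x0, \<xi>0)" by fastforce
  ultimately have \<xi>0: "\<xi>0 \<noteq> 0" by (simp add: WF_FB_def)
  show "p \<in> (\<Inter>g\<in>fourier_BF B. WF_A (\<lambda>\<phi>. f \<phi> - g \<phi>))"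
    using WF_FB_subset_WF_A[OF assms(1) _ \<xi>0] \<open>p \<in> WF_FB B f\<close> unfolding p by blast
next
  fix p assume A: "p \<in> (\<Inter>g\<in>fourier_BF B. WF_A (\<lambda>\<phi>. f \<phi> - g \<phi>))"
  obtain x0 \<xi>0 where p: "p = (x0, \<xi>0)" by fastforce
  \<comment> \<open>The index set contains the zero functional. Over an empty index set the
    intersection would be everything, and \<xi>0 = 0 could not be excluded.\<close>
  have "p \<in> WF_A (\<lambda>\<phi>. f \<phi> - 0)" using A fourier_BF_zero[OF assms(1)] by blast
  then have \<xi>0: "\<xi>0 \<noteq> 0" by (simp add: p WF_A_def)
  show "p \<in> WF_FB B f"
    using WF_A_subset_WF_FB[OF assms \<xi>0] A unfolding p by blast
qed

end
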